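(* Let $p\in\{1,2\}$ and let $X=(X_t,\ t\in[0,1])$ be a zero-mean Gaussian process with $X_0=0$ satisfying Assumptions (A.1) and (A.2)$_p$ (stated in the context), with local Hurst function $H(\cdot)$. Then $$R^{p,n}(X)\longrightarrow\int_0^1\Lambda_p(H(t))\,dt\quad\text{a.s. as } n\to\infty.$$
   Context: For $n>p$, put $\Delta^{p,n}_jX=\sum_{i=0}^p(-1)^{p-i}\binom{p}{i}X_{(j+i)/n}$, $j=0,\dots,n-p$, $\sigma_{p,n}^2(k)=\mathrm{E}(\Delta^{p,n}_kX)^2$, and $$R^{p,n}(X)=\frac{1}{n-p}\sum_{k=0}^{n-p-1}\frac{|\Delta^{p,n}_kX+\Delta^{p,n}_{k+1}X|}{|\Delta^{p,n}_kX|+|\Delta^{p,n}_{k+1}X|},\qquad \tfrac00:=1.$$ $\Lambda_p(H)=\lambda(\rho_p(H))$, where $\lambda(r)=\frac1\pi\arccos(-r)+\frac1\pi\sqrt{\frac{1+r}{1-r}}\log\big(\frac{2}{1+r}\big)$, $\rho_1(H)=2^{2H-1}-1$, $\rho_2(H)=\frac{-3^{2H}+2^{2H+2}-7}{8-2^{2H+1}}$. (A.1): there exist continuous functions $H(t)\in(0,1)$ and $c(t)>0$, $t\in[0,1]$, such that for every integer $j\ge1$ $$\lim_{n\to\infty}\sup_{t}\left|\frac{\mathrm{E}(X_{([nt]+j)/n}-X_{[nt]/n})^2}{(j/n)^{2H(t)}}-c(t)\right|=0,\qquad \lim_{n\to\infty}\sup_{t}\big|H(t)-H(t+\tfrac1n)\big|\log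 n=0,$$ the suprema being over those $t\in(0,1)$ for which the arguments of $X$ and $H$ lie in $[0,1]$; $[\cdot]$ is the integer part. (A.2)$_p$: there exist $d>0$, $\gamma>1/2$ and $0\le\theta<\gamma/2$ such that for all $n$ and all $1\le k<j\le n-p$, $$\big|\mathrm{E}[\Delta^{p,n}_kX\,\Delta^{p,n}_jX]\big|\le d\,\sigma_{p,n}(k)\,\sigma_{p,n}(j)\,n^{\theta}\,|j-k|^{-\gamma}.$$ *)

theory Defs
  imports "HOL-Probability.Probability"
begin

text \<open>Gaussian laws may be degenerate; the library density \<^const>\<open>normal_density\<close> only covers
  positive standard deviation.\<close>

definition centered_gaussian_rv :: "'a measure \<Rightarrow> ('a \<Rightarrow> real) \<Rightarrow> bool" where
  "centered_gaussian_rv M Y \<longleftrightarrow>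
     Y \<in> borel_measurable M \<and>
     ((AE \<omega> in M. Y \<omega> = 0) \<or> (\<exists>s>0. distributed M lborel Y (normal_density 0 s)))"

definition centered_gaussian_process :: "'a measure \<Rightarrow> real set \<Rightarrow> (real \<Rightarrow> 'a \<Rightarrow> real) \<Rightarrow> bool" where
  "centered_gaussian_process M T X \<longleftrightarrow>
     (\<forall>S a. finite S \<longrightarrow> S \<subseteq> T \<longrightarrow> centered_gaussian_rv M (\<lambda>\<omega>. \<Sum>t\<in>S. a t * X t \<omega>))"

definition incr :: "nat \<Rightarrow> nat \<Rightarrow> nat \<Rightarrow> (real \<Rightarrow> real) \<Rightarrow> real" where
  "incr p n j x =
     (\<Sum>i=0..p. (-1) ^ (p - i) * real (p choose i) * x (real (j + i) / real n))"

definition incr_sd :: "'a measure \<Rightarrow> (real \<Rightarrow> 'a \<Rightarrow> real) \<Rightarrow> nat \<Rightarrow> nat \<Rightarrow> nat \<Rightarrow> real" where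
  "incr_sd M X p n k = sqrt (\<integral>\<omega>. (incr p n k (\<lambda>t. X t \<omega>))\<^sup>2 \<partial>M)"

definition incr_ratio :: "real \<Rightarrow> real \<Rightarrow> real" where
  "incr_ratio u v = (if \<bar>u\<bar> + \<bar>v\<bar> = 0 then 1 else \<bar>u + v\<bar> / (\<bar>u\<bar> + \<bar>v\<bar>))"

text \<open>Only meaningful for \<open>n > p\<close>.\<close>

definition incr_ratio_stat :: "nat \<Rightarrow> nat \<Rightarrow> (real \<Rightarrow> real) \<Rightarrow> real" where
  "incr_ratio_stat p n x =
     1 / real (n - p) * (\<Sum>k<n - p. incr_ratio (incr p n k x) (incr p n (k + 1) x))"

definition lambda_fun :: "real \<Rightarrow> real" where
  "lambda_fun r = 1 / pi * arccos (- r) + 1 / pi * sqrt ((1 + r) / (1 - r)) * ln (2 / (1 + r))"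

definition rho1 :: "real \<Rightarrow> real" where
  "rho1 h = 2 powr (2 * h - 1) - 1"

definition rho2 :: "real \<Rightarrow> real" where
  "rho2 h = (- (3 powr (2 * h)) + 2 powr (2 * h + 2) - 7) / (8 - 2 powr (2 * h + 1))"

text \<open>Only used for \<open>p \<in> {1, 2}\<close>.\<close>

definition Lambda_fun :: "nat \<Rightarrow> real \<Rightarrow> real" where
  "Lambda_fun p h = lambda_fun (if p = 1 then rho1 h else rho2 h)"

text \<open>The suprema are taken in \<^typ>\<open>ennreal\<close>, so that they always exist and an unbounded
  family has supremum infinity.\<close>

definition assumption_A1 :: "'a measure \<Rightarrow> (real \<Rightarrow> 'a \<Rightarrow> real) \<Rightarrow> (real \<Rightarrow> real) \<Rightarrow> bool" where
  "assumption_A1 M X H \<longleftrightarrow>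
     continuous_on {0..1} H \<and> (\<forall>t\<in>{0..1}. 0 < H t \<and> H t < 1) \<and>
     (\<exists>c. continuous_on {0..1} c \<and> (\<forall>t\<in>{0..1}. 0 < c t) \<and>
        (\<forall>j::nat. j \<ge> 1 \<longrightarrow>
          (\<lambda>n::nat.
             SUP t \<in> {t \<in> {0<..<1}. of_int \<lfloor>real n * t\<rfloor> / real n \<in> {0..1} \<and>
                        (of_int \<lfloor>real n * t\<rfloor> + real j) / real n \<in> {0..1}}.
               ennreal \<bar>(\<integral>\<omega>. (X ((of_int \<lfloor>real n * t\<rfloor> + real j) / real n) \<omega>
                                - X (of_int \<lfloor>real n * t\<rfloor> / real n) \<omega>)\<^sup>2 \<partial>M)
                         / (real j / real n) powr (2 * H t) - c t\<bar>)
          \<longlonglongrightarrow> 0)) \<and>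
     (\<lambda>n::nat.
        SUP t \<in> {t \<in> {0<..<1}. t + 1 / real n \<in> {0..1}}.
          ennreal (\<bar>H t - H (t + 1 / real n)\<bar> * ln (real n)))
       \<longlonglongrightarrow> 0"

definition assumption_A2 :: "nat \<Rightarrow> 'a measure \<Rightarrow> (real \<Rightarrow> 'a \<Rightarrow> real) \<Rightarrow> bool" where
  "assumption_A2 p M X \<longleftrightarrow>
     (\<exists>d \<gamma> \<theta>. d > 0 \<and> \<gamma> > 1 / 2 \<and> 0 \<le> \<theta> \<and> \<theta> < \<gamma> / 2 \<and>
        (\<forall>n k j::nat. n > p \<longrightarrow> 1 \<le> k \<longrightarrow> k < j \<longrightarrow> j \<le> n - p \<longrightarrow>
           \<bar>\<integral>\<omega>. incr p n k (\<lambda>t. X t \<omega>) * incr p n j (\<lambda>t. X t \<omega>) \<partial>M\<bar>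
             \<le> d * incr_sd M X p n k * incr_sd M X p n j
                 * real n powr \<theta> * \<bar>real j - real k\<bar> powr (- \<gamma>)))"

end

theory Submission imports Defs begin

text \<open>
  With \<open>s\<close>, \<open>d\<close> the normalised sum and difference of two adjacent increments, the increment ratio is
  \<open>\<bar>s\<bar> / max \<bar>s\<bar> \<bar>d\<bar>\<close>. By (A.1), \<open>s\<close> and \<open>d\<close> are locally asymptotically independent centred
  Gaussian variables, so that \<open>s / d\<close> is asymptotically a multiple of a Cauchy variable, which gives
  \<open>\<Lambda>\<^sub>p(H)\<close> as the local mean. As a function of \<open>x = e\<^bsup>-s\<^sup>2\<^esup>\<close> and \<open>y = e\<^bsup>-d\<^sup>2\<^esup>\<close>, the ratio is
  continuous on the unit square except at two corners, so by Stone-Weierstrass it suffices to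
  treat the monomials \<open>x\<^sup>i y\<^sup>j\<close>, and these are mixtures of cosines of Gaussian linear forms. For
  averages of cosines, almost sure convergence follows from the Borel-Cantelli lemma and a bound on
  the eighth central moment, obtained by iterating a Poincare inequality for trigonometric
  polynomials; by (A.2), the energy of an average of \<open>n\<close> cosines is \<open>O(n\<^bsup>\<theta> - \<gamma>\<^esup>)\<close>, where one may
  assume \<open>\<gamma> < 1\<close>.
\<close>

section \<open>A Poincare inequality for trigonometric polynomials of Gaussian variables\<close>

text \<open>(A.2) controls covariances only, that is, linear functionals of the increments, whereas
  the ratio is nonlinear and has unbounded slope near \<open>s = d = 0\<close>. So an inequality is
  needed that bounds the fluctuations of a smooth functional by covariances, together with an
  approximation by functionals with bounded gradients. Cosines of linear forms serve both ends:
  their gradients are bounded, their span is closed under products (so powers of an average stay in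
  the class), and their expectations depend on the variance alone. The Poincare inequality thus
  becomes a comparison of two kernels in the covariances, proved without a joint density and valid
  for degenerate laws. (A.1) gives variances only relative to a local scale that varies with
  \<open>n\<close> and \<open>t\<close>; since the ratio is homogeneous of degree 0, sum and
  difference may be divided by the same scale, and only the quotient of their limiting variances
  matters.\<close>

abbreviation std_normal :: "real measure" where "std_normal \<equiv> density lborel (\<lambda>x. ennreal (std_normal_density x))"

interpretation std_normal: prob_space std_normal
  by (rule prob_space_normal_density) simp

section \<open>Characteristic functions of centred Gaussian variables\<close>

lemma std_normal_cos: "(\<integral>z. cos (z * x) \<partial>std_normal) = exp (- x\<^sup>2 / 2)"
  and std_normal_sin: "(\<integral>z. sin (z * x) \<partial>std_normal) = 0"
proof -
  interpret S: real_distribution std_normal by (rule real_dist_normal_dist)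
  have c: "char std_normal x = of_real (exp (- x\<^sup>2 / 2))"
    by (simp add: char_std_normal_distribution exp_of_real)
  have "Re (char std_normal x) = (\<integral>z. Re (iexp (x * z)) \<partial>std_normal)"
    unfolding char_def by (rule integral_Re[symmetric]) (use std_normal.integrable_iexp in auto)
  then show "(\<integral>z. cos (z * x) \<partial>std_normal) = exp (- x\<^sup>2 / 2)"
    unfolding c Re_complex_of_real by (simp add: Re_exp mult.commute)
  have "Im (char std_normal x) = (\<integral>z. Im (iexp (x * z)) \<partial>std_normal)"
    unfolding char_def by (rule integral_Im[symmetric]) (use std_normal.integrable_iexp in auto)
  then show "(\<integral>z. sin (z * x) \<partial>std_normal) = 0"
    unfolding c Im_complex_of_real by (simp add: Im_exp mult.commute)
qed

lemma (in prob_space) centered_gaussian_rv_square_integrable: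
  assumes "centered_gaussian_rv M Y"
  shows "integrable M (\<lambda>\<omega>. (Y \<omega>)\<^sup>2)"
proof -
  have m [measurable]: "Y \<in> borel_measurable M" using assms by (simp add: centered_gaussian_rv_def)
  from assms consider "AE \<omega> in M. Y \<omega> = 0" | s where "s > 0" "distributed M lborel Y (normal_density 0 s)"
    by (auto simp: centered_gaussian_rv_def)
  then show ?thesis
  proof cases
    case 1
    have "integrable M (\<lambda>\<omega>. (Y \<omega>)\<^sup>2) \<longleftrightarrow> integrable M (\<lambda>\<omega>. 0::real)"
      by (rule integrable_cong_AE) (use 1 in auto)
    then show ?thesis by simp
  next
    case 2
    have "integrable lborel (\<lambda>x. normal_density 0 s x * (x - 0) ^ (2 * 1))"
      using 2(1) by (rule integrable_normal_moment)
    then show ?thesis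
      by (subst distributed_integrable[OF 2(2), symmetric]) auto
  qed
qed

text \<open>Together with measurability and square integrability, this is all that later arguments
  use of a Gaussian law on \<open>M\<close>. The degenerate law fits with variance 0, so the two
  cases need not be separated again.\<close>

lemma (in prob_space) centered_gaussian_rv_expectation_cos:
  assumes "centered_gaussian_rv M Y"
  shows "expectation (\<lambda>\<omega>. cos (Y \<omega>)) = exp (- expectation (\<lambda>\<omega>. (Y \<omega>)\<^sup>2) / 2)"
proof -
  have m [measurable]: "Y \<in> borel_measurable M" using assms by (simp add: centered_gaussian_rv_def)
  from assms consider "AE \<omega> in M. Y \<omega> = 0" | s where "s > 0" "distributed M lborel Y (normal_density 0 s)"
    by (auto simp: centered_gaussian_rv_def)
  then show ?thesis
  proof cases
    case 1
    have "expectation (\<lambda>\<omega>. cos (Y \<omega>)) = expectation (\<lambda>\<omega>. 1)"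
      by (rule integral_cong_AE) (use 1 in auto)
    moreover have "expectation (\<lambda>\<omega>. (Y \<omega>)\<^sup>2) = expectation (\<lambda>\<omega>. 0)"
      by (rule integral_cong_AE) (use 1 in auto)
    ultimately show ?thesis by (simp add: prob_space)
  next
    case 2
    have v: "expectation (\<lambda>\<omega>. (Y \<omega>)\<^sup>2) = s\<^sup>2"
    proof -
      have "variance Y = s\<^sup>2" "expectation Y = 0"
        using normal_distributed_variance[OF 2] normal_distributed_expectation[OF 2] by auto
      then show ?thesis by simp
    qed
    have d: "distributed M lborel (\<lambda>\<omega>. Y \<omega> / s) std_normal_density"
      using normal_standard_normal_convert[OF 2(1), of Y 0] 2(2) by simp
    then have e: "distr M lborel (\<lambda>\<omega>. Y \<omega> / s) = std_normal_distribution"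
      by (simp add: distributed_def)
    have "exp (- s\<^sup>2 / 2) = expectation (\<lambda>\<omega>. cos (Y \<omega> / s * s))"
      unfolding std_normal_cos[symmetric] e[symmetric] by (rule integral_distr) auto
    then show ?thesis using 2(1) v by simp
  qed
qed

text \<open>The Taylor coefficients \<open>1/(n-1)! - 1/n!\<close> are nonnegative, which is what
  turns the scalar inequality \<open>cosh x - 1 \<le> x sinh x\<close> into one between positive
  semidefinite kernels.\<close>

lemma mult_sinh_minus_cosh_sums:
  "(\<lambda>n. (if even n \<and> n > 0 then 1 / fact (n - 1) - 1 / fact n else 0) * x ^ n) sums (x * sinh x - (cosh x - 1))"
  for x :: real
proof -
  have "(\<lambda>n. if even n then 0 else x ^ n /\<^sub>R fact n) sums sinh x" by (rule sinh_converges)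
  then have "(\<lambda>n. x * (if even n then 0 else x ^ n /\<^sub>R fact n)) sums (x * sinh x)" by (rule sums_mult)
  moreover have "(\<lambda>n. x * (if even n then 0 else x ^ n /\<^sub>R fact n)) = (\<lambda>n. (if even (Suc n) \<and> Suc n > 0 then 1 / fact (Suc n - 1) else 0) * x ^ Suc n)"
    by (auto simp: fun_eq_iff divide_simps)
  ultimately have "(\<lambda>n. (if even (Suc n) \<and> Suc n > 0 then 1 / fact (Suc n - 1) else 0) * x ^ Suc n) sums (x * sinh x)" by simp
  from sums_Suc[OF this] have A: "(\<lambda>n. (if even n \<and> n > 0 then 1 / fact (n - 1) else 0) * x ^ n) sums (x * sinh x)" by simp
  have "(\<lambda>n. if even n then x ^ n /\<^sub>R fact n else 0) sums cosh x" by (rule cosh_converges)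
  from sums_diff[OF this sums_single[of 0 "\<lambda>_. 1::real"]]
  have B: "(\<lambda>n. (if even n then x ^ n /\<^sub>R fact n else 0) - (if n = 0 then 1 else 0)) sums (cosh x - 1)" .
  have "(\<lambda>n. (if even n \<and> n > 0 then 1 / fact (n - 1) else 0) * x ^ n - ((if even n then x ^ n /\<^sub>R fact n else 0) - (if n = 0 then 1 else 0)))
     = (\<lambda>n. (if even n \<and> n > 0 then 1 / fact (n - 1) - 1 / fact n else 0) * x ^ n)"
    by (auto simp: fun_eq_iff divide_simps algebra_simps)
  then show ?thesis using sums_diff[OF A B] by simp
qed

section \<open>Linear forms in a finite Gaussian family and their covariances\<close>

locale gaussian_family = prob_space M for M :: "'a measure" +
  fixes I :: "'i set" and Z :: "'i \<Rightarrow> 'a \<Rightarrow> real"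
  assumes finite_I: "finite I"
    and gauss: "\<And>c. centered_gaussian_rv M (\<lambda>\<omega>. \<Sum>k\<in>I. c k * Z k \<omega>)"
begin

definition lf :: "('i \<Rightarrow> real) \<Rightarrow> 'a \<Rightarrow> real" where
  "lf c \<omega> = (\<Sum>k\<in>I. c k * Z k \<omega>)"

definition cv :: "('i \<Rightarrow> real) \<Rightarrow> ('i \<Rightarrow> real) \<Rightarrow> real" where
  "cv c d = expectation (\<lambda>\<omega>. lf c \<omega> * lf d \<omega>)"

lemma gauss_lf: "centered_gaussian_rv M (lf c)"
  unfolding lf_def by (rule gauss)

lemma measurable_lf [measurable]: "lf c \<in> borel_measurable M"
  using gauss_lf[of c] by (simp add: centered_gaussian_rv_def)

lemma lf_add: "lf (\<lambda>k. c k + d k) \<omega> = lf c \<omega> + lf d \<omega>"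
  by (simp add: lf_def distrib_right sum.distrib)

lemma lf_diff: "lf (\<lambda>k. c k - d k) \<omega> = lf c \<omega> - lf d \<omega>"
  by (simp add: lf_def left_diff_distrib sum_subtractf)

lemma lf_indicator:
  assumes "k \<in> I" shows "lf (indicator {k}) = Z k"
proof
  fix \<omega>
  have "lf (indicator {k}) \<omega> = (\<Sum>l\<in>I. if l = k then Z l \<omega> else 0)"
    unfolding lf_def by (rule sum.cong) auto
  then show "lf (indicator {k}) \<omega> = Z k \<omega>" using assms finite_I by simp
qed

lemma integrable_lf_sq: "integrable M (\<lambda>\<omega>. (lf c \<omega>)\<^sup>2)"
  by (rule centered_gaussian_rv_square_integrable[OF gauss_lf])

lemma integrable_lf_mult: "integrable M (\<lambda>\<omega>. lf c \<omega> * lf d \<omega>)"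
proof -
  \<comment> \<open>Polarisation, because only squares of linear forms are known to be
    integrable.\<close>
  have "integrable M (\<lambda>\<omega>. ((lf (\<lambda>k. c k + d k) \<omega>)\<^sup>2 - (lf (\<lambda>k. c k - d k) \<omega>)\<^sup>2) / 4)"
    using integrable_lf_sq by auto
  then show ?thesis
    by (simp add: lf_add lf_diff power2_eq_square algebra_simps)
qed

lemma integrable_Z_mult: "k \<in> I \<Longrightarrow> l \<in> I \<Longrightarrow> integrable M (\<lambda>\<omega>. Z k \<omega> * Z l \<omega>)"
  using integrable_lf_mult[of "indicator {k}" "indicator {l}"] by (simp add: lf_indicator)

lemma cv_eq: "cv c d = (\<Sum>k\<in>I. \<Sum>l\<in>I. expectation (\<lambda>\<omega>. Z k \<omega> * Z l \<omega>) * c k * d l)"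
proof -
  have "cv c d = expectation (\<lambda>\<omega>. \<Sum>k\<in>I. \<Sum>l\<in>I. (c k * d l) * (Z k \<omega> * Z l \<omega>))"
    unfolding cv_def lf_def by (simp add: sum_product mult_ac)
  also have "\<dots> = (\<Sum>k\<in>I. \<Sum>l\<in>I. (c k * d l) * expectation (\<lambda>\<omega>. Z k \<omega> * Z l \<omega>))"
    by (simp add: Bochner_Integration.integral_sum integrable_Z_mult)
  finally show ?thesis by (simp add: mult_ac)
qed

lemma cv_add: "cv (\<lambda>k. c k + d k) (\<lambda>k. c k + d k) = cv c c + 2 * cv c d + cv d d"
proof -
  have "cv (\<lambda>k. c k + d k) (\<lambda>k. c k + d k)
    = expectation (\<lambda>\<omega>. lf c \<omega> * lf c \<omega> + 2 * (lf c \<omega> * lf d \<omega>) + lf d \<omega> * lf d \<omega>)"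
    unfolding cv_def by (simp add: lf_add algebra_simps)
  also have "\<dots> = cv c c + 2 * cv c d + cv d d"
    unfolding cv_def by (simp add: integrable_lf_mult)
  finally show ?thesis .
qed

lemma cv_diff: "cv (\<lambda>k. c k - d k) (\<lambda>k. c k - d k) = cv c c - 2 * cv c d + cv d d"
proof -
  have "cv (\<lambda>k. c k - d k) (\<lambda>k. c k - d k)
    = expectation (\<lambda>\<omega>. lf c \<omega> * lf c \<omega> - 2 * (lf c \<omega> * lf d \<omega>) + lf d \<omega> * lf d \<omega>)"
    unfolding cv_def by (simp add: lf_diff algebra_simps)
  also have "\<dots> = cv c c - 2 * cv c d + cv d d"
    unfolding cv_def by (simp add: integrable_lf_mult)
  finally show ?thesis .
qed

lemma expectation_cos_lf: "expectation (\<lambda>\<omega>. cos (lf c \<omega>)) = exp (- cv c c / 2)"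
  using centered_gaussian_rv_expectation_cos[OF gauss_lf[of c]] by (simp add: cv_def power2_eq_square)

lemma integrable_cos_lf [simp]: "integrable M (\<lambda>\<omega>. cos (lf c \<omega>))"
  by (rule integrable_const_bound[where B=1]) auto

lemma integrable_cos_cos [simp]: "integrable M (\<lambda>\<omega>. cos (lf c \<omega>) * cos (lf d \<omega>))"
  by (rule integrable_const_bound[where B=1]) (auto simp: abs_mult mult_le_one)

lemma integrable_sin_sin [simp]: "integrable M (\<lambda>\<omega>. sin (lf c \<omega>) * sin (lf d \<omega>))"
  by (rule integrable_const_bound[where B=1]) (auto simp: abs_mult mult_le_one)

lemma expectation_cos_cos:
  "expectation (\<lambda>\<omega>. cos (lf c \<omega>) * cos (lf d \<omega>)) = exp (- cv c c / 2) * exp (- cv d d / 2) * cosh (cv c d)"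
proof -
  have "expectation (\<lambda>\<omega>. cos (lf c \<omega>) * cos (lf d \<omega>))
      = expectation (\<lambda>\<omega>. (cos (lf (\<lambda>k. c k - d k) \<omega>) + cos (lf (\<lambda>k. c k + d k) \<omega>)) / 2)"
    by (simp add: lf_add lf_diff cos_times_cos)
  also have "\<dots> = (exp (- cv (\<lambda>k. c k - d k) (\<lambda>k. c k - d k) / 2) + exp (- cv (\<lambda>k. c k + d k) (\<lambda>k. c k + d k) / 2)) / 2"
    by (simp add: expectation_cos_lf)
  also have "\<dots> = exp (- cv c c / 2) * exp (- cv d d / 2) * cosh (cv c d)"
    by (simp add: cv_add cv_diff cosh_field_def flip: exp_add) (simp add: field_simps flip: exp_add)
  finally show ?thesis .
qed

lemma expectation_sin_sin:
  "expectation (\<lambda>\<omega>. sin (lf c \<omega>) * sin (lf d \<omega>)) = exp (- cv c c / 2) * exp (- cv d d / 2) * sinh (cv c d)"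
proof -
  have "expectation (\<lambda>\<omega>. sin (lf c \<omega>) * sin (lf d \<omega>))
      = expectation (\<lambda>\<omega>. (cos (lf (\<lambda>k. c k - d k) \<omega>) - cos (lf (\<lambda>k. c k + d k) \<omega>)) / 2)"
    by (simp add: lf_add lf_diff sin_times_sin)
  also have "\<dots> = (exp (- cv (\<lambda>k. c k - d k) (\<lambda>k. c k - d k) / 2) - exp (- cv (\<lambda>k. c k + d k) (\<lambda>k. c k + d k) / 2)) / 2"
    by (simp add: expectation_cos_lf)
  also have "\<dots> = exp (- cv c c / 2) * exp (- cv d d / 2) * sinh (cv c d)"
    by (simp add: cv_add cv_diff sinh_field_def flip: exp_add) (simp add: field_simps flip: exp_add)
  finally show ?thesis .
qed

text \<open>A special case of Schur's product theorem.\<close>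

lemma cv_power_psd:
  assumes "finite Q"
  shows "0 \<le> (\<Sum>p\<in>Q. \<Sum>q\<in>Q. a p * a q * cv (w p) (w q) ^ m)"
proof (induction m arbitrary: a)
  case 0
  have "(\<Sum>p\<in>Q. \<Sum>q\<in>Q. a p * a q * cv (w p) (w q) ^ 0) = (\<Sum>p\<in>Q. a p)\<^sup>2"
    by (simp add: power2_eq_square sum_product)
  then show ?case by simp
next
  case (Suc m)
  \<comment> \<open>The inductive hypothesis is applied for each \<open>\<omega>\<close> with the
    coefficients \<open>a p * lf (w p) \<omega>\<close>; averaging over \<open>\<omega>\<close> then
    supplies one more factor of \<open>cv\<close>.\<close>
  have "0 \<le> expectation (\<lambda>\<omega>. \<Sum>p\<in>Q. \<Sum>q\<in>Q. (a p * lf (w p) \<omega>) * (a q * lf (w q) \<omega>) * cv (w p) (w q) ^ m)"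
    by (intro Bochner_Integration.integral_nonneg Suc)
  also have "\<dots> = expectation (\<lambda>\<omega>. \<Sum>p\<in>Q. \<Sum>q\<in>Q. (a p * a q * cv (w p) (w q) ^ m) * (lf (w p) \<omega> * lf (w q) \<omega>))"
    by (simp add: mult_ac)
  also have "\<dots> = (\<Sum>p\<in>Q. \<Sum>q\<in>Q. (a p * a q * cv (w p) (w q) ^ m) * cv (w p) (w q))"
    by (simp add: Bochner_Integration.integral_sum integrable_lf_mult cv_def)
  finally show ?case by (simp add: mult_ac)
qed

text \<open>The difference of both sides is a power series in the entries of the kernel
  \<open>cv\<close> with nonnegative coefficients, and every entrywise power of \<open>cv\<close> is
  positive semidefinite.\<close>

lemma cosh_le_mult_sinh_psd:
  assumes "finite Q"
  shows "(\<Sum>p\<in>Q. \<Sum>q\<in>Q. a p * a q * (cosh (cv (w p) (w q)) - 1))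
       \<le> (\<Sum>p\<in>Q. \<Sum>q\<in>Q. a p * a q * (cv (w p) (w q) * sinh (cv (w p) (w q))))"
proof -
  define b :: "nat \<Rightarrow> real" where "b n = (if even n \<and> n > 0 then 1 / fact (n - 1) - 1 / fact n else 0)" for n
  have b: "b n \<ge> 0" for n
    by (auto simp: b_def divide_simps intro!: fact_mono)
  let ?f = "\<lambda>p q. cv (w p) (w q) * sinh (cv (w p) (w q)) - (cosh (cv (w p) (w q)) - 1)"
  have "(\<lambda>n. \<Sum>p\<in>Q. \<Sum>q\<in>Q. a p * a q * (b n * cv (w p) (w q) ^ n)) sums (\<Sum>p\<in>Q. \<Sum>q\<in>Q. a p * a q * ?f p q)"
    by (intro sums_sum sums_mult) (unfold b_def, rule mult_sinh_minus_cosh_sums)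
  moreover have "(\<Sum>p\<in>Q. \<Sum>q\<in>Q. a p * a q * (b n * cv (w p) (w q) ^ n)) \<ge> 0" for n
  proof -
    have "(\<Sum>p\<in>Q. \<Sum>q\<in>Q. a p * a q * (b n * cv (w p) (w q) ^ n)) = b n * (\<Sum>p\<in>Q. \<Sum>q\<in>Q. a p * a q * cv (w p) (w q) ^ n)"
      by (simp add: sum_distrib_left mult_ac)
    then show ?thesis using b[of n] cv_power_psd[OF assms, of a w n] by simp
  qed
  ultimately have "0 \<le> (\<Sum>p\<in>Q. \<Sum>q\<in>Q. a p * a q * ?f p q)"
    by (metis (no_types, lifting) sums_le sums_zero)
  also have "\<dots> = (\<Sum>p\<in>Q. \<Sum>q\<in>Q. a p * a q * (cv (w p) (w q) * sinh (cv (w p) (w q)))) - (\<Sum>p\<in>Q. \<Sum>q\<in>Q. a p * a q * (cosh (cv (w p) (w q)) - 1))"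
    by (simp add: right_diff_distrib sum_subtractf)
  finally show ?thesis by simp
qed

text \<open>The squared length of a gradient with components \<open>D k\<close> in the covariance
  form (carre du champ), hence the natural right-hand side of a Gaussian Poincare
  inequality.\<close>

definition energy :: "('i \<Rightarrow> 'a \<Rightarrow> real) \<Rightarrow> 'a \<Rightarrow> real" where
  "energy D \<omega> = (\<Sum>k\<in>I. \<Sum>l\<in>I. expectation (\<lambda>\<omega>. Z k \<omega> * Z l \<omega>) * D k \<omega> * D l \<omega>)"

text \<open>By bilinearity (\<open>cv_eq\<close>), the sums over \<open>I\<close> recombine
  frequencies into covariances. The energy becomes a quadratic form over \<open>Q\<close>,
  comparable with the variance.\<close>

lemma energy_sin_sum:
  "energy (\<lambda>k \<omega>. \<Sum>q\<in>Q. a q * w q k * sin (lf (w q) \<omega>)) \<omega>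
   = (\<Sum>p\<in>Q. \<Sum>q\<in>Q. (a p * a q * cv (w p) (w q)) * (sin (lf (w p) \<omega>) * sin (lf (w q) \<omega>)))" (is "?L = ?R")
proof -
  let ?t = "\<lambda>k l p q. (a p * a q) * (expectation (\<lambda>\<omega>. Z k \<omega> * Z l \<omega>) * w p k * w q l) * (sin (lf (w p) \<omega>) * sin (lf (w q) \<omega>))"
  have "?L = (\<Sum>k\<in>I. \<Sum>l\<in>I. \<Sum>p\<in>Q. \<Sum>q\<in>Q. ?t k l p q)"
    unfolding energy_def
    by (simp add: mult.assoc sum_product) (simp add: sum_distrib_left sum_distrib_right mult_ac)
  also have "\<dots> = (\<Sum>k\<in>I. \<Sum>p\<in>Q. \<Sum>l\<in>I. \<Sum>q\<in>Q. ?t k l p q)"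
    by (rule sum.cong[OF refl], rule sum.swap)
  also have "\<dots> = (\<Sum>p\<in>Q. \<Sum>k\<in>I. \<Sum>l\<in>I. \<Sum>q\<in>Q. ?t k l p q)"
    by (rule sum.swap)
  also have "\<dots> = (\<Sum>p\<in>Q. \<Sum>k\<in>I. \<Sum>q\<in>Q. \<Sum>l\<in>I. ?t k l p q)"
    by (rule sum.cong[OF refl], rule sum.cong[OF refl], rule sum.swap)
  also have "\<dots> = (\<Sum>p\<in>Q. \<Sum>q\<in>Q. \<Sum>k\<in>I. \<Sum>l\<in>I. ?t k l p q)"
    by (rule sum.cong[OF refl], rule sum.swap)
  also have "\<dots> = ?R"
    by (simp add: cv_eq sum_distrib_left sum_distrib_right mult_ac)
  finally show ?thesis .
qed

text \<open>With \<open>K = cv\<close>, the covariances of \<open>cos\<close> and \<open>sin\<close> of linear forms are, up to the same factors,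
  \<open>cosh K - 1\<close> and \<open>sinh K\<close>; the inequality is \<open>cosh K - 1 \<le> K sinh K\<close> in the sense of
  positive semidefinite kernels.\<close>

lemma poincare_cos_sum:
  assumes "finite Q"
  shows "expectation (\<lambda>\<omega>. (\<Sum>q\<in>Q. a q * cos (lf (w q) \<omega>))\<^sup>2) - (expectation (\<lambda>\<omega>. \<Sum>q\<in>Q. a q * cos (lf (w q) \<omega>)))\<^sup>2
    \<le> expectation (energy (\<lambda>k \<omega>. \<Sum>q\<in>Q. a q * w q k * sin (lf (w q) \<omega>)))"
proof -
  \<comment> \<open>The factors \<open>exp (- cv c c / 2)\<close> occur in all product moments;
    absorbing them into the coefficients makes variance and energy quadratic forms in the same
    vector \<open>b\<close>.\<close>
  define b where "b q = a q * exp (- cv (w q) (w q) / 2)" for q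
  have E1: "expectation (\<lambda>\<omega>. (\<Sum>q\<in>Q. a q * cos (lf (w q) \<omega>))\<^sup>2) = (\<Sum>p\<in>Q. \<Sum>q\<in>Q. b p * b q * cosh (cv (w p) (w q)))"
  proof -
    have "expectation (\<lambda>\<omega>. (\<Sum>q\<in>Q. a q * cos (lf (w q) \<omega>))\<^sup>2)
      = expectation (\<lambda>\<omega>. \<Sum>p\<in>Q. \<Sum>q\<in>Q. (a p * a q) * (cos (lf (w p) \<omega>) * cos (lf (w q) \<omega>)))"
      by (simp add: power2_eq_square sum_product mult_ac)
    also have "\<dots> = (\<Sum>p\<in>Q. \<Sum>q\<in>Q. (a p * a q) * expectation (\<lambda>\<omega>. cos (lf (w p) \<omega>) * cos (lf (w q) \<omega>)))"
      by (simp add: Bochner_Integration.integral_sum)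
    finally show ?thesis by (simp add: expectation_cos_cos b_def mult_ac)
  qed
  have E2: "expectation (\<lambda>\<omega>. \<Sum>q\<in>Q. a q * cos (lf (w q) \<omega>)) = (\<Sum>q\<in>Q. b q)"
    by (simp add: Bochner_Integration.integral_sum expectation_cos_lf b_def)
  have "expectation (energy (\<lambda>k \<omega>. \<Sum>q\<in>Q. a q * w q k * sin (lf (w q) \<omega>)))
     = expectation (\<lambda>\<omega>. \<Sum>p\<in>Q. \<Sum>q\<in>Q. (a p * a q * cv (w p) (w q)) * (sin (lf (w p) \<omega>) * sin (lf (w q) \<omega>)))"
    by (rule arg_cong[where f=expectation], rule ext, rule energy_sin_sum)
  also have "\<dots> = (\<Sum>p\<in>Q. \<Sum>q\<in>Q. (a p * a q * cv (w p) (w q)) * expectation (\<lambda>\<omega>. sin (lf (w p) \<omega>) * sin (lf (w q) \<omega>)))"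
    by (simp add: Bochner_Integration.integral_sum)
  also have "\<dots> = (\<Sum>p\<in>Q. \<Sum>q\<in>Q. b p * b q * (cv (w p) (w q) * sinh (cv (w p) (w q))))"
    by (simp add: expectation_sin_sin b_def mult_ac)
  finally have E3: "expectation (energy (\<lambda>k \<omega>. \<Sum>q\<in>Q. a q * w q k * sin (lf (w q) \<omega>)))
     = (\<Sum>p\<in>Q. \<Sum>q\<in>Q. b p * b q * (cv (w p) (w q) * sinh (cv (w p) (w q))))" .
  show ?thesis
    unfolding E1 E2 E3 using cosh_le_mult_sinh_psd[OF assms, of b w]
    by (simp add: right_diff_distrib sum_subtractf power2_eq_square sum_product)
qed

section \<open>Trigonometric polynomials and their eighth moments\<close>

definition trig :: "(real \<times> ('i \<Rightarrow> real)) list \<Rightarrow> 'a \<Rightarrow> real" where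
  "trig xs \<omega> = (\<Sum>(c, w)\<leftarrow>xs. c * cos (lf w \<omega>))"

text \<open>The negative of the partial derivative of \<open>trig xs\<close> with respect to \<open>Z k\<close>.\<close>

definition dtrig :: "(real \<times> ('i \<Rightarrow> real)) list \<Rightarrow> 'i \<Rightarrow> 'a \<Rightarrow> real" where
  "dtrig xs k \<omega> = (\<Sum>(c, w)\<leftarrow>xs. c * w k * sin (lf w \<omega>))"

text \<open>The product-to-sum formula on representations. Lists are used instead of finite sets
  because a product may contain the same coefficient and frequency several times.\<close>

fun trig_mult1 :: "real \<times> ('i \<Rightarrow> real) \<Rightarrow> (real \<times> ('i \<Rightarrow> real)) list \<Rightarrow> (real \<times> ('i \<Rightarrow> real)) list" where
  "trig_mult1 (c, w) [] = []"
| "trig_mult1 (c, w) ((c', w') # ys) =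
     (c * c' / 2, \<lambda>k. w k + w' k) # (c * c' / 2, \<lambda>k. w k - w' k) # trig_mult1 (c, w) ys"

fun trig_mult :: "(real \<times> ('i \<Rightarrow> real)) list \<Rightarrow> (real \<times> ('i \<Rightarrow> real)) list \<Rightarrow> (real \<times> ('i \<Rightarrow> real)) list" where
  "trig_mult [] ys = []"
| "trig_mult (x # xs) ys = trig_mult1 x ys @ trig_mult xs ys"

lemma trig_simps [simp]:
  "trig [] \<omega> = 0" "trig ((c, w) # xs) \<omega> = c * cos (lf w \<omega>) + trig xs \<omega>"
  "trig (xs @ ys) \<omega> = trig xs \<omega> + trig ys \<omega>"
  by (simp_all add: trig_def)

lemma dtrig_simps [simp]:
  "dtrig [] k \<omega> = 0" "dtrig ((c, w) # xs) k \<omega> = c * w k * sin (lf w \<omega>) + dtrig xs k \<omega>"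
  "dtrig (xs @ ys) k \<omega> = dtrig xs k \<omega> + dtrig ys k \<omega>"
  by (simp_all add: dtrig_def)

lemma trig_trig_mult: "trig (trig_mult xs ys) \<omega> = trig xs \<omega> * trig ys \<omega>"
proof (induction xs)
  case (Cons a xs)
  obtain c w where a: "a = (c, w)" by fastforce
  have "trig (trig_mult1 (c, w) ys) \<omega> = c * cos (lf w \<omega>) * trig ys \<omega>"
    by (induction ys) (auto simp: lf_add lf_diff cos_add cos_diff algebra_simps)
  then show ?case using Cons by (simp add: a distrib_right)
qed simp

text \<open>The Leibniz rule. It yields \<open>n F^(n-1)\<close> times the derivative of
  \<open>F\<close> for a represented power, although that power is a long list of
  frequencies.\<close>

lemma dtrig_trig_mult:
  "dtrig (trig_mult xs ys) k \<omega> = trig xs \<omega> * dtrig ys k \<omega> + dtrig xs k \<omega> * trig ys \<omega>"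
proof (induction xs)
  case (Cons a xs)
  obtain c w where a: "a = (c, w)" by fastforce
  have "dtrig (trig_mult1 (c, w) ys) k \<omega>
     = c * cos (lf w \<omega>) * dtrig ys k \<omega> + c * w k * sin (lf w \<omega>) * trig ys \<omega>"
    by (induction ys) (auto simp: lf_add lf_diff cos_add cos_diff sin_add sin_diff field_simps)
  then show ?case using Cons by (simp add: a algebra_simps)
qed simp

lemma trig_eq_sum: "trig xs \<omega> = (\<Sum>i<length xs. fst (xs ! i) * cos (lf (snd (xs ! i)) \<omega>))"
  unfolding trig_def by (simp add: sum_list_sum_nth split_beta atLeast0LessThan)

lemma dtrig_eq_sum: "dtrig xs k \<omega> = (\<Sum>i<length xs. fst (xs ! i) * snd (xs ! i) k * sin (lf (snd (xs ! i)) \<omega>))"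
  unfolding dtrig_def by (simp add: sum_list_sum_nth split_beta atLeast0LessThan)

lemma poincare_trig:
  "expectation (\<lambda>\<omega>. (trig xs \<omega>)\<^sup>2) - (expectation (trig xs))\<^sup>2 \<le> expectation (energy (dtrig xs))"
proof -
  have 1: "trig xs = (\<lambda>\<omega>. \<Sum>i<length xs. fst (xs ! i) * cos (lf (snd (xs ! i)) \<omega>))"
    by (rule ext) (rule trig_eq_sum)
  have 2: "dtrig xs = (\<lambda>k \<omega>. \<Sum>i<length xs. fst (xs ! i) * snd (xs ! i) k * sin (lf (snd (xs ! i)) \<omega>))"
    by (intro ext) (rule dtrig_eq_sum)
  show ?thesis
    unfolding 1 2 by (intro poincare_cos_sum finite_lessThan)
qed

lemma measurable_trig [measurable]: "trig xs \<in> borel_measurable M"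
proof -
  have "(\<lambda>\<omega>. \<Sum>i<length xs. fst (xs ! i) * cos (lf (snd (xs ! i)) \<omega>)) \<in> borel_measurable M" by measurable
  then show ?thesis by (simp add: trig_eq_sum[abs_def])
qed

lemma abs_trig_le: "\<bar>trig xs \<omega>\<bar> \<le> (\<Sum>(c, w)\<leftarrow>xs. \<bar>c\<bar>)"
proof (induction xs)
  case (Cons a xs)
  obtain c w where a: "a = (c, w)" by fastforce
  have "\<bar>c * cos (lf w \<omega>)\<bar> \<le> \<bar>c\<bar>" by (simp add: abs_mult mult_left_le)
  then show ?case using Cons by (simp add: a)
qed simp

lemma integrable_trig_power [simp]: "integrable M (\<lambda>\<omega>. trig xs \<omega> ^ m)"
proof (rule integrable_const_bound[where B="(\<Sum>(c, w)\<leftarrow>xs. \<bar>c\<bar>) ^ m"])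
  show "AE \<omega> in M. norm (trig xs \<omega> ^ m) \<le> (\<Sum>(c, w)\<leftarrow>xs. \<bar>c\<bar>) ^ m"
    by (intro AE_I2) (simp add: norm_power power_mono abs_trig_le power_abs)
qed measurable

text \<open>With \<open>b = n F^(n-1)\<close> this is the chain rule for the energy of a
  power.\<close>

lemma energy_scale:
  "energy (\<lambda>k \<omega>. b \<omega> * D k \<omega>) \<omega> = (b \<omega>)\<^sup>2 * energy D \<omega>"
  unfolding energy_def by (simp add: sum_distrib_left power2_eq_square mult_ac)

text \<open>The Poincare inequality applied to \<open>F\<close>, \<open>F\<^sup>2\<close>, \<open>F\<^sup>3\<close> and \<open>F\<^sup>4\<close>.\<close>

lemma trig_eighth_moment:
  assumes en: "\<And>\<omega>. energy (dtrig xs) \<omega> \<le> S" and S: "0 \<le> S" and mean: "expectation (trig xs) = 0"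
  shows "expectation (\<lambda>\<omega>. trig xs \<omega> ^ 8) \<le> 1330 * S ^ 4"
proof -
  define F where "F = trig xs"
  define m where "m n = expectation (\<lambda>\<omega>. F \<omega> ^ n)" for n
  have int: "integrable M (\<lambda>\<omega>. F \<omega> ^ n)" for n by (simp add: F_def)
  \<comment> \<open>A pointwise bound on the energy of \<open>F\<close> gives a recursion among
    moments: the variance of \<open>F^n\<close> is controlled by the moment of order
    \<open>2 n - 2\<close>.\<close>
  have P: "m (2 * n) - (m n)\<^sup>2 \<le> (real n)\<^sup>2 * S * m (2 * n - 2)"
    if "trig ys = (\<lambda>\<omega>. F \<omega> ^ n)" "dtrig ys = (\<lambda>k \<omega>. (real n * F \<omega> ^ (n - 1)) * dtrig xs k \<omega>)" "n \<ge> 1" for ys n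
  proof -
    have e: "energy (dtrig ys) \<omega> \<le> (real n)\<^sup>2 * S * F \<omega> ^ (2 * n - 2)" for \<omega>
    proof -
      have "energy (dtrig ys) \<omega> = (real n * F \<omega> ^ (n - 1))\<^sup>2 * energy (dtrig xs) \<omega>"
        unfolding that(2) by (rule energy_scale)
      also have "\<dots> \<le> (real n * F \<omega> ^ (n - 1))\<^sup>2 * S"
        by (rule mult_left_mono[OF en]) simp
      also have "(F \<omega> ^ (n - 1))\<^sup>2 = F \<omega> ^ (2 * n - 2)"
        by (simp add: power_mult[symmetric] right_diff_distrib' mult.commute)
      then have "(real n * F \<omega> ^ (n - 1))\<^sup>2 * S = (real n)\<^sup>2 * S * F \<omega> ^ (2 * n - 2)"
        by (simp add: power_mult_distrib mult_ac)
      finally show ?thesis .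
    qed
    have nn: "0 \<le> (real n)\<^sup>2 * S * F \<omega> ^ (2 * n - 2)" for \<omega>
    proof -
      have "even (2 * n - 2)" by simp
      then have "0 \<le> F \<omega> ^ (2 * n - 2)" by (metis zero_le_even_power)
      then show ?thesis using S by simp
    qed
    have "m (2 * n) - (m n)\<^sup>2 \<le> expectation (energy (dtrig ys))"
      using poincare_trig[of ys] unfolding that(1) m_def by (simp add: power_mult[symmetric] mult.commute)
    also have "\<dots> \<le> expectation (\<lambda>\<omega>. (real n)\<^sup>2 * S * F \<omega> ^ (2 * n - 2))"
      by (rule Bochner_Integration.integral_mono') (use e nn int in auto)
    also have "\<dots> = (real n)\<^sup>2 * S * m (2 * n - 2)" by (simp add: m_def)
    finally show ?thesis .
  qed
  let ?x2 = "trig_mult xs xs"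
  have m1: "m 1 = 0" using mean by (simp add: m_def F_def)
  have m0: "m 0 = 1" by (simp add: m_def prob_space)
  have p1: "m 2 \<le> S"
    using P[of xs 1] m1 m0 by (simp add: F_def fun_eq_iff)
  have "m 4 - (m 2)\<^sup>2 \<le> 4 * S * m 2"
    using P[of ?x2 2] by (simp add: F_def fun_eq_iff trig_trig_mult dtrig_trig_mult power2_eq_square algebra_simps)
  moreover have m2: "0 \<le> m 2" unfolding m_def by simp
  ultimately have p2: "m 4 \<le> 5 * S\<^sup>2"
  proof -
    assume a: "m 4 - (m 2)\<^sup>2 \<le> 4 * S * m 2" and b: "0 \<le> m 2"
    have "(m 2)\<^sup>2 \<le> S\<^sup>2" using p1 b by (rule power_mono)
    moreover have "4 * S * m 2 \<le> 4 * S * S" using p1 S by (intro mult_left_mono) auto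
    ultimately show ?thesis using a by (simp add: power2_eq_square)
  qed
  have "m 8 - (m 4)\<^sup>2 \<le> 16 * S * m 6"
    using P[of "trig_mult ?x2 ?x2" 4]
    by (simp add: F_def fun_eq_iff trig_trig_mult dtrig_trig_mult power2_eq_square power4_eq_xxxx power3_eq_cube algebra_simps)
  \<comment> \<open>The sixth moment is not estimated on its own: completing the square absorbs it
    into half of the eighth moment and a multiple of the fourth.\<close>
  moreover have "16 * S * m 6 \<le> m 8 / 2 + 128 * S\<^sup>2 * m 4"
  proof -
    have "16 * S * m 6 = expectation (\<lambda>\<omega>. 16 * S * F \<omega> ^ 6)" by (simp add: m_def)
    also have "\<dots> \<le> expectation (\<lambda>\<omega>. F \<omega> ^ 8 / 2 + 128 * S\<^sup>2 * F \<omega> ^ 4)"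
    proof (rule integral_mono)
      fix \<omega>
      have "0 \<le> F \<omega> ^ 4 * (F \<omega> ^ 2 - 16 * S)\<^sup>2" by simp
      also have "\<dots> = F \<omega> ^ 8 - 32 * S * F \<omega> ^ 6 + 256 * S\<^sup>2 * F \<omega> ^ 4" by algebra
      finally show "16 * S * F \<omega> ^ 6 \<le> F \<omega> ^ 8 / 2 + 128 * S\<^sup>2 * F \<omega> ^ 4" by simp
    qed (use int in auto)
    also have "\<dots> = m 8 / 2 + 128 * S\<^sup>2 * m 4" using int by (simp add: m_def)
    finally show ?thesis .
  qed
  moreover have "128 * S\<^sup>2 * m 4 \<le> 128 * S\<^sup>2 * (5 * S\<^sup>2)" using p2 by (intro mult_left_mono) auto
  moreover have "0 \<le> m 4" unfolding m_def by simp
  then have "(m 4)\<^sup>2 \<le> (5 * S\<^sup>2)\<^sup>2" using p2 by (intro power_mono)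
  \<comment> \<open>Moving \<open>m 8 / 2\<close> to the left doubles the rest;
    \<open>640 = 128 * 5\<close> and \<open>25 = 5^2\<close> come from the bound
    \<open>5 * S^2\<close> on the fourth moment, hence 1330.\<close>
  ultimately have "m 8 \<le> 2 * (640 * (S\<^sup>2 * S\<^sup>2) + 25 * (S\<^sup>2 * S\<^sup>2))"
    by (simp add: power2_eq_square)
  also have "\<dots> = 1330 * S ^ 4" by (simp add: power2_eq_square power4_eq_xxxx)
  finally show ?thesis by (simp add: m_def F_def)
qed

text \<open>Sines are bounded by 1, so the energy of a sum of cosines has a deterministic bound by
  absolute covariances; this uniformity in \<open>\<omega>\<close> is what the moment recursion
  needs.\<close>

lemma cos_sum_eighth_moment:
  assumes "finite Q" and S: "(\<Sum>p\<in>Q. \<Sum>q\<in>Q. \<bar>a p * a q * cv (w p) (w q)\<bar>) \<le> S"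
  shows "expectation (\<lambda>\<omega>. (\<Sum>q\<in>Q. a q * (cos (lf (w q) \<omega>) - expectation (\<lambda>\<omega>. cos (lf (w q) \<omega>)))) ^ 8) \<le> 1330 * S ^ 4"
proof -
  define e where "e = (\<Sum>q\<in>Q. a q * expectation (\<lambda>\<omega>. cos (lf (w q) \<omega>)))"
  obtain qs where qs: "set qs = Q" "distinct qs" using finite_distinct_list[OF assms(1)] by blast
  \<comment> \<open>The mean is subtracted as a cosine of frequency 0, which keeps the centred sum
    in the class and adds nothing to the derivative.\<close>
  define xs where "xs = (- e, \<lambda>_. 0) # map (\<lambda>q. (a q, w q)) qs"
  have t: "trig xs \<omega> = (\<Sum>q\<in>Q. a q * (cos (lf (w q) \<omega>) - expectation (\<lambda>\<omega>. cos (lf (w q) \<omega>))))" for \<omega>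
    by (simp add: xs_def trig_def lf_def o_def sum_list_distinct_conv_sum_set[OF qs(2)] qs(1)
        right_diff_distrib sum_subtractf e_def)
  have d: "dtrig xs = (\<lambda>k \<omega>. \<Sum>q\<in>Q. a q * w q k * sin (lf (w q) \<omega>))"
    by (simp add: xs_def dtrig_def fun_eq_iff o_def sum_list_distinct_conv_sum_set[OF qs(2)] qs(1))
  have "expectation (\<lambda>\<omega>. trig xs \<omega> ^ 8) \<le> 1330 * S ^ 4"
  proof (rule trig_eighth_moment)
    fix \<omega>
    have "energy (dtrig xs) \<omega> = (\<Sum>p\<in>Q. \<Sum>q\<in>Q. (a p * a q * cv (w p) (w q)) * (sin (lf (w p) \<omega>) * sin (lf (w q) \<omega>)))"
      unfolding d by (rule energy_sin_sum)
    also have "\<dots> \<le> (\<Sum>p\<in>Q. \<Sum>q\<in>Q. \<bar>a p * a q * cv (w p) (w q)\<bar>)"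
    proof (intro sum_mono)
      fix p q
      have "(a p * a q * cv (w p) (w q)) * (sin (lf (w p) \<omega>) * sin (lf (w q) \<omega>))
        \<le> \<bar>a p * a q * cv (w p) (w q)\<bar> * \<bar>sin (lf (w p) \<omega>) * sin (lf (w q) \<omega>)\<bar>"
        by (metis abs_ge_self abs_mult)
      also have "\<dots> \<le> \<bar>a p * a q * cv (w p) (w q)\<bar>"
        by (intro mult_left_le) (auto simp: abs_mult mult_le_one)
      finally show "(a p * a q * cv (w p) (w q)) * (sin (lf (w p) \<omega>) * sin (lf (w q) \<omega>)) \<le> \<bar>a p * a q * cv (w p) (w q)\<bar>" .
    qed
    also note S
    finally show "energy (dtrig xs) \<omega> \<le> S" .
  next
    have "0 \<le> (\<Sum>p\<in>Q. \<Sum>q\<in>Q. \<bar>a p * a q * cv (w p) (w q)\<bar>)" by (intro sum_nonneg) simp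
    then show "0 \<le> S" using S by linarith
  next
    show "expectation (trig xs) = 0"
      by (simp add: t[abs_def] Bochner_Integration.integral_sum prob_space)
  qed
  then show ?thesis by (simp add: t)
qed

end

section \<open>The mean ratio of two Gaussian variables\<close>

text \<open>The increment ratio in terms of the sum \<open>s = u + v\<close> and the difference \<open>d = u - v\<close>, since
  \<open>\<bar>u\<bar> + \<bar>v\<bar> = max \<bar>s\<bar> \<bar>d\<bar>\<close>.\<close>

definition sd_ratio :: "real \<Rightarrow> real \<Rightarrow> real" where
  "sd_ratio s d = (if s = 0 \<and> d = 0 then 1 else \<bar>s\<bar> / max \<bar>s\<bar> \<bar>d\<bar>)"

lemma incr_ratio_eq_sd_ratio: "incr_ratio u v = sd_ratio (u + v) (u - v)"
proof -
  have "\<bar>u\<bar> + \<bar>v\<bar> = max \<bar>u + v\<bar> \<bar>u - v\<bar>" by linarith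
  then show ?thesis by (auto simp: incr_ratio_def sd_ratio_def)
qed

text \<open>Homogeneity of degree 0: dividing sum and difference by the local scale leaves the ratio
  unchanged.\<close>

lemma sd_ratio_scale: "c \<noteq> 0 \<Longrightarrow> sd_ratio (s / c) (d / c) = sd_ratio s d"
proof -
  assume c: "c \<noteq> 0"
  have "max (\<bar>s\<bar> / \<bar>c\<bar>) (\<bar>d\<bar> / \<bar>c\<bar>) = max \<bar>s\<bar> \<bar>d\<bar> / \<bar>c\<bar>"
    using c by (auto simp: max_def divide_simps)
  then show ?thesis using c by (simp add: sd_ratio_def)
qed

lemma sd_ratio_nonneg: "0 \<le> sd_ratio s d"
  by (simp add: sd_ratio_def)

lemma sd_ratio_le_1: "sd_ratio s d \<le> 1"
  by (auto simp: sd_ratio_def divide_simps)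

lemma sd_ratio_eq_min: "d \<noteq> 0 \<Longrightarrow> sd_ratio s d = min 1 (\<bar>s\<bar> / \<bar>d\<bar>)"
  by (auto simp: sd_ratio_def min_def max_def divide_simps)

lemma measurable_sd_ratio [measurable (raw)]:
  assumes [measurable]: "f \<in> borel_measurable M" "g \<in> borel_measurable M"
  shows "(\<lambda>x. sd_ratio (f x) (g x)) \<in> borel_measurable M"
  unfolding sd_ratio_def by measurable

lemma nn_integral_even:
  fixes f :: "real \<Rightarrow> ennreal"
  assumes [measurable]: "f \<in> borel_measurable borel" and even: "\<And>x. f (- x) = f x"
  shows "(\<integral>\<^sup>+x. f x \<partial>lborel) = 2 * (\<integral>\<^sup>+x. f x * indicator {0..} x \<partial>lborel)"
proof -
  have "(\<integral>\<^sup>+x. f x \<partial>lborel) = (\<integral>\<^sup>+x. f x * indicator {0..} x + f x * indicator {..<0} x \<partial>lborel)"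
    by (rule nn_integral_cong) (auto split: split_indicator)
  also have "\<dots> = (\<integral>\<^sup>+x. f x * indicator {0..} x \<partial>lborel) + (\<integral>\<^sup>+x. f x * indicator {..<0} x \<partial>lborel)"
    by (rule nn_integral_add) auto
  also have "(\<integral>\<^sup>+x. f x * indicator {..<0} x \<partial>lborel) = (\<integral>\<^sup>+x. f x * indicator {0<..} x \<partial>lborel)"
    by (subst nn_integral_real_affine[of _ "-1" 0])
       (auto simp: even split: split_indicator intro!: nn_integral_cong)
  also have "\<dots> = (\<integral>\<^sup>+x. f x * indicator {0..} x \<partial>lborel)"
  proof (rule nn_integral_cong_AE)
    show "AE x in lborel. f x * indicator {0<..} x = f x * indicator {0..} x"
      using AE_lborel_singleton[of "0::real"] by eventually_elim (auto split: split_indicator)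
  qed
  finally show ?thesis by (simp add: mult_2)
qed

text \<open>The ratio of two independent standard normal variables is Cauchy distributed.\<close>

lemma nn_integral_std_normal_ratio_inner:
  fixes u :: real
  shows "(\<integral>\<^sup>+y. ennreal (\<bar>y\<bar> * std_normal_density y * std_normal_density (y * u)) \<partial>lborel)
    = ennreal (1 / (pi * (1 + u\<^sup>2)))"
proof -
  let ?f = "\<lambda>y. ennreal (\<bar>y\<bar> * std_normal_density y * std_normal_density (y * u))"
  let ?c = "1 + u\<^sup>2"
  have c: "?c > 0" by (simp add: add_pos_nonneg)
  have e: "std_normal_density y * std_normal_density (y * u) = exp (- y\<^sup>2 * ?c / 2) / (2 * pi)" for y
    by (simp add: std_normal_density_def field_simps power2_eq_square flip: exp_add)
  have lim: "((\<lambda>y. - exp (- y\<^sup>2 * ?c / 2) / (2 * pi * ?c)) \<longlongrightarrow> 0) at_top"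
  proof -
    have "filterlim (\<lambda>y::real. (?c / 2) * y\<^sup>2) at_top at_top"
      using c by (intro filterlim_tendsto_pos_mult_at_top[OF tendsto_const] filterlim_pow_at_top filterlim_ident) auto
    then have "filterlim (\<lambda>y::real. y\<^sup>2 * (?c / 2)) at_top at_top" by (simp only: mult.commute)
    then have "filterlim (\<lambda>y::real. - (y\<^sup>2 * (?c / 2))) at_bot at_top"
      by (simp add: filterlim_uminus_at_bot)
    then have "((\<lambda>y::real. exp (- (y\<^sup>2 * (?c / 2)))) \<longlongrightarrow> 0) at_top"
      by (rule filterlim_compose[OF exp_at_bot])
    then have "((\<lambda>y::real. - exp (- (y\<^sup>2 * (?c / 2))) / (2 * pi * ?c)) \<longlongrightarrow> - 0 / (2 * pi * ?c)) at_top"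
      using c by (intro tendsto_intros) auto
    then show ?thesis by simp
  qed
  have "(\<integral>\<^sup>+y. ?f y \<partial>lborel)
    = 2 * (\<integral>\<^sup>+y. ?f y * indicator {0..} y \<partial>lborel)"
    by (rule nn_integral_even) (auto simp: std_normal_density_def)
  also have "(\<integral>\<^sup>+y. ?f y * indicator {0..} y \<partial>lborel)
    = (\<integral>\<^sup>+y. ennreal (y * exp (- y\<^sup>2 * ?c / 2) / (2 * pi)) * indicator {0..} y \<partial>lborel)"
    by (intro nn_integral_cong) (auto simp: e mult.assoc split: split_indicator)
  also have "\<dots> = ennreal (0 - (- exp (- 0\<^sup>2 * ?c / 2) / (2 * pi * ?c)))"
  proof (rule nn_integral_FTC_atLeast[OF _ _ _ lim])
    fix y :: real
    have "((\<lambda>y. exp (- y\<^sup>2 * ?c / 2)) has_real_derivative exp (- y\<^sup>2 * ?c / 2) * (- (2 * y) * ?c / 2)) (at y)"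
      by (auto intro!: derivative_eq_intros)
    then have "((\<lambda>y. (- 1 / (2 * pi * ?c)) * exp (- y\<^sup>2 * ?c / 2)) has_real_derivative
       (- 1 / (2 * pi * ?c)) * (exp (- y\<^sup>2 * ?c / 2) * (- (2 * y) * ?c / 2))) (at y)"
      by (rule DERIV_cmult)
    moreover have "(- 1 / (2 * pi * ?c)) * (exp (- y\<^sup>2 * ?c / 2) * (- (2 * y) * ?c / 2)) = y * exp (- y\<^sup>2 * ?c / 2) / (2 * pi)"
    proof -
      have "(- 1 / (2 * p * q)) * (e * (- (2 * y) * q / 2)) = y * e / (2 * p)" if "q \<noteq> 0" for p q e :: real
        using that by (simp add: divide_simps)
      then show ?thesis using c by (metis less_irrefl)
    qed
    ultimately show "((\<lambda>y. - exp (- y\<^sup>2 * ?c / 2) / (2 * pi * ?c)) has_real_derivative (y * exp (- y\<^sup>2 * ?c / 2) / (2 * pi))) (at y)"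
      by simp
  qed auto
  also have "2 * ennreal (0 - (- exp (- 0\<^sup>2 * ?c / 2) / (2 * pi * ?c))) = ennreal (1 / (pi * ?c))"
    using c by (subst ennreal_numeral[symmetric], subst ennreal_mult[symmetric]) auto
  finally show ?thesis .
qed

text \<open>The minimum switches at \<open>u = 1/a\<close>: below, the integrand has a logarithm as
  antiderivative, above, an arctangent. Both indicators contain \<open>1/a\<close>, so the splitting
  holds only almost everywhere.\<close>

lemma nn_integral_min_cauchy:
  fixes a :: real
  assumes a: "a > 0"
  shows "(\<integral>\<^sup>+u. ennreal (min 1 (a * \<bar>u\<bar>) * (1 / (pi * (1 + u\<^sup>2)))) \<partial>lborel)
    = ennreal (1 / pi * (2 * arctan a + a * ln (1 + 1 / a\<^sup>2)))"
proof -
  let ?f = "\<lambda>u. ennreal (min 1 (a * \<bar>u\<bar>) * (1 / (pi * (1 + u\<^sup>2))))"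
  let ?g = "\<lambda>u. ennreal (a * u / (pi * (1 + u\<^sup>2))) * indicator {0..1/a} u"
  let ?h = "\<lambda>u. ennreal (1 / (pi * (1 + u\<^sup>2))) * indicator {1/a..} u"
  have pos: "1 + u\<^sup>2 > 0" for u :: real by (simp add: add_pos_nonneg)
  have "(\<integral>\<^sup>+u. ?f u \<partial>lborel)
    = 2 * (\<integral>\<^sup>+u. ?f u * indicator {0..} u \<partial>lborel)"
    by (rule nn_integral_even) auto
  also have "(\<integral>\<^sup>+u. ?f u * indicator {0..} u \<partial>lborel)
    = (\<integral>\<^sup>+u. ?g u
           + ?h u \<partial>lborel)"
  proof (rule nn_integral_cong_AE)
    show "AE u in lborel. ?f u * indicator {0..} u
       = ?g u
           + ?h u"
      using AE_lborel_singleton[of "1/a"]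
    proof eventually_elim
      case (elim u)
      consider "u < 0" | "0 \<le> u" "u < 1/a" | "1/a < u" using elim by linarith
      then show ?case
      proof cases
        case 1 then show ?thesis using a by (auto simp: split: split_indicator)
             (smt (verit) divide_pos_pos)
      next
        case 2
        then have "a * u \<le> 1" using a by (simp add: field_simps)
        then show ?thesis using 2 by (auto simp: min_def split: split_indicator)
      next
        case 3
        moreover have "u \<ge> 0" using 3 a by (smt (verit) divide_pos_pos)
        moreover have "a * u \<ge> 1" using a 3 by (simp add: field_simps)
        ultimately show ?thesis by (auto simp: min_def split: split_indicator)
      qed
    qed
  qed
  also have "\<dots> = (\<integral>\<^sup>+u. ?g u \<partial>lborel)
           + (\<integral>\<^sup>+u. ?h u \<partial>lborel)"
    by (rule nn_integral_add) auto
  also have "(\<integral>\<^sup>+u. ?g u \<partial>lborel)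
     = ennreal (a / (2 * pi) * ln (1 + (1/a)\<^sup>2) - a / (2 * pi) * ln (1 + 0\<^sup>2))"
  proof (rule nn_integral_FTC_Icc)
    fix u :: real
    assume "u \<in> {0..1 / a}"
    have "((\<lambda>u. ln (1 + u\<^sup>2)) has_real_derivative (2 * u) / (1 + u\<^sup>2)) (at u)"
      using pos[of u] by (auto intro!: derivative_eq_intros)
    then have "((\<lambda>u. a / (2 * pi) * ln (1 + u\<^sup>2)) has_real_derivative a / (2 * pi) * ((2 * u) / (1 + u\<^sup>2))) (at u)"
      by (rule DERIV_cmult)
    moreover have "a / (2 * pi) * ((2 * u) / (1 + u\<^sup>2)) = a * u / (pi * (1 + u\<^sup>2))" by simp
    ultimately show "((\<lambda>u. a / (2 * pi) * ln (1 + u\<^sup>2)) has_real_derivative a * u / (pi * (1 + u\<^sup>2))) (at u)"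
      by metis
  qed (use a in \<open>auto simp: pos less_imp_le\<close>)
  also have "(\<integral>\<^sup>+u. ?h u \<partial>lborel)
     = ennreal (1 / pi * (pi / 2) - 1 / pi * arctan (1 / a))"
  proof (rule nn_integral_FTC_atLeast)
    fix u :: real
    show "((\<lambda>u. 1 / pi * arctan u) has_real_derivative 1 / (pi * (1 + u\<^sup>2))) (at u)"
      using DERIV_cmult[OF DERIV_arctan[of u], of "1 / pi"] by (simp add: divide_inverse mult.commute)
    show "((\<lambda>u. 1 / pi * arctan u) \<longlongrightarrow> 1 / pi * (pi / 2)) at_top"
      by (intro tendsto_intros tendsto_arctan_at_top)
  qed (use pos in \<open>auto simp: less_imp_le\<close>)
  also have "pi / 2 - arctan (1 / a) = arctan a"
    using arctan_inverse[of a] a by (simp add: inverse_eq_divide)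
  then have "1 / pi * (pi / 2) - 1 / pi * arctan (1 / a) = 1 / pi * arctan a"
    by (metis right_diff_distrib)
  also have "2 * (ennreal (a / (2 * pi) * ln (1 + (1/a)\<^sup>2) - a / (2 * pi) * ln (1 + 0\<^sup>2)) + ennreal (1 / pi * arctan a))
     = ennreal (1 / pi * (2 * arctan a + a * ln (1 + 1 / a\<^sup>2)))"
  proof -
    have "ln (1 + (1/a)\<^sup>2) \<ge> 0" by simp
    then have "0 \<le> a / (2 * pi) * ln (1 + (1/a)\<^sup>2)" using a by simp
    moreover have "0 \<le> 1 / pi * arctan a" using a by simp
    moreover have "2 * ennreal z = ennreal (2 * z)" if "z \<ge> 0" for z :: real
      using that by (simp add: ennreal_mult)
    ultimately have "2 * (ennreal (a / (2 * pi) * ln (1 + (1/a)\<^sup>2)) + ennreal (1 / pi * arctan a))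
      = ennreal (2 * (a / (2 * pi) * ln (1 + (1/a)\<^sup>2) + 1 / pi * arctan a))"
      by (simp add: ennreal_plus[symmetric] del: ennreal_plus)
    also have "2 * (a / (2 * pi) * ln (1 + (1/a)\<^sup>2) + 1 / pi * arctan a) = 1 / pi * (2 * arctan a + a * ln (1 + 1 / a\<^sup>2))"
      by (simp add: algebra_simps power_divide)
    finally show ?thesis by simp
  qed
  finally show ?thesis .
qed

text \<open>For \<open>y \<noteq> 0\<close> substitute \<open>x = y u\<close>. By homogeneity the
  ratio becomes \<open>min 1 (A/B \<bar>u\<bar>)\<close>, free of \<open>y\<close>, and integrating
  the Jacobian and the densities over \<open>y\<close> leaves the Cauchy density.\<close>

lemma nn_integral_sd_ratio_normal:
  assumes A: "A > 0" and B: "B > 0"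
  shows "(\<integral>\<^sup>+y. \<integral>\<^sup>+x. ennreal (sd_ratio (A * x) (B * y)) \<partial>std_normal \<partial>std_normal)
    = ennreal (1 / pi * (2 * arctan (A / B) + A / B * ln (1 + 1 / (A / B)\<^sup>2)))"
proof -
  let ?a = "A / B"
  let ?n = "std_normal_density"
  have a: "?a > 0" using A B by simp
  have "(\<integral>\<^sup>+y. \<integral>\<^sup>+x. ennreal (sd_ratio (A * x) (B * y)) \<partial>std_normal \<partial>std_normal)
      = (\<integral>\<^sup>+y. ?n y * (\<integral>\<^sup>+x. ?n x * ennreal (sd_ratio (A * x) (B * y)) \<partial>lborel) \<partial>lborel)"
    by (simp add: nn_integral_density)
  also have "\<dots> = (\<integral>\<^sup>+y. (\<integral>\<^sup>+u. ennreal (\<bar>y\<bar> * ?n y * ?n (y * u)) * ennreal (min 1 (?a * \<bar>u\<bar>)) \<partial>lborel) \<partial>lborel)"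
  proof (rule nn_integral_cong_AE)
    show "AE y in lborel. ?n y * (\<integral>\<^sup>+x. ?n x * ennreal (sd_ratio (A * x) (B * y)) \<partial>lborel)
       = (\<integral>\<^sup>+u. ennreal (\<bar>y\<bar> * ?n y * ?n (y * u)) * ennreal (min 1 (?a * \<bar>u\<bar>)) \<partial>lborel)"
      using AE_lborel_singleton[of "0::real"]
    proof eventually_elim
      case (elim y)
      have r: "sd_ratio (A * (y * u)) (B * y) = min 1 (?a * \<bar>u\<bar>)" for u
        using elim A B by (subst sd_ratio_eq_min) (auto simp: abs_mult)
      have "(\<integral>\<^sup>+x. ?n x * ennreal (sd_ratio (A * x) (B * y)) \<partial>lborel)
         = \<bar>y\<bar> * (\<integral>\<^sup>+u. ?n (0 + y * u) * ennreal (sd_ratio (A * (0 + y * u)) (B * y)) \<partial>lborel)"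
        by (rule nn_integral_real_affine) (use elim in auto)
      also have "\<dots> = \<bar>y\<bar> * (\<integral>\<^sup>+u. ?n (y * u) * ennreal (min 1 (?a * \<bar>u\<bar>)) \<partial>lborel)"
        using r by simp
      finally have "?n y * (\<integral>\<^sup>+x. ?n x * ennreal (sd_ratio (A * x) (B * y)) \<partial>lborel)
        = (\<integral>\<^sup>+u. ?n y * (\<bar>y\<bar> * (?n (y * u) * ennreal (min 1 (?a * \<bar>u\<bar>)))) \<partial>lborel)"
        by (simp add: nn_integral_cmult)
      also have "\<dots> = (\<integral>\<^sup>+u. ennreal (\<bar>y\<bar> * ?n y * ?n (y * u)) * ennreal (min 1 (?a * \<bar>u\<bar>)) \<partial>lborel)"
        by (intro nn_integral_cong) (simp add: ennreal_mult mult_ac)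
      finally show ?case .
    qed
  qed
  also have "\<dots> = (\<integral>\<^sup>+u. (\<integral>\<^sup>+y. ennreal (\<bar>y\<bar> * ?n y * ?n (y * u)) * ennreal (min 1 (?a * \<bar>u\<bar>)) \<partial>lborel) \<partial>lborel)"
    by (rule lborel_pair.Fubini'[symmetric]) measurable
  also have "\<dots> = (\<integral>\<^sup>+u. ennreal (min 1 (?a * \<bar>u\<bar>) * (1 / (pi * (1 + u\<^sup>2)))) \<partial>lborel)"
  proof (rule nn_integral_cong)
    fix u :: real
    have "(\<integral>\<^sup>+y. ennreal (\<bar>y\<bar> * ?n y * ?n (y * u)) * ennreal (min 1 (?a * \<bar>u\<bar>)) \<partial>lborel)
      = (\<integral>\<^sup>+y. ennreal (\<bar>y\<bar> * ?n y * ?n (y * u)) \<partial>lborel) * ennreal (min 1 (?a * \<bar>u\<bar>))"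
      by (rule nn_integral_multc) measurable
    also have "\<dots> = ennreal (min 1 (?a * \<bar>u\<bar>)) * ennreal (1 / (pi * (1 + u\<^sup>2)))"
      by (subst nn_integral_std_normal_ratio_inner) (rule mult.commute)
    also have "\<dots> = ennreal (min 1 (?a * \<bar>u\<bar>) * (1 / (pi * (1 + u\<^sup>2))))"
      using A B by (intro ennreal_mult[symmetric]) (auto simp: add_nonneg_nonneg)
    finally show "(\<integral>\<^sup>+y. ennreal (\<bar>y\<bar> * ?n y * ?n (y * u)) * ennreal (min 1 (?a * \<bar>u\<bar>)) \<partial>lborel)
      = ennreal (min 1 (?a * \<bar>u\<bar>) * (1 / (pi * (1 + u\<^sup>2))))" .
  qed
  also have "\<dots> = ennreal (1 / pi * (2 * arctan ?a + ?a * ln (1 + 1 / ?a\<^sup>2)))"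
    by (rule nn_integral_min_cauchy[OF a])
  finally show ?thesis .
qed

text \<open>The argument is the correlation of \<open>(s + d)/2\<close> and \<open>(s - d)/2\<close>
  for uncorrelated \<open>s\<close>, \<open>d\<close> with variances \<open>vs\<close>,
  \<open>vd\<close>. The half-angle formula \<open>(1 - a^2)/(1 + a^2) = cos (2 arctan a)\<close>
  turns the arccosine into an arctangent.\<close>

lemma lambda_fun_eq_arctan:
  assumes vs: "vs > 0" and vd: "vd > 0"
  defines "a \<equiv> sqrt vs / sqrt vd"
  shows "lambda_fun ((vs - vd) / (vs + vd)) = 1 / pi * (2 * arctan a + a * ln (1 + 1 / a\<^sup>2))"
proof -
  let ?r = "(vs - vd) / (vs + vd)"
  have a: "a > 0" "a\<^sup>2 = vs / vd" using vs vd by (auto simp: a_def power_divide)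
  have p: "1 + ?r = 2 * vs / (vs + vd)" "1 - ?r = 2 * vd / (vs + vd)" using vs vd by (simp_all add: field_simps)
  have 1: "(1 + ?r) / (1 - ?r) = vs / vd" unfolding p using vs vd by simp
  have 2: "2 / (1 + ?r) = 1 + 1 / a\<^sup>2" unfolding p using vs vd a by (simp add: field_simps)
  have "- ?r = (1 - a\<^sup>2) / (1 + a\<^sup>2)" using vs vd by (simp add: a(2) divide_simps) (simp add: algebra_simps)
  also have "\<dots> = 2 / (1 + a\<^sup>2) - 1" 
  proof -
    have "1 + a\<^sup>2 > 0" by (simp add: add_pos_nonneg)
    then show ?thesis by (simp add: divide_simps)
  qed
  also have "\<dots> = cos (2 * arctan a)"
    using cos_double_cos[of "arctan a"] by (simp add: cos_arctan power_divide field_simps add_pos_nonneg)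
  finally have "arccos (- ?r) = 2 * arctan a"
    using a arctan_ubound[of a] by (simp add: arccos_cos zero_le_arctan_iff)
  moreover have "sqrt ((1 + ?r) / (1 - ?r)) = a" unfolding 1 a_def by (simp add: real_sqrt_divide)
  ultimately show ?thesis unfolding lambda_fun_def 2 by (simp add: algebra_simps)
qed

section \<open>Consequences of the assumptions (A.1) and (A.2)\<close>

lemma sum_powr_le:
  fixes \<gamma> :: real
  assumes g: "0 < \<gamma>" "\<gamma> < 1"
  shows "(\<Sum>m<n. (real m + 1) powr (- \<gamma>)) \<le> real n powr (1 - \<gamma>) / (1 - \<gamma>)"
proof (induction n)
  case (Suc n)
  \<comment> \<open>Weighted arithmetic-geometric mean inequality, a discrete form of the comparison
    with the integral of \<open>x^(-\<gamma>)\<close>; divided by \<open>(n+1)^\<gamma>\<close> it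
    makes the bound telescope.\<close>
  have "real n powr (1 - \<gamma>) * (real n + 1) powr \<gamma> \<le> (1 - \<gamma>) * real n + \<gamma> * (real n + 1)"
  proof (cases "n = 0")
    case False
    then show ?thesis by (intro Youngs_inequality_0) (use g in auto)
  qed (use g in auto)
  then have "real n powr (1 - \<gamma>) * (real n + 1) powr \<gamma> \<le> (real n + 1) - (1 - \<gamma>)" by (simp add: algebra_simps)
  then have "real n powr (1 - \<gamma>) * (real n + 1) powr \<gamma> * (real n + 1) powr (- \<gamma>) \<le> ((real n + 1) - (1 - \<gamma>)) * (real n + 1) powr (- \<gamma>)"
    by (rule mult_right_mono) simp
  also have "real n powr (1 - \<gamma>) * (real n + 1) powr \<gamma> * (real n + 1) powr (- \<gamma>) = real n powr (1 - \<gamma>)"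
    by (simp add: mult.assoc flip: powr_add)
  also have "((real n + 1) - (1 - \<gamma>)) * (real n + 1) powr (- \<gamma>) = (real n + 1) powr (1 - \<gamma>) - (1 - \<gamma>) * (real n + 1) powr (- \<gamma>)"
    using powr_mult_base[of "real n + 1" "- \<gamma>"] by (simp add: algebra_simps)
  finally have "(1 - \<gamma>) * (real n + 1) powr (- \<gamma>) \<le> (real n + 1) powr (1 - \<gamma>) - real n powr (1 - \<gamma>)" by simp
  then have "(real n + 1) powr (- \<gamma>) \<le> ((real n + 1) powr (1 - \<gamma>) - real n powr (1 - \<gamma>)) / (1 - \<gamma>)"
    using g by (simp add: field_simps)
  then show ?case using Suc.IH by (simp add: diff_divide_distrib add.commute)
qed simp

text \<open>Each distance to \<open>k\<close> occurs at most once on either side, hence the factor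
  2.\<close>

lemma sum_dist_powr_le:
  fixes \<gamma> :: real
  assumes g: "0 < \<gamma>" "\<gamma> < 1" and k: "k < n" and L: "L \<subseteq> {..<n}"
  shows "(\<Sum>l\<in>L. (\<bar>real k - real l\<bar> + 1) powr (- \<gamma>)) \<le> 2 * real n powr (1 - \<gamma>) / (1 - \<gamma>)"
proof -
  let ?f = "\<lambda>m. (real m + 1) powr (- \<gamma>)"
  have "(\<Sum>l\<in>L. (\<bar>real k - real l\<bar> + 1) powr (- \<gamma>)) \<le> (\<Sum>l<n. (\<bar>real k - real l\<bar> + 1) powr (- \<gamma>))"
    by (rule sum_mono2) (use L in auto)
  also have "{..<n} = {..<k} \<union> {k..<n}" using k by auto
  also have "(\<Sum>l\<in>\<dots>. (\<bar>real k - real l\<bar> + 1) powr (- \<gamma>))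
     = (\<Sum>l\<in>{..<k}. (\<bar>real k - real l\<bar> + 1) powr (- \<gamma>)) + (\<Sum>l\<in>{k..<n}. (\<bar>real k - real l\<bar> + 1) powr (- \<gamma>))"
    by (rule sum.union_disjoint) auto
  also have "(\<Sum>l\<in>{..<k}. (\<bar>real k - real l\<bar> + 1) powr (- \<gamma>)) = (\<Sum>l\<in>{..<k}. ?f (k - l))"
    by (intro sum.cong) auto
  also have "\<dots> = sum ?f ((\<lambda>l. k - l) ` {..<k})"
    by (subst sum.reindex) (auto simp: inj_on_def)
  also have "\<dots> \<le> sum ?f {..<n}"
    by (rule sum_mono2) (use k in auto)
  also have "(\<Sum>l\<in>{k..<n}. (\<bar>real k - real l\<bar> + 1) powr (- \<gamma>)) = (\<Sum>l\<in>{k..<n}. ?f (l - k))"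
    by (intro sum.cong) auto
  also have "\<dots> = sum ?f ((\<lambda>l. l - k) ` {k..<n})"
    by (subst sum.reindex) (auto simp: inj_on_def)
  also have "\<dots> \<le> sum ?f {..<n}"
    by (rule sum_mono2) (use k in auto)
  finally show ?thesis using sum_powr_le[OF g, of n] by simp
qed

text \<open>The averages used below omit \<open>k = 0\<close> and the last \<open>p\<close> cells
  and are divided by \<open>n - p\<close>; comparison with the full midpoint Riemann sum shows that
  this does not affect the limit.\<close>

lemma midpoint_sum_tendsto:
  fixes f :: "real \<Rightarrow> real"
  assumes f: "continuous_on {0..1} f"
  shows "(\<lambda>n. 1 / real (n - p) * (\<Sum>k=1..<n - p. f ((real k + 1/2) / real n))) \<longlonglongrightarrow> integral {0..1} f"
proof -
  let ?R = "\<lambda>n. 1 / real n * (\<Sum>k<n. f ((real k + 1/2) / real n))" and ?S = "\<lambda>n. 1 / real (n - p) * (\<Sum>k=1..<n - p. f ((real k + 1/2) / real n))"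
  obtain B where B: "\<And>t. t \<in> {0..1} \<Longrightarrow> \<bar>f t\<bar> \<le> B"
    using compact_continuous_image[OF f] compact_imp_bounded bounded_iff by (metis compact_Icc image_eqI real_norm_def)
  have B0: "B \<ge> 0" using B[of 0] by force
  have "(\<lambda>n. ?R n) \<longlonglongrightarrow> integral {0..1} f"
  proof (rule LIMSEQ_I)
    fix e :: real assume e: "e > 0"
    have "uniformly_continuous_on {0..1} f" by (intro compact_uniformly_continuous f) simp
    then obtain d where d: "d > 0" "\<And>x y. x \<in> {0..1} \<Longrightarrow> y \<in> {0..1} \<Longrightarrow> dist x y < d \<Longrightarrow> dist (f x) (f y) < e / 2"
      unfolding uniformly_continuous_on_def using e by (metis dist_commute half_gt_zero)
    obtain N where N: "real N > 1 / d" using reals_Archimedean2 by blast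
    show "\<exists>no. \<forall>n\<ge>no. norm (?R n - integral {0..1} f) < e"
    proof (intro exI allI impI)
      fix n assume n: "n \<ge> N + 1"
      have n0: "n > 0" using n by simp
      have nd: "1 / real n < d"
      proof -
        have "1 / d < real n" using n N by linarith
        then show ?thesis using d(1) n0 by (simp add: field_simps)
      qed
      have int: "f integrable_on {a..b}" if "0 \<le> a" "b \<le> 1" for a b
        by (rule integrable_continuous_real, rule continuous_on_subset[OF f]) (use that in auto)
      have part: "integral {0..real m / real n} f = (\<Sum>k<m. integral {real k / real n..real (Suc k) / real n} f)" if "m \<le> n" for m
        using that
      proof (induction m)
        case (Suc m)
        have "integral {0..real (Suc m) / real n} f = integral {0..real m / real n} f + integral {real m / real n..real (Suc m) / real n} f"
          by (rule Henstock_Kurzweil_Integration.integral_combine[symmetric]) (use Suc n0 in \<open>auto simp: divide_simps intro!: int\<close>)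
        then show ?case using Suc by simp
      qed simp
      have piece: "\<bar>1 / real n * f ((real k + 1/2) / real n) - integral {real k / real n..real (Suc k) / real n} f\<bar> \<le> (e / 2) * (1 / real n)" if "k < n" for k
      proof -
        let ?t = "(real k + 1/2) / real n"
        let ?I = "{real k / real n..real (Suc k) / real n}"
        have len: "real (Suc k) / real n - real k / real n = 1 / real n" by (simp add: add_divide_distrib)
        have sub: "?I \<subseteq> {0..1}" using that n0 by (auto simp: divide_simps)
        have tI: "?t \<in> ?I" using n0 by (auto simp: divide_simps)
        have intI: "f integrable_on ?I" by (rule integrable_continuous_real, rule continuous_on_subset[OF f sub])
        have "integral ?I (\<lambda>x. f x - f ?t) = integral ?I f - integral ?I (\<lambda>x. f ?t)"
          by (rule Henstock_Kurzweil_Integration.integral_diff[OF intI]) auto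
        then have eq: "integral ?I f - 1 / real n * f ?t = integral ?I (\<lambda>x. f x - f ?t)"
          using len by (simp add: divide_right_mono)
        have "norm (integral ?I (\<lambda>x. f x - f ?t)) \<le> (e / 2) * (real (Suc k) / real n - real k / real n)"
        proof (rule integral_bound)
          show "continuous_on ?I (\<lambda>x. f x - f ?t)" by (intro continuous_intros continuous_on_subset[OF f sub])
          fix x assume x: "x \<in> ?I"
          have "dist x ?t \<le> 1 / real n" using x tI len by (auto simp: dist_real_def)
          then have "dist x ?t < d" using nd by linarith
          moreover have "x \<in> {0..1}" "?t \<in> {0..1}" using x tI sub by blast+
          ultimately have "dist (f x) (f ?t) < e / 2" using d(2) by blast
          then show "norm (f x - f ?t) \<le> e / 2" by (simp add: dist_real_def)
        qed (use n0 in \<open>auto simp: divide_simps\<close>)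
        then show ?thesis unfolding len using eq by (simp add: abs_minus_commute)
      qed
      have "\<bar>?R n - integral {0..1} f\<bar>
         = \<bar>\<Sum>k<n. 1 / real n * f ((real k + 1/2) / real n) - integral {real k / real n..real (Suc k) / real n} f\<bar>"
        using part[of n] n0 by (simp add: sum_distrib_left sum_subtractf)
      also have "\<dots> \<le> (\<Sum>k<n. (e / 2) * (1 / real n))"
        by (rule order_trans[OF sum_abs], rule sum_mono, rule piece) auto
      also have "\<dots> = e / 2" using n0 by simp
      finally show "norm (?R n - integral {0..1} f) < e" using e by simp
    qed
  qed
  moreover have "(\<lambda>n. ?S n - ?R n) \<longlonglongrightarrow> 0"
  proof (rule Lim_null_comparison)
    \<comment> \<open>The change of normalisation costs \<open>p B / n\<close>, and the
      \<open>p + 1\<close> omitted terms cost \<open>(p + 1) B / n\<close>.\<close>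
    show "(\<lambda>n. (2 * real p + 1) * B / real (n - p)) \<longlonglongrightarrow> 0"
    proof -
      have "(\<lambda>n. (2 * real p + 1) * B / real n) \<longlonglongrightarrow> 0" by (rule lim_const_over_n)
      then have "(\<lambda>n. (2 * real p + 1) * B / real (n + p - p)) \<longlonglongrightarrow> 0" by simp
      then show ?thesis by (rule LIMSEQ_offset[where k=p])
    qed
    show "\<forall>\<^sub>F n in sequentially. norm (?S n - ?R n)
       \<le> (2 * real p + 1) * B / real (n - p)"
      using eventually_gt_at_top[of "p + 1"]
    proof eventually_elim
      case (elim n)
      let ?g = "\<lambda>k. f ((real k + 1/2) / real n)"
      have g: "\<bar>?g k\<bar> \<le> B" if "k < n" for k
        using that by (intro B) (auto simp: divide_simps)
      define N where "N = real (n - p)"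
      have N: "N > 0" "real n = N + real p" using elim by (auto simp: N_def)
      have split: "sum ?g {..<n} = sum ?g {1..<n-p} + sum ?g (insert 0 {n-p..<n})"
      proof -
        have "{..<n} = {1..<n-p} \<union> insert 0 {n-p..<n}" using elim by auto
        then show ?thesis by (simp only:) (rule sum.union_disjoint, use elim in auto)
      qed
      have r: "\<bar>sum ?g (insert 0 {n-p..<n})\<bar> \<le> (real p + 1) * B"
      proof -
        have "\<bar>sum ?g (insert 0 {n-p..<n})\<bar> \<le> (\<Sum>k\<in>insert 0 {n-p..<n}. B)"
          by (rule order_trans[OF sum_abs], rule sum_mono, rule g) (use elim in auto)
        also have "\<dots> = (real p + 1) * B" using elim by (simp add: card_insert_if)
        finally show ?thesis .
      qed
      have s: "\<bar>sum ?g {1..<n-p}\<bar> \<le> N * B"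
      proof -
        have "\<bar>sum ?g {1..<n-p}\<bar> \<le> (\<Sum>k\<in>{1..<n-p}. B)"
          by (rule order_trans[OF sum_abs], rule sum_mono, rule g) auto
        also have "\<dots> = real (n - p - 1) * B" by simp
        also have "\<dots> \<le> N * B" using B0 by (intro mult_right_mono) (auto simp: N_def)
        finally show ?thesis .
      qed
      have "1 / N * sum ?g {1..<n-p} - 1 / real n * sum ?g {..<n}
        = (real p / (N * real n)) * sum ?g {1..<n-p} - 1 / real n * sum ?g (insert 0 {n-p..<n})"
      proof -
        have "1 / N * a - 1 / (N + real p) * (a + b) = (real p / (N * (N + real p))) * a - 1 / (N + real p) * b" for a b
          using N(1) by (simp add: divide_simps add_nonneg_eq_0_iff) (simp add: algebra_simps)
        then show ?thesis unfolding split N(2)[symmetric] .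
      qed
      also have "\<bar>\<dots>\<bar> \<le> (real p / (N * real n)) * (N * B) + 1 / real n * ((real p + 1) * B)"
      proof (rule order_trans[OF abs_triangle_ineq4], rule add_mono)
        show "\<bar>real p / (N * real n) * sum ?g {1..<n-p}\<bar> \<le> (real p / (N * real n)) * (N * B)"
          using s N by (simp only: abs_mult) (intro mult_mono, auto)
        show "\<bar>1 / real n * sum ?g (insert 0 {n-p..<n})\<bar> \<le> 1 / real n * ((real p + 1) * B)"
          using r by (simp only: abs_mult) (intro mult_mono, auto)
      qed
      also have "\<dots> = (2 * real p + 1) * B / real n" using N by (simp add: divide_simps) (simp add: algebra_simps)
      also have "\<dots> \<le> (2 * real p + 1) * B / N" using N B0 by (intro divide_left_mono) auto
      finally show ?case by (simp add: N_def)
    qed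
  qed
  ultimately show ?thesis using tendsto_add by fastforce
qed

lemma (in prob_space) cauchy_schwarz_expectation:
  assumes "integrable M (\<lambda>x. (f x)\<^sup>2)" "integrable M (\<lambda>x. (g x)\<^sup>2)" "integrable M (\<lambda>x. f x * g x :: real)"
  shows "\<bar>expectation (\<lambda>x. f x * g x)\<bar> \<le> sqrt (expectation (\<lambda>x. (f x)\<^sup>2)) * sqrt (expectation (\<lambda>x. (g x)\<^sup>2))"
proof -
  let ?a = "expectation (\<lambda>x. (f x)\<^sup>2)" and ?b = "expectation (\<lambda>x. f x * g x)" and ?c = "expectation (\<lambda>x. (g x)\<^sup>2)"
  have q: "0 \<le> t\<^sup>2 * ?a + 2 * t * s * ?b + s\<^sup>2 * ?c" for s t :: real
  proof -
    have "0 \<le> expectation (\<lambda>x. (t * f x + s * g x)\<^sup>2)" by simp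
    also have "\<dots> = expectation (\<lambda>x. t\<^sup>2 * (f x)\<^sup>2 + 2 * t * s * (f x * g x) + s\<^sup>2 * (g x)\<^sup>2)"
      by (simp add: power2_eq_square algebra_simps)
    also have "\<dots> = t\<^sup>2 * ?a + 2 * t * s * ?b + s\<^sup>2 * ?c" using assms by simp
    finally show ?thesis .
  qed
  have ac: "0 \<le> ?a" "0 \<le> ?c" by simp_all
  have "?b\<^sup>2 \<le> ?a * ?c"
  proof (cases "?c = 0")
    case True
    have "?b = 0"
    proof (rule ccontr)
      assume "?b \<noteq> 0"
      \<comment> \<open>For \<open>?c = 0\<close> the form is affine in its second argument; this
        value of it makes the form equal to \<open>-1\<close>.\<close>
      with q[of 1 "- (?a + 1) / (2 * ?b)"] True show False by (simp add: field_simps)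
    qed
    then show ?thesis using True by simp
  next
    case False
    have "0 \<le> ?c * (?a * ?c - ?b\<^sup>2)"
      using q[of "?c" "- ?b"] by (simp add: power2_eq_square algebra_simps)
    then show ?thesis using False ac by (simp add: zero_le_mult_iff)
  qed
  then show ?thesis by (metis real_sqrt_abs real_sqrt_le_mono real_sqrt_mult)
qed

lemma min_one_le_powr:
  fixes x a :: real
  assumes "0 \<le> x" "0 < a" "a \<le> 1"
  shows "min 1 x \<le> x powr a"
proof (cases "x \<ge> 1")
  case True then show ?thesis using assms by (simp add: ge_one_powr_ge_zero)
next
  case False
  show ?thesis
  proof (cases "x = 0")
    case False
    have "x powr 1 \<le> x powr a" by (rule powr_mono') (use assms \<open>\<not> x \<ge> 1\<close> in auto)
    then show ?thesis using assms \<open>\<not> x \<ge> 1\<close> by simp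
  qed auto
qed

section \<open>The local scale of the process from (A.1)\<close>

definition midpt :: "nat \<Rightarrow> nat \<Rightarrow> real" where
  "midpt n k = (real k + 1/2) / real n"

lemma midpt_in: "k < n \<Longrightarrow> midpt n k \<in> {0<..<1}"
  by (auto simp: midpt_def divide_simps)

lemma midpt_in': "k < n \<Longrightarrow> midpt n k \<in> {0..1}"
  using midpt_in[of k n] by auto

lemma midpt_Suc: "n > 0 \<Longrightarrow> midpt n (Suc k) = midpt n k + 1 / real n"
  by (simp add: midpt_def field_simps)

text \<open>The reason for sampling at midpoints: every cell, also \<open>k = 0\<close>, has its
  midpoint in the open interval to which (A.1) refers, and rounding down returns
  \<open>k\<close>.\<close>

lemma floor_midpt: "n > 0 \<Longrightarrow> \<lfloor>real n * midpt n k\<rfloor> = int k"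
  by (simp add: midpt_def)

lemma uniform_continuity_midpt:
  fixes f :: "real \<Rightarrow> real"
  assumes f: "continuous_on {0..1} f" and e: "e > 0"
  shows "\<forall>\<^sub>F n in sequentially. \<forall>k. Suc k < n \<longrightarrow> \<bar>f (midpt n (Suc k)) - f (midpt n k)\<bar> \<le> e"
proof -
  have "uniformly_continuous_on {0..1} f" by (intro compact_uniformly_continuous f) simp
  then obtain d where d: "d > 0" "\<And>x y. x \<in> {0..1} \<Longrightarrow> y \<in> {0..1} \<Longrightarrow> dist x y < d \<Longrightarrow> dist (f x) (f y) < e"
    unfolding uniformly_continuous_on_def using e by (metis dist_commute)
  have "(\<lambda>n. 1 / real n) \<longlonglongrightarrow> 0" by (rule lim_1_over_n)
  then have "\<forall>\<^sub>F n in sequentially. 1 / real n < d" using d(1) by (rule order_tendstoD)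
  then show ?thesis
  proof eventually_elim
    case (elim n)
    show ?case
    proof (intro allI impI)
      fix k assume k: "Suc k < n"
      have "dist (midpt n (Suc k)) (midpt n k) < d"
        using k elim by (simp add: midpt_Suc dist_real_def)
      then show "\<bar>f (midpt n (Suc k)) - f (midpt n k)\<bar> \<le> e"
        using d(2)[of "midpt n (Suc k)" "midpt n k"] midpt_in'[of k n] midpt_in'[of "Suc k" n] k
        by (auto simp: dist_real_def less_imp_le)
    qed
  qed
qed

text \<open>Passing to \<open>ennreal\<close> cuts off negative values, so the conclusion is a
  one-sided bound.\<close>

lemma SUP_ennreal_tendsto_0D:
  fixes f :: "nat \<Rightarrow> real \<Rightarrow> real"
  assumes lim: "(\<lambda>n. SUP t\<in>A n. ennreal (f n t)) \<longlonglongrightarrow> 0" and e: "e > 0"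
  shows "\<forall>\<^sub>F n in sequentially. \<forall>t\<in>A n. f n t \<le> e"
proof -
  have "\<forall>\<^sub>F n in sequentially. (SUP t\<in>A n. ennreal (f n t)) < ennreal e"
    using lim by (rule order_tendstoD) (use e in auto)
  then show ?thesis
  proof eventually_elim
    case (elim n)
    show ?case
    proof
      fix t assume "t \<in> A n"
      then have "ennreal (f n t) \<le> (SUP t\<in>A n. ennreal (f n t))" by (rule SUP_upper)
      then have "ennreal (f n t) < ennreal e" using elim by (rule le_less_trans)
      then show "f n t \<le> e" using e
        by (metis ennreal_leI leD linorder_le_cases)
    qed
  qed
qed

definition grid_var :: "'a measure \<Rightarrow> (real \<Rightarrow> 'a \<Rightarrow> real) \<Rightarrow> nat \<Rightarrow> nat \<Rightarrow> nat \<Rightarrow> real" where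
  "grid_var M X n k j = (\<integral>\<omega>. (X (real (k + j) / real n) \<omega> - X (real k / real n) \<omega>)\<^sup>2 \<partial>M)"

text \<open>(A.1) gives the variance of a difference of lag \<open>j\<close> relative to the scale
  at its own base point, but all differences near cell \<open>k\<close> must be measured in the
  single scale \<open>\<tau> n k\<close>. Continuity of \<open>c\<close> and the second limit in
  (A.1) make the scales of neighbouring cells asymptotically equal, and \<open>m\<close> such steps
  are chained by induction.\<close>

lemma assumption_A1_grid_var:
  assumes A1: "assumption_A1 M X H"
  obtains \<tau> :: "nat \<Rightarrow> nat \<Rightarrow> real" where
    "\<And>n k. k < n \<Longrightarrow> \<tau> n k > 0"
    "\<And>j m e. j \<ge> 1 \<Longrightarrow> e > 0 \<Longrightarrow> \<forall>\<^sub>F n in sequentially. \<forall>k. k + m + j \<le> n \<longrightarrow>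
       \<bar>grid_var M X n (k + m) j / (\<tau> n k)\<^sup>2 - real j powr (2 * H (midpt n k))\<bar> \<le> e"
proof -
  from A1 obtain c where cH: "continuous_on {0..1} H" and H: "\<And>t. t \<in> {0..1} \<Longrightarrow> 0 < H t \<and> H t < 1"
    and cc: "continuous_on {0..1} c" and c: "\<And>t. t \<in> {0..1} \<Longrightarrow> 0 < c t"
    and L1: "\<And>j::nat. j \<ge> 1 \<Longrightarrow> (\<lambda>n::nat.
             SUP t \<in> {t \<in> {0<..<1}. of_int \<lfloor>real n * t\<rfloor> / real n \<in> {0..1} \<and>
                        (of_int \<lfloor>real n * t\<rfloor> + real j) / real n \<in> {0..1}}.
               ennreal \<bar>(\<integral>\<omega>. (X ((of_int \<lfloor>real n * t\<rfloor> + real j) / real n) \<omega>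
                                - X (of_int \<lfloor>real n * t\<rfloor> / real n) \<omega>)\<^sup>2 \<partial>M)
                         / (real j / real n) powr (2 * H t) - c t\<bar>) \<longlonglongrightarrow> 0"
    and L2: "(\<lambda>n::nat. SUP t \<in> {t \<in> {0<..<1}. t + 1 / real n \<in> {0..1}}.
          ennreal (\<bar>H t - H (t + 1 / real n)\<bar> * ln (real n))) \<longlonglongrightarrow> 0"
    unfolding assumption_A1_def by blast
  obtain c0 where c0: "c0 > 0" "\<And>t. t \<in> {0..1} \<Longrightarrow> c0 \<le> c t"
  proof -
    obtain s where "s \<in> {0..1}" "\<And>t. t \<in> {0..1} \<Longrightarrow> c s \<le> c t"
      using continuous_attains_inf[OF _ _ cc] by auto
    then show ?thesis using c that by blast
  qed
  define \<tau> where "\<tau> n k = sqrt (c (midpt n k)) * real n powr (- H (midpt n k))" for n k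
  have tpos: "\<tau> n k > 0" if "k < n" for n k
    using c[OF midpt_in'[OF that]] that by (simp add: \<tau>_def)
  have tsq: "(\<tau> n k)\<^sup>2 = c (midpt n k) * real n powr (- (2 * H (midpt n k)))" if "k < n" for n k
  proof -
    have "(real n powr (- H (midpt n k)))\<^sup>2 = real n powr (- (2 * H (midpt n k)))"
      by (simp add: power2_eq_square flip: powr_add)
    then show ?thesis using c[OF midpt_in'[OF that]] by (simp add: \<tau>_def power_mult_distrib)
  qed
  have Jle: "real j powr (2 * H t) \<le> (real j)\<^sup>2" if "j \<ge> 1" "t \<in> {0..1}" for j t
  proof -
    have "real j powr (2 * H t) \<le> real j powr 2" using H[OF that(2)] that(1) by (intro powr_mono) auto
    then show ?thesis using that(1) by simp
  qed
  have J0: "\<forall>\<^sub>F n in sequentially. \<forall>k. k + j \<le> n \<longrightarrow>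
       \<bar>grid_var M X n k j / (\<tau> n k)\<^sup>2 - real j powr (2 * H (midpt n k))\<bar> \<le> e" if j: "j \<ge> 1" and e: "e > 0" for j e
  proof -
    let ?e = "e * c0 / (real j)\<^sup>2"
    have "?e > 0" using j e c0 by simp
    from SUP_ennreal_tendsto_0D[OF L1[OF j] this] show ?thesis
    proof eventually_elim
      case (elim n)
      show ?case
      proof (intro allI impI)
        fix k assume k: "k + j \<le> n"
        let ?t = "midpt n k"
        have kn: "k < n" "n > 0" using j k by auto
        have fl: "of_int \<lfloor>real n * ?t\<rfloor> = real k" using kn by (simp add: floor_midpt)
        have kj: "real k + real j \<le> real n" using k by (metis of_nat_add of_nat_le_iff)
        have tA: "?t \<in> {t \<in> {0<..<1}. of_int \<lfloor>real n * t\<rfloor> / real n \<in> {0..1} \<and>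
                        (of_int \<lfloor>real n * t\<rfloor> + real j) / real n \<in> {0..1}}"
          using midpt_in[OF kn(1)] kn kj unfolding mem_Collect_eq fl by (auto simp: divide_simps)
        have "\<bar>(\<integral>\<omega>. (X ((real k + real j) / real n) \<omega> - X (real k / real n) \<omega>)\<^sup>2 \<partial>M)
                         / (real j / real n) powr (2 * H ?t) - c ?t\<bar> \<le> ?e"
          using elim[rule_format, OF tA] unfolding fl .
        then have b: "\<bar>grid_var M X n k j / (real j / real n) powr (2 * H ?t) - c ?t\<bar> \<le> ?e"
          by (simp add: grid_var_def)
        let ?J = "real j powr (2 * H ?t)" and ?c = "c ?t"
        have cp: "?c > 0" using c midpt_in'[OF kn(1)] by blast
        have Jp: "?J > 0" using j by simp
        have np: "real n powr (- (2 * H ?t)) > 0" using kn by simp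
        have d: "(real j / real n) powr (2 * H ?t) = ?J * real n powr (- (2 * H ?t))"
          using kn by (simp add: powr_divide powr_minus_divide)
        have "grid_var M X n k j / (\<tau> n k)\<^sup>2 - ?J = (grid_var M X n k j / (real j / real n) powr (2 * H ?t) - ?c) * (?J / ?c)"
          unfolding tsq[OF kn(1)] d using cp Jp np by (simp add: divide_simps) (simp add: algebra_simps)?
        then have "\<bar>grid_var M X n k j / (\<tau> n k)\<^sup>2 - ?J\<bar> = \<bar>grid_var M X n k j / (real j / real n) powr (2 * H ?t) - ?c\<bar> * (?J / ?c)"
          using cp Jp by (simp add: abs_mult)
        also have "\<dots> \<le> ?e * ((real j)\<^sup>2 / c0)"
          using b Jle[OF j midpt_in'[OF kn(1)]] c0(2)[OF midpt_in'[OF kn(1)]] c0(1) cp e Jp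
          by (intro mult_mono frac_le) auto
        also have "\<dots> = e" using c0 j by simp
        finally show "\<bar>grid_var M X n k j / (\<tau> n k)\<^sup>2 - ?J\<bar> \<le> e" .
      qed
    qed
  qed
  have ratio: "\<forall>\<^sub>F n in sequentially. \<forall>k. Suc k < n \<longrightarrow> \<bar>(\<tau> n (Suc k))\<^sup>2 / (\<tau> n k)\<^sup>2 - 1\<bar> \<le> e" if e: "e > 0" for e
  proof -
    obtain d where d: "d > 0" "\<And>y::real. \<bar>y\<bar> < d \<Longrightarrow> \<bar>exp y - 1\<bar> < e"
    proof -
      have "isCont exp (0::real)" by simp
      then have "\<exists>d>0. \<forall>y::real. dist y 0 < d \<longrightarrow> dist (exp y) (exp 0) < e"
        unfolding continuous_at_eps_delta using e by blast
      then show ?thesis using that by (auto simp: dist_real_def)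
    qed
    have lc: "continuous_on {0..1} (\<lambda>t. ln (c t))"
      by (intro continuous_intros cc) (use c in force)
    have "d / 4 > 0" using d by simp
    from uniform_continuity_midpt[OF lc this] SUP_ennreal_tendsto_0D[OF L2 this] eventually_gt_at_top[of 0]
    show ?thesis
    proof eventually_elim
      case (elim n)
      show ?case
      proof (intro allI impI)
        fix k assume k: "Suc k < n"
        let ?t = "midpt n k" and ?u = "midpt n (Suc k)"
        have t: "?t \<in> {0<..<1}" "?u \<in> {0<..<1}" using midpt_in k by auto
        then have cp: "c ?t > 0" "c ?u > 0" using c by auto
        have u: "?u = ?t + 1 / real n" using midpt_Suc elim by simp
        have 1: "\<bar>ln (c ?u) - ln (c ?t)\<bar> \<le> d / 4" using elim(1) k by blast
        have "?t \<in> {t \<in> {0<..<1}. t + 1 / real n \<in> {0..1}}" using t u by auto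
        then have 2: "\<bar>H ?t - H ?u\<bar> * ln (real n) \<le> d / 4" using elim(2) unfolding u by blast
        \<comment> \<open>The logarithm of the quotient of the squared scales. The factor
          \<open>ln n\<close> is why (A.1) demands a rate for the increments of \<open>H\<close> and
          not mere continuity; the total is at most \<open>d/4 + 2 d/4 < d\<close>.\<close>
        let ?y = "(ln (c ?u) - ln (c ?t)) + 2 * ((H ?t - H ?u) * ln (real n))"
        have "\<bar>(H ?t - H ?u) * ln (real n)\<bar> \<le> d / 4" using 2 elim(3) by (simp add: abs_mult)
        then have y: "\<bar>?y\<bar> < d" using 1 d(1) by linarith
        have "(\<tau> n (Suc k))\<^sup>2 / (\<tau> n k)\<^sup>2 = exp ?y"
          using tsq[of k n] tsq[of "Suc k" n] tpos[of k n] k elim(3) cp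
          by (simp add: powr_def exp_add exp_diff algebra_simps exp_minus divide_simps)
        then show "\<bar>(\<tau> n (Suc k))\<^sup>2 / (\<tau> n k)\<^sup>2 - 1\<bar> \<le> e" using d(2)[OF y] by simp
      qed
    qed
  qed
  have main: "\<forall>\<^sub>F n in sequentially. \<forall>k. k + m + j \<le> n \<longrightarrow>
       \<bar>grid_var M X n (k + m) j / (\<tau> n k)\<^sup>2 - real j powr (2 * H (midpt n k))\<bar> \<le> e" if j: "j \<ge> 1" and e: "e > 0" for j m e
    using e
  proof (induction m arbitrary: e)
    case 0
    show ?case using J0[OF j 0] by simp
  next
    case (Suc m)
    \<comment> \<open>Chosen for the three error terms below: since \<open>e' \<le> 1\<close>,
      \<open>\<bar>?A\<bar>\<close> is at most \<open>j^2 + 1\<close>, and they add up to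
      \<open>(j^2 + 3) e'\<close>.\<close>
    define e' where "e' = min 1 (e / ((real j)\<^sup>2 + 3))"
    have j2: "(real j)\<^sup>2 + 3 > 0" by (simp add: add_nonneg_pos)
    have e': "e' > 0" "e' \<le> 1" "((real j)\<^sup>2 + 3) * e' \<le> e"
    proof -
      show "e' > 0" "e' \<le> 1" using Suc.prems j2 by (auto simp: e'_def)
      have "e' \<le> e / ((real j)\<^sup>2 + 3)" by (simp add: e'_def)
      then show "((real j)\<^sup>2 + 3) * e' \<le> e" using j2 by (simp add: field_simps)
    qed
    have cJ: "continuous_on {0..1} (\<lambda>t. real j powr (2 * H t))"
      by (intro continuous_intros cH) (use j in auto)
    from Suc.IH[OF e'(1)] ratio[OF e'(1)] uniform_continuity_midpt[OF cJ e'(1)]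
    show ?case
    proof eventually_elim
      case (elim n)
      show ?case
      proof (intro allI impI)
        fix k assume k: "k + Suc m + j \<le> n"
        have kn: "Suc k < n" "k < n" using k j by auto
        let ?J = "\<lambda>k. real j powr (2 * H (midpt n k))"
        let ?A = "grid_var M X n (Suc k + m) j / (\<tau> n (Suc k))\<^sup>2" and ?r = "(\<tau> n (Suc k))\<^sup>2 / (\<tau> n k)\<^sup>2"
        have a: "\<bar>?A - ?J (Suc k)\<bar> \<le> e'" using elim(1)[rule_format, of "Suc k"] k by simp
        have r: "\<bar>?r - 1\<bar> \<le> e'" using elim(2) kn by blast
        have J: "\<bar>?J (Suc k) - ?J k\<bar> \<le> e'" using elim(3) kn by blast
        have "0 \<le> ?J (Suc k)" by simp
        then have A: "\<bar>?A\<bar> \<le> (real j)\<^sup>2 + 1"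
          using a Jle[OF j midpt_in'[OF kn(1)]] e'(2) by linarith
        have "\<bar>?A * (?r - 1)\<bar> \<le> ((real j)\<^sup>2 + 1) * e'"
          unfolding abs_mult using A r by (intro mult_mono) auto
        moreover have "?A * ?r - ?J k = ?A * (?r - 1) + (?A - ?J (Suc k)) + (?J (Suc k) - ?J k)"
          by (simp only: right_diff_distrib)
        ultimately have "\<bar>?A * ?r - ?J k\<bar> \<le> ((real j)\<^sup>2 + 1) * e' + e' + e'" using a J by linarith
        also have "\<dots> = ((real j)\<^sup>2 + 3) * e'" by (simp add: algebra_simps)
        also have "\<dots> \<le> e" by (rule e')
        also have "?A * ?r = grid_var M X n (k + Suc m) j / (\<tau> n k)\<^sup>2"
          using tpos[OF kn(1)] by simp
        finally show "\<bar>grid_var M X n (k + Suc m) j / (\<tau> n k)\<^sup>2 - ?J k\<bar> \<le> e" .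
      qed
    qed
  qed
  show ?thesis by (rule that[OF tpos main]) auto
qed

section \<open>Variances and correlations of the increments\<close>

locale gauss_process = prob_space M for M :: "'a measure" +
  fixes X :: "real \<Rightarrow> 'a \<Rightarrow> real"
  assumes gaussian: "centered_gaussian_process M {0..1} X"
begin

lemma gaussian_family_grid:
  assumes n: "n > 0"
  shows "gaussian_family M {..n} (\<lambda>k. X (real k / real n))"
proof
  fix c :: "nat \<Rightarrow> real"
  define g where "g k = real k / real n" for k :: nat
  have inj: "inj_on g {..n}" using n by (auto simp: inj_on_def g_def)
  have "centered_gaussian_rv M (\<lambda>\<omega>. \<Sum>t\<in>g ` {..n}. c (inv_into {..n} g t) * X t \<omega>)"
    by (rule gaussian[unfolded centered_gaussian_process_def, rule_format])
       (use n in \<open>auto simp: g_def divide_simps\<close>)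
  also have "(\<lambda>\<omega>. \<Sum>t\<in>g ` {..n}. c (inv_into {..n} g t) * X t \<omega>) = (\<lambda>\<omega>. \<Sum>k\<le>n. c k * X (real k / real n) \<omega>)"
    using inj by (simp add: sum.reindex g_def[symmetric] o_def)
  finally show "centered_gaussian_rv M (\<lambda>\<omega>. \<Sum>k\<le>n. c k * X (real k / real n) \<omega>)" .
qed simp

definition incr_coeff :: "nat \<Rightarrow> nat \<Rightarrow> nat \<Rightarrow> real" where
  "incr_coeff p k l = (\<Sum>i=0..p. (-1) ^ (p - i) * real (p choose i) * (if l = k + i then 1 else 0))"

abbreviation D :: "nat \<Rightarrow> nat \<Rightarrow> nat \<Rightarrow> 'a \<Rightarrow> real" where
  "D p n k \<omega> \<equiv> incr p n k (\<lambda>t. X t \<omega>)"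

abbreviation sd :: "nat \<Rightarrow> nat \<Rightarrow> nat \<Rightarrow> real" where
  "sd \<equiv> incr_sd M X"

lemma lf_incr_coeff:
  assumes "n > 0" "k + p \<le> n"
  shows "gaussian_family.lf {..n} (\<lambda>k. X (real k / real n)) (incr_coeff p k) = D p n k"
proof
  fix \<omega>
  interpret G: gaussian_family M "{..n}" "\<lambda>k. X (real k / real n)" using assms(1) by (rule gaussian_family_grid)
  have "G.lf (incr_coeff p k) \<omega> = (\<Sum>l\<le>n. \<Sum>i=0..p. if l = k + i then (-1) ^ (p - i) * real (p choose i) * X (real l / real n) \<omega> else 0)"
    unfolding G.lf_def incr_coeff_def sum_distrib_right by (intro sum.cong refl) auto
  also have "\<dots> = (\<Sum>i=0..p. \<Sum>l\<le>n. if l = k + i then (-1) ^ (p - i) * real (p choose i) * X (real l / real n) \<omega> else 0)"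
    by (rule sum.swap)
  also have "\<dots> = D p n k \<omega>"
    unfolding incr_def using assms(2) by (intro sum.cong refl) simp
  finally show "G.lf (incr_coeff p k) \<omega> = D p n k \<omega>" .
qed

lemma integrable_X_mult:
  assumes "n > 0" "k \<le> n" "l \<le> n"
  shows "integrable M (\<lambda>\<omega>. X (real k / real n) \<omega> * X (real l / real n) \<omega>)"
proof -
  interpret G: gaussian_family M "{..n}" "\<lambda>k. X (real k / real n)" using assms(1) by (rule gaussian_family_grid)
  show ?thesis using assms by (intro G.integrable_Z_mult) auto
qed

lemma integrable_D_mult:
  assumes "n > 0" "k + p \<le> n" "l + p \<le> n"
  shows "integrable M (\<lambda>\<omega>. D p n k \<omega> * D p n l \<omega>)"
proof -
  interpret G: gaussian_family M "{..n}" "\<lambda>k. X (real k / real n)" using assms(1) by (rule gaussian_family_grid)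
  show ?thesis using G.integrable_lf_mult[of "incr_coeff p k" "incr_coeff p l"] assms by (simp add: lf_incr_coeff)
qed

lemma measurable_D [measurable]:
  assumes "n > 0" "k + p \<le> n"
  shows "D p n k \<in> borel_measurable M"
proof -
  interpret G: gaussian_family M "{..n}" "\<lambda>k. X (real k / real n)" using assms(1) by (rule gaussian_family_grid)
  show ?thesis using G.measurable_lf[of "incr_coeff p k"] assms by (simp add: lf_incr_coeff)
qed

lemma grid_var_eq:
  assumes "n > 0" "k + j \<le> n"
  shows "grid_var M X n k j = expectation (\<lambda>\<omega>. X (real (k + j) / real n) \<omega> * X (real (k + j) / real n) \<omega>)
     - 2 * expectation (\<lambda>\<omega>. X (real k / real n) \<omega> * X (real (k + j) / real n) \<omega>)
     + expectation (\<lambda>\<omega>. X (real k / real n) \<omega> * X (real k / real n) \<omega>)"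
proof -
  let ?y = "X (real (k + j) / real n)"
  let ?x = "X (real k / real n)"
  note [simp] = integrable_X_mult[OF assms(1) assms(2) assms(2)] integrable_X_mult[OF assms(1) _ assms(2), of k] integrable_X_mult[OF assms(1), of k k]
  have k: "k \<le> n" using assms(2) by simp
  have "grid_var M X n k j = expectation (\<lambda>\<omega>. ?y \<omega> * ?y \<omega>
     - 2 * (?x \<omega> * ?y \<omega>) + ?x \<omega> * ?x \<omega>)"
    unfolding grid_var_def by (rule Bochner_Integration.integral_cong[OF refl]) (simp only: power2_eq_square, algebra)
  also have "\<dots> = expectation (\<lambda>\<omega>. ?y \<omega> * ?y \<omega>)
     - 2 * expectation (\<lambda>\<omega>. ?x \<omega> * ?y \<omega>)
     + expectation (\<lambda>\<omega>. ?x \<omega> * ?x \<omega>)"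
    using k by (simp del: of_nat_add)
  finally show ?thesis .
qed

text \<open>For a linear form with zero coefficient sum, the variance is a combination of the
  variances of differences: \<open>(\<Sum>a\<^sub>i x\<^sub>i)\<^sup>2 = - (\<Sum>\<^bsub>i<j\<^esub> a\<^sub>i a\<^sub>j (x\<^sub>i - x\<^sub>j)\<^sup>2)\<close>.\<close>

lemma variances_first_order:
  assumes n: "k + 2 \<le> n"
  defines "V i j \<equiv> grid_var M X n (k + i) j"
  shows "expectation (\<lambda>\<omega>. (D 1 n k \<omega> + D 1 n (k + 1) \<omega>)\<^sup>2) = V 0 2" (is "?S = _")
    and "expectation (\<lambda>\<omega>. (D 1 n k \<omega> - D 1 n (k + 1) \<omega>)\<^sup>2) = 2 * V 0 1 + 2 * V 1 1 - V 0 2" (is "?T = _")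
    and "expectation (\<lambda>\<omega>. (D 1 n k \<omega> + D 1 n (k + 1) \<omega>) * (D 1 n k \<omega> - D 1 n (k + 1) \<omega>)) = V 0 1 - V 1 1" (is "?ST = _")
proof -
  have n0: "n > 0" using n by simp
  define x where "x i = X (real (k + i) / real n)" for i
  define e where "e i j = expectation (\<lambda>\<omega>. x i \<omega> * x j \<omega>)" for i j
  have int: "i \<le> 2 \<Longrightarrow> j \<le> 2 \<Longrightarrow> integrable M (\<lambda>\<omega>. x i \<omega> * x j \<omega>)" for i j
    unfolding x_def using n n0 by (intro integrable_X_mult) auto
  have V: "V i j = e (i + j) (i + j) - 2 * e i (i + j) + e i i" if "i + j \<le> 2" for i j
    unfolding V_def e_def x_def by (subst grid_var_eq) (use n n0 that in \<open>auto simp: add.assoc\<close>)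
  have D: "D 1 n k \<omega> = x 1 \<omega> - x 0 \<omega>" "D 1 n (k + 1) \<omega> = x 2 \<omega> - x 1 \<omega>" for \<omega>
    by (simp_all add: incr_def x_def numeral_2_eq_2 add_ac)
  let ?x = "\<lambda>i j \<omega>. x i \<omega> * x j \<omega>"
  have "?S
     = expectation (\<lambda>\<omega>. ?x 2 2 \<omega> - 2 * (?x 0 2 \<omega>) + ?x 0 0 \<omega>)"
    unfolding D by (rule Bochner_Integration.integral_cong[OF refl]) (simp only: power2_eq_square, algebra)
  also have "\<dots> = V 0 2" by (simp add: int V e_def numeral_2_eq_2)
  finally show "?S = V 0 2" .
  have "?T
     = expectation (\<lambda>\<omega>. 4 * (?x 1 1 \<omega>) + ?x 0 0 \<omega> + ?x 2 2 \<omega>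
        - 4 * (?x 0 1 \<omega>) - 4 * (?x 1 2 \<omega>) + 2 * (?x 0 2 \<omega>))"
    unfolding D by (rule Bochner_Integration.integral_cong[OF refl]) (simp only: power2_eq_square, algebra)
  also have "\<dots> = 2 * V 0 1 + 2 * V 1 1 - V 0 2" by (simp add: int V e_def[symmetric] numeral_2_eq_2 numeral_3_eq_3)
  finally show "?T = 2 * V 0 1 + 2 * V 1 1 - V 0 2" .
  have "?ST
     = expectation (\<lambda>\<omega>. ?x 0 0 \<omega> - ?x 2 2 \<omega> - 2 * (?x 0 1 \<omega>) + 2 * (?x 1 2 \<omega>))"
    unfolding D by (rule Bochner_Integration.integral_cong[OF refl]) algebra
  also have "\<dots> = V 0 1 - V 1 1" by (simp add: int V e_def[symmetric] numeral_2_eq_2 numeral_3_eq_3)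
  finally show "?ST = V 0 1 - V 1 1" .
qed

text \<open>Sum and difference have the coefficients \<open>(1, -1, -1, 1)\<close> and
  \<open>(1, -3, 3, -1)\<close> at the four grid points. The first is symmetric and the second
  antisymmetric under reversal, so the mixed moment cancels as soon as \<open>V i j\<close> depends
  on \<open>j\<close> only.\<close>

lemma variances_second_order:
  assumes n: "k + 3 \<le> n"
  defines "V i j \<equiv> grid_var M X n (k + i) j"
  shows "expectation (\<lambda>\<omega>. (D 2 n k \<omega> + D 2 n (k + 1) \<omega>)\<^sup>2) = V 0 1 + V 0 2 - V 0 3 - V 1 1 + V 1 2 + V 2 1" (is "?S = _")
    and "expectation (\<lambda>\<omega>. (D 2 n k \<omega> - D 2 n (k + 1) \<omega>)\<^sup>2)
      = 3 * V 0 1 - 3 * V 0 2 + V 0 3 + 9 * V 1 1 - 3 * V 1 2 + 3 * V 2 1" (is "?T = _")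
    and "expectation (\<lambda>\<omega>. (D 2 n k \<omega> + D 2 n (k + 1) \<omega>) * (D 2 n k \<omega> - D 2 n (k + 1) \<omega>))
      = 2 * V 0 1 - V 0 2 - 2 * V 2 1 + V 1 2" (is "?ST = _")
proof -
  have n0: "n > 0" using n by simp
  define x where "x i = X (real (k + i) / real n)" for i
  define e where "e i j = expectation (\<lambda>\<omega>. x i \<omega> * x j \<omega>)" for i j
  have int: "i \<le> 3 \<Longrightarrow> j \<le> 3 \<Longrightarrow> integrable M (\<lambda>\<omega>. x i \<omega> * x j \<omega>)" for i j
    unfolding x_def using n n0 by (intro integrable_X_mult) auto
  have V: "V i j = e (i + j) (i + j) - 2 * e i (i + j) + e i i" if "i + j \<le> 3" for i j
    unfolding V_def e_def x_def by (subst grid_var_eq) (use n n0 that in \<open>auto simp: add.assoc\<close>)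
  have D: "D 2 n k \<omega> = x 0 \<omega> - 2 * x 1 \<omega> + x 2 \<omega>" "D 2 n (k + 1) \<omega> = x 1 \<omega> - 2 * x 2 \<omega> + x 3 \<omega>" for \<omega>
    by (simp_all add: incr_def x_def numeral_2_eq_2 numeral_3_eq_3 add_ac)
  let ?x = "\<lambda>i j \<omega>. x i \<omega> * x j \<omega>"
  have "?S
     = expectation (\<lambda>\<omega>. ?x 0 0 \<omega> + ?x 1 1 \<omega> + ?x 2 2 \<omega> + ?x 3 3 \<omega>
        - 2 * (?x 0 1 \<omega>) - 2 * (?x 0 2 \<omega>) + 2 * (?x 0 3 \<omega>)
        + 2 * (?x 1 2 \<omega>) - 2 * (?x 1 3 \<omega>) - 2 * (?x 2 3 \<omega>))"
    unfolding D by (rule Bochner_Integration.integral_cong[OF refl]) (simp only: power2_eq_square, algebra)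
  also have "\<dots> = V 0 1 + V 0 2 - V 0 3 - V 1 1 + V 1 2 + V 2 1" by (simp add: int V e_def[symmetric] numeral_2_eq_2 numeral_3_eq_3)
  finally show "?S = V 0 1 + V 0 2 - V 0 3 - V 1 1 + V 1 2 + V 2 1" .
  have "?T
     = expectation (\<lambda>\<omega>. ?x 0 0 \<omega> + 9 * (?x 1 1 \<omega>) + 9 * (?x 2 2 \<omega>) + ?x 3 3 \<omega>
        - 6 * (?x 0 1 \<omega>) + 6 * (?x 0 2 \<omega>) - 2 * (?x 0 3 \<omega>)
        - 18 * (?x 1 2 \<omega>) + 6 * (?x 1 3 \<omega>) - 6 * (?x 2 3 \<omega>))"
    unfolding D by (rule Bochner_Integration.integral_cong[OF refl]) (simp only: power2_eq_square, algebra)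
  also have "\<dots> = 3 * V 0 1 - 3 * V 0 2 + V 0 3 + 9 * V 1 1 - 3 * V 1 2 + 3 * V 2 1" by (simp add: int V e_def[symmetric] numeral_2_eq_2 numeral_3_eq_3)
  finally show "?T
      = 3 * V 0 1 - 3 * V 0 2 + V 0 3 + 9 * V 1 1 - 3 * V 1 2 + 3 * V 2 1" .
  have "?ST
     = expectation (\<lambda>\<omega>. ?x 0 0 \<omega> + 3 * (?x 1 1 \<omega>) - 3 * (?x 2 2 \<omega>) - ?x 3 3 \<omega>
        - 4 * (?x 0 1 \<omega>) + 2 * (?x 0 2 \<omega>) - 2 * (?x 1 3 \<omega>) + 4 * (?x 2 3 \<omega>))"
    unfolding D by (rule Bochner_Integration.integral_cong[OF refl]) algebra
  also have "\<dots> = 2 * V 0 1 - V 0 2 - 2 * V 2 1 + V 1 2" by (simp add: int V e_def[symmetric] numeral_2_eq_2 numeral_3_eq_3)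
  finally show "?ST
      = 2 * V 0 1 - V 0 2 - 2 * V 2 1 + V 1 2" .
qed

end

text \<open>Limits of the variances of sum and difference of two adjacent increments, in units of the
  local scale \<open>\<tau>\<^sup>2 = c(t) n\<^bsup>-2H(t)\<^esup>\<close>; their normalised difference is \<open>\<rho>\<^sub>p(H)\<close>.\<close>

definition sum_var :: "nat \<Rightarrow> real \<Rightarrow> real" where
  "sum_var p h = (if p = 1 then 2 powr (2 * h) else 1 + 2 * 2 powr (2 * h) - 3 powr (2 * h))"

definition diff_var :: "nat \<Rightarrow> real \<Rightarrow> real" where
  "diff_var p h = (if p = 1 then 4 - 2 powr (2 * h) else 15 - 6 * 2 powr (2 * h) + 3 powr (2 * h))"

context gauss_process begin

definition nsum :: "nat \<Rightarrow> (nat \<Rightarrow> nat \<Rightarrow> real) \<Rightarrow> nat \<Rightarrow> nat \<Rightarrow> 'a \<Rightarrow> real" where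
  "nsum p \<tau> n k \<omega> = (D p n k \<omega> + D p n (k + 1) \<omega>) / \<tau> n k"

definition ndiff :: "nat \<Rightarrow> (nat \<Rightarrow> nat \<Rightarrow> real) \<Rightarrow> nat \<Rightarrow> nat \<Rightarrow> 'a \<Rightarrow> real" where
  "ndiff p \<tau> n k \<omega> = (D p n k \<omega> - D p n (k + 1) \<omega>) / \<tau> n k"

text \<open>For a centred Gaussian pair these three moments determine the law, so this expresses
  closeness to an independent pair with the limiting variances.\<close>

definition close_variances :: "nat \<Rightarrow> (nat \<Rightarrow> nat \<Rightarrow> real) \<Rightarrow> (real \<Rightarrow> real) \<Rightarrow> real \<Rightarrow> nat \<Rightarrow> nat \<Rightarrow> bool" where
  "close_variances p \<tau> H e n k \<longleftrightarrow>
     \<bar>expectation (\<lambda>\<omega>. (nsum p \<tau> n k \<omega>)\<^sup>2) - sum_var p (H (midpt n k))\<bar> \<le> e \<and>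
     \<bar>expectation (\<lambda>\<omega>. (ndiff p \<tau> n k \<omega>)\<^sup>2) - diff_var p (H (midpt n k))\<bar> \<le> e \<and>
     \<bar>expectation (\<lambda>\<omega>. nsum p \<tau> n k \<omega> * ndiff p \<tau> n k \<omega>)\<bar> \<le> e"

lemma assumption_A1_variances:
  assumes A1: "assumption_A1 M X H" and p: "p \<in> {1, 2}"
  obtains \<tau> :: "nat \<Rightarrow> nat \<Rightarrow> real" where
    "\<And>n k. k < n \<Longrightarrow> \<tau> n k > 0"
    "\<And>e. e > 0 \<Longrightarrow> \<forall>\<^sub>F n in sequentially. \<forall>k<n - p. close_variances p \<tau> H e n k"
proof -
  from assumption_A1_grid_var[OF A1] obtain \<tau> where tpos: "\<And>n k. k < n \<Longrightarrow> \<tau> n k > 0"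
    and V: "\<And>j m e. j \<ge> 1 \<Longrightarrow> e > 0 \<Longrightarrow> \<forall>\<^sub>F n in sequentially. \<forall>k. k + m + j \<le> n \<longrightarrow>
       \<bar>grid_var M X n (k + m) j / (\<tau> n k)\<^sup>2 - real j powr (2 * H (midpt n k))\<bar> \<le> e"
    by blast
  have norm_eq: "(nsum p \<tau> n k \<omega>)\<^sup>2 = (D p n k \<omega> + D p n (k + 1) \<omega>)\<^sup>2 / (\<tau> n k)\<^sup>2"
    "(ndiff p \<tau> n k \<omega>)\<^sup>2 = (D p n k \<omega> - D p n (k + 1) \<omega>)\<^sup>2 / (\<tau> n k)\<^sup>2"
    "nsum p \<tau> n k \<omega> * ndiff p \<tau> n k \<omega> = (D p n k \<omega> + D p n (k + 1) \<omega>) * (D p n k \<omega> - D p n (k + 1) \<omega>) / (\<tau> n k)\<^sup>2" for n k \<omega>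
    unfolding nsum_def ndiff_def by (simp_all add: power_divide power2_eq_square)
  note close = close_variances_def norm_eq integral_divide_zero
  show ?thesis
  proof (rule that[OF tpos])
    fix e :: real assume "e > 0"
    \<comment> \<open>The absolute coefficients in each of the variance formulas sum to at most
      \<open>3 + 3 + 1 + 9 + 3 + 3 = 22\<close>.\<close>
    then have e: "e / 24 > 0" by simp
    have le: "(1::nat) \<le> 2" "(1::nat) \<le> 3" by simp_all
    from V[OF order_refl e, of 0] V[OF order_refl e, of 1] V[OF order_refl e, of 2]
      V[OF le(1) e, of 0] V[OF le(1) e, of 1] V[OF le(2) e, of 0]
    show "\<forall>\<^sub>F n in sequentially. \<forall>k<n - p. close_variances p \<tau> H e n k"
    proof eventually_elim
      case (elim n)
      show ?case
      proof (intro allI impI)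
        fix k assume kn: "k < n - p"
        define W where "W i j = grid_var M X n (k + i) j / (\<tau> n k)\<^sup>2" for i j
        note d = W_def add_divide_distrib diff_divide_distrib times_divide_eq_right
        let ?h = "2 * H (midpt n k)"
        have w1: "\<bar>W 0 1 - 1\<bar> \<le> e / 24" "\<bar>W 1 1 - 1\<bar> \<le> e / 24" "\<bar>W 0 2 - 2 powr ?h\<bar> \<le> e / 24"
          if "k + 2 \<le> n"
          using elim(1,2,4)[rule_format, of k] that by (simp_all add: W_def)
        have w2: "\<bar>W 2 1 - 1\<bar> \<le> e / 24" "\<bar>W 1 2 - 2 powr ?h\<bar> \<le> e / 24" "\<bar>W 0 3 - 3 powr ?h\<bar> \<le> e / 24"
          if "k + 3 \<le> n"
          using elim(3,5,6)[rule_format, of k] that by (simp_all add: W_def)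
        show "close_variances p \<tau> H e n k"
        proof (cases "p = 1")
          case True
          then have k: "k + 2 \<le> n" using kn by simp
          have v: "sum_var 1 (H (midpt n k)) = 2 powr ?h" "diff_var 1 (H (midpt n k)) = 4 - 2 powr ?h"
            by (simp_all add: sum_var_def diff_var_def)
          show ?thesis
            unfolding close unfolding True variances_first_order[OF k] v
            using w1[OF k] \<open>e > 0\<close> unfolding abs_le_iff d by (intro conjI; linarith)
        next
          case False
          then have p2: "p = 2" using p by auto
          then have k: "k + 3 \<le> n" "k + 2 \<le> n" using kn by simp_all
          have v: "sum_var 2 (H (midpt n k)) = 1 + 2 * 2 powr ?h - 3 powr ?h"
            "diff_var 2 (H (midpt n k)) = 15 - 6 * 2 powr ?h + 3 powr ?h"
            by (simp_all add: sum_var_def diff_var_def)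
          show ?thesis
            unfolding close unfolding p2 variances_second_order[OF k(1)] v
            using w1[OF k(2)] w2[OF k(1)] \<open>e > 0\<close> unfolding abs_le_iff d by (intro conjI; linarith)
        qed
      qed
    qed
  qed
qed

text \<open>Adding 1 to the distance lets the diagonal \<open>k = j\<close> obey the same bound, so
  that one estimate covers all pairs.\<close>

definition correlation_bound :: "nat \<Rightarrow> real \<Rightarrow> real \<Rightarrow> real \<Rightarrow> bool" where
  "correlation_bound p C \<gamma> \<theta> \<longleftrightarrow> C \<ge> 1 \<and> 1/2 < \<gamma> \<and> \<gamma> < 1 \<and> 0 \<le> \<theta> \<and> \<theta> < \<gamma> / 2 \<and>
    (\<forall>n k j. n > p \<longrightarrow> 1 \<le> k \<longrightarrow> 1 \<le> j \<longrightarrow> k \<le> n - p \<longrightarrow> j \<le> n - p \<longrightarrow>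
      \<bar>expectation (\<lambda>\<omega>. D p n k \<omega> * D p n j \<omega>)\<bar>
       \<le> C * real n powr \<theta> * (\<bar>real k - real j\<bar> + 1) powr (- \<gamma>) * (sd p n k * sd p n j))"

text \<open>A correlation is at most \<open>min 1 x \<le> x\<^sup>a\<close>, where \<open>x\<close> is the bound of (A.2) and \<open>0 < a \<le> 1\<close>; this
  replaces \<open>(\<gamma>, \<theta>)\<close> by \<open>(a \<gamma>, a \<theta>)\<close>.\<close>

lemma assumption_A2_correlation:
  assumes A2: "assumption_A2 p M X"
  obtains C \<gamma> \<theta> where "correlation_bound p C \<gamma> \<theta>"
proof -
  from A2 obtain d \<gamma> \<theta> where d: "d > 0" and g: "\<gamma> > 1/2" and th: "0 \<le> \<theta>" "\<theta> < \<gamma> / 2"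
    and A: "\<And>n k j. n > p \<Longrightarrow> 1 \<le> k \<Longrightarrow> k < j \<Longrightarrow> j \<le> n - p \<Longrightarrow>
           \<bar>expectation (\<lambda>\<omega>. D p n k \<omega> * D p n j \<omega>)\<bar>
             \<le> d * sd p n k * sd p n j * real n powr \<theta> * \<bar>real j - real k\<bar> powr (- \<gamma>)"
    unfolding assumption_A2_def by blast
  \<comment> \<open>In the second case \<open>a * \<gamma> = 3/4\<close>; any value strictly between
    1/2 and 1 would do.\<close>
  define a where "a = (if \<gamma> < 1 then 1 else 3 / (4 * \<gamma>))"
  have a: "0 < a" "a \<le> 1" "1/2 < a * \<gamma>" "a * \<gamma> < 1" using g by (auto simp: a_def divide_simps)
  \<comment> \<open>The factor 2 pays for replacing the distance \<open>m \<ge> 1\<close> by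
    \<open>m + 1 \<le> 2 m\<close>.\<close>
  define C where "C = 2 * (max 1 d) powr a"
  have C: "C \<ge> 2" using a by (simp add: C_def ge_one_powr_ge_zero)
  show ?thesis
  proof (rule that, unfold correlation_bound_def, intro conjI allI impI)
    show "C \<ge> 1" using C by simp
    show "1/2 < a * \<gamma>" "a * \<gamma> < 1" by (fact a)+
    show "0 \<le> a * \<theta>" using a th by simp
    show "a * \<theta> < a * \<gamma> / 2" using a th by simp
  next
    fix n k j :: nat
    assume n: "n > p" and kj: "1 \<le> k" "1 \<le> j" "k \<le> n - p" "j \<le> n - p"
    let ?E = "\<bar>expectation (\<lambda>\<omega>. D p n k \<omega> * D p n j \<omega>)\<bar>"
    let ?s = "sd p n k * sd p n j"
    have s0: "?s \<ge> 0" by (simp add: incr_sd_def)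
    have CS: "?E \<le> ?s"
      unfolding incr_sd_def
      by (rule cauchy_schwarz_expectation)
         (use kj n in \<open>auto simp: power2_eq_square intro!: integrable_D_mult\<close>)
    have n1: "real n powr (a * \<theta>) \<ge> 1" using n a th by (intro ge_one_powr_ge_zero) auto
    show "?E \<le> C * real n powr (a * \<theta>) * (\<bar>real k - real j\<bar> + 1) powr (- (a * \<gamma>)) * ?s"
    proof (cases "k = j")
      case True
      have "1 * 1 \<le> C * real n powr (a * \<theta>)" using C n1 by (intro mult_mono) auto
      then have "1 * ?s \<le> C * real n powr (a * \<theta>) * ?s" using s0 by (intro mult_right_mono) auto
      then show ?thesis using CS True by simp
    next
      case False
      define m where "m = \<bar>real k - real j\<bar>"
      have m: "m \<ge> 1" using False unfolding m_def by linarith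
      define x where "x = d * real n powr \<theta> * m powr (- \<gamma>)"
      have x0: "x \<ge> 0" using d by (simp add: x_def)
      have "?E \<le> x * ?s"
      proof (cases "k < j")
        case True
        then show ?thesis using A[OF n kj(1) True kj(4)] by (simp add: x_def m_def mult_ac abs_minus_commute)
      next
        case f: False
        then have "j < k" using False by simp
        then show ?thesis using A[OF n kj(2) _ kj(3)] by (simp add: x_def m_def mult_ac)
      qed
      then have "?E \<le> min 1 x * ?s" using CS by (simp add: min_def)
      also have "\<dots> \<le> x powr a * ?s"
        using min_one_le_powr[OF x0 a(1,2)] s0 by (rule mult_right_mono)
      also have "x powr a = d powr a * real n powr (a * \<theta>) * m powr (- (a * \<gamma>))"
        using d m by (simp add: x_def powr_mult powr_powr mult.commute)
      also have "\<dots> \<le> (max 1 d) powr a * real n powr (a * \<theta>) * (2 * (m + 1) powr (- (a * \<gamma>)))"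
      proof (intro mult_mono powr_mono2)
        have "m powr (- (a * \<gamma>)) = 2 powr (a * \<gamma>) * (2 * m) powr (- (a * \<gamma>))"
          using m by (simp add: powr_mult flip: powr_add)
        also have "\<dots> \<le> 2 powr 1 * (m + 1) powr (- (a * \<gamma>))"
          using m a by (intro mult_mono powr_mono powr_mono2') auto
        finally show "m powr (- (a * \<gamma>)) \<le> 2 * (m + 1) powr (- (a * \<gamma>))" by simp
        qed (use d a th in auto)
      also have "\<dots> = C * real n powr (a * \<theta>) * (\<bar>real k - real j\<bar> + 1) powr (- (a * \<gamma>))"
        by (simp add: C_def m_def)
      finally show ?thesis using s0 by (simp add: mult_right_mono)
    qed
  qed
qed

end

section \<open>Positivity and continuity of the limiting variances\<close>

lemma powr_two_mult: "0 < (a::real) \<Longrightarrow> a powr (2 * h) = (a\<^sup>2) powr h"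
  by (simp add: powr_powr[symmetric])

text \<open>For \<open>p = 2\<close>, the inequality \<open>(4/9)^h > 4/9\<close> gives
  \<open>2 * 4^h > 8/9 * 9^h\<close>, and what remains, \<open>1 - 9^h / 9\<close>, is positive
  because \<open>h < 1\<close>.\<close>

lemma sum_var_pos:
  assumes p: "p \<in> {1, 2}" and h: "0 < h" "h < 1"
  shows "sum_var p h > 0"
proof (cases "p = 1")
  case False
  then have "p = 2" using p by auto
  have y: "(9::real) powr h > 0" by simp
  have 1: "(1/9::real) powr 1 < (1/9) powr h" using h by (intro powr_less_mono') auto
  have 2: "(4/9::real) powr 1 < (4/9) powr h" using h by (intro powr_less_mono') auto
  from 1 have "9 powr h < (9::real)" by (simp add: powr_divide field_simps)
  moreover from 2 have "4 * 9 powr h < 9 * (4::real) powr h" by (simp add: powr_divide field_simps)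
  ultimately show ?thesis using \<open>p = 2\<close> by (simp add: sum_var_def powr_two_mult)
qed (simp add: sum_var_def)

text \<open>For \<open>p = 2\<close> the function vanishes at \<open>h = 1\<close> and decreases up
  to there: its derivative is negative because \<open>9^x \<le> 9/4 * 4^x\<close> and
  \<open>ln 9 < 2 ln 4\<close>.\<close>

lemma diff_var_pos:
  assumes p: "p \<in> {1, 2}" and h: "0 < h" "h < 1"
  shows "diff_var p h > 0"
proof (cases "p = 1")
  case True
  have "(2::real) powr (2 * h) < 2 powr 2" using h by (intro powr_less_mono) auto
  then show ?thesis using True by (simp add: diff_var_def)
next
  case False
  then have p2: "p = 2" using p by auto
  let ?f = "\<lambda>h::real. 15 - 6 * 4 powr h + 9 powr h"
  have "?f 1 < ?f h"
  proof (rule DERIV_neg_imp_decreasing[OF h(2)])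
    fix x :: real assume x: "h \<le> x" "x \<le> 1"
    let ?d = "- 6 * (4 powr x * ln 4) + 9 powr x * ln 9"
    have "(?f has_real_derivative ?d) (at x)"
      by (auto intro!: derivative_eq_intros)
    moreover have "?d < 0"
    proof -
      have "(9/4::real) powr x \<le> (9/4) powr 1" using x by (intro powr_mono) auto
      then have a: "9 powr x \<le> 9 / 4 * (4::real) powr x" by (simp add: powr_divide field_simps)
      have "ln (9::real) < ln (4 ^ 2)" by (subst ln_less_cancel_iff) auto
      then have b: "ln (9::real) < 2 * ln 4" by (subst (asm) ln_realpow) auto
      have "9 powr x * ln 9 \<le> 9 / 4 * (4::real) powr x * ln 9" using a by (intro mult_right_mono) auto
      also have "\<dots> \<le> 9 / 4 * (4::real) powr x * (2 * ln 4)" using b by (intro mult_left_mono) auto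
      also have "\<dots> < 6 * (4 powr x * ln 4)" by simp
      finally show ?thesis by simp
    qed
    ultimately show "\<exists>y. (?f has_real_derivative y) (at x) \<and> y < 0" by blast
  qed
  then show ?thesis using p2 by (simp add: diff_var_def powr_two_mult)
qed

lemma continuous_on_sum_var [continuous_intros]:
  "continuous_on S f \<Longrightarrow> continuous_on S (\<lambda>x. sum_var p (f x))"
  unfolding sum_var_def by (cases "p = 1") (auto intro!: continuous_intros)

lemma continuous_on_diff_var [continuous_intros]:
  "continuous_on S f \<Longrightarrow> continuous_on S (\<lambda>x. diff_var p (f x))"
  unfolding diff_var_def by (cases "p = 1") (auto intro!: continuous_intros)

lemma Lambda_fun_eq:
  assumes p: "p \<in> {1, 2}" and h: "0 < h" "h < 1"
  shows "Lambda_fun p h = lambda_fun ((sum_var p h - diff_var p h) / (sum_var p h + diff_var p h))"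
proof (cases "p = 1")
  case True
  have "rho1 h = 2 powr (2 * h) / 2 - 1" by (simp add: rho1_def powr_diff)
  then show ?thesis using True
    by (simp add: Lambda_fun_def sum_var_def diff_var_def diff_divide_distrib)
next
  case False
  then have p2: "p = 2" using p by auto
  let ?x = "(2::real) powr (2 * h)" and ?y = "(3::real) powr (2 * h)"
  have e: "2 powr (2 * h + 2) = 4 * ?x" "2 powr (2 * h + 1) = 2 * ?x" by (simp_all add: powr_add)
  have "?x < 2 powr 2" using h by (intro powr_less_mono) auto
  then have x: "?x < 4" by simp
  have "rho2 h = (2 * (- ?y + 4 * ?x - 7)) / (2 * (8 - 2 * ?x))"
    unfolding rho2_def e by (subst mult_divide_mult_cancel_left) auto
  also have "\<dots> = (sum_var p h - diff_var p h) / (sum_var p h + diff_var p h)"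
    using p2 by (simp add: sum_var_def diff_var_def)
  finally show ?thesis using p2 by (simp add: Lambda_fun_def)
qed

section \<open>Almost sure convergence and the eighth moment of averages of cosines\<close>

lemma (in prob_space) AE_tendsto_0_of_summable_eighth_moment:
  fixes F :: "nat \<Rightarrow> 'a \<Rightarrow> real"
  assumes F [measurable]: "\<And>n. n \<ge> N \<Longrightarrow> F n \<in> borel_measurable M"
    and int: "\<And>n. n \<ge> N \<Longrightarrow> integrable M (\<lambda>\<omega>. F n \<omega> ^ 8)"
    and bd: "\<And>n. n \<ge> N \<Longrightarrow> expectation (\<lambda>\<omega>. F n \<omega> ^ 8) \<le> a n"
    and a: "summable a"
  shows "AE \<omega> in M. (\<lambda>n. F n \<omega>) \<longlonglongrightarrow> 0"
proof -
  have a': "summable (\<lambda>n. a (n + N))" using a by (simp add: summable_iff_shift)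
  have nn: "0 \<le> F n \<omega> ^ 8" for n \<omega> by (rule zero_le_even_power) simp
  have [measurable]: "F (n + N) \<in> borel_measurable M" for n by simp
  \<comment> \<open>Borel-Cantelli in integrated form: the series of eighth powers has finite
    expectation, so it converges almost surely and its terms tend to 0.\<close>
  have "(\<integral>\<^sup>+\<omega>. (\<Sum>n. ennreal (F (n + N) \<omega> ^ 8)) \<partial>M) = (\<Sum>n. \<integral>\<^sup>+\<omega>. ennreal (F (n + N) \<omega> ^ 8) \<partial>M)"
    by (rule nn_integral_suminf) simp
  also have "\<dots> = (\<Sum>n. ennreal (expectation (\<lambda>\<omega>. F (n + N) \<omega> ^ 8)))"
    by (intro suminf_cong nn_integral_eq_integral int) (auto simp: nn)
  also have "\<dots> \<le> (\<Sum>n. ennreal (a (n + N)))"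
    by (intro suminf_le ennreal_leI bd) auto
  also have "\<dots> < \<infinity>"
  proof -
    have "0 \<le> a (n + N)" for n
      by (rule order_trans[OF _ bd[of "n + N"]]) (auto intro!: Bochner_Integration.integral_nonneg simp: nn)
    then show ?thesis using a' by (simp add: suminf_ennreal2)
  qed
  finally have "AE \<omega> in M. (\<Sum>n. ennreal (F (n + N) \<omega> ^ 8)) \<noteq> \<infinity>"
    by (intro nn_integral_noteq_infinite) auto
  then show ?thesis
  proof eventually_elim
    case (elim \<omega>)
    then have "summable (\<lambda>n. F (n + N) \<omega> ^ 8)"
      by (intro summable_suminf_not_top) (auto simp: nn)
    then have "(\<lambda>n. F (n + N) \<omega> ^ 8) \<longlonglongrightarrow> 0" by (rule summable_LIMSEQ_zero)
    then have "(\<lambda>n. \<bar>F (n + N) \<omega> ^ 8\<bar>) \<longlonglongrightarrow> 0" by (rule tendsto_rabs_zero)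
    then have "(\<lambda>n. root 8 (\<bar>F (n + N) \<omega>\<bar> ^ 8)) \<longlonglongrightarrow> root 8 0"
      by (intro tendsto_real_root) (simp add: power_abs)
    moreover have "root 8 (\<bar>x\<bar> ^ 8) = \<bar>x\<bar>" for x :: real by (rule real_root_power_cancel) auto
    ultimately have "(\<lambda>n. \<bar>F (n + N) \<omega>\<bar>) \<longlonglongrightarrow> 0" by (simp only: real_root_zero)
    then have "(\<lambda>n. F (n + N) \<omega>) \<longlonglongrightarrow> 0" by (rule tendsto_rabs_zero_cancel)
    then show ?case by (rule LIMSEQ_offset)
  qed
qed

abbreviation normal2 :: "(real \<times> real) measure" where
  "normal2 \<equiv> std_normal \<Otimes>\<^sub>M std_normal"

interpretation normal2: pair_prob_space std_normal std_normal ..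

text \<open>Even monomials in \<open>e\<^bsup>-x\<^sup>2\<^esup>\<close> and \<open>e\<^bsup>-y\<^sup>2\<^esup>\<close> are Gaussian mixtures of cosines of linear forms.\<close>

lemma normal2_cos:
  "(\<integral>z. cos (fst z * x + snd z * y) \<partial>normal2) = exp (- (x\<^sup>2 + y\<^sup>2) / 2)"
proof -
  have i: "integrable normal2 (\<lambda>z. cos (fst z * x + snd z * y))"
    by (rule normal2.P.integrable_const_bound[where B=1]) auto
  have ic: "integrable std_normal (\<lambda>w. cos (w * y))" "integrable std_normal (\<lambda>w. sin (w * y))" for y
    by (rule std_normal.integrable_const_bound[where B=1]; simp)+
  have "(\<integral>z. cos (fst z * x + snd z * y) \<partial>normal2) = (\<integral>z. \<integral>w. cos (z * x + w * y) \<partial>std_normal \<partial>std_normal)"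
    using normal2.integral_fst'[OF i] by simp
  also have "\<dots> = (\<integral>z. exp (- y\<^sup>2 / 2) * cos (z * x) \<partial>std_normal)"
    by (intro Bochner_Integration.integral_cong refl) (simp add: cos_add ic std_normal_cos std_normal_sin)
  also have "\<dots> = exp (- (x\<^sup>2 + y\<^sup>2) / 2)"
    by (simp add: std_normal_cos diff_divide_distrib flip: exp_add)
  finally show ?thesis .
qed

lemma integrable_std_normal_power: "integrable std_normal (\<lambda>z. z ^ m)"
  by (subst integrable_real_density) (auto intro: integrable_std_normal_moment)

lemma integrable_normal2_power:
  "integrable normal2 (\<lambda>z. fst z ^ m)" "integrable normal2 (\<lambda>z. snd z ^ m)"
proof -
  have f: "integrable (distr normal2 std_normal fst) (\<lambda>z. z ^ m)"
    by (simp add: std_normal.distr_pair_fst integrable_std_normal_power)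
  show 1: "integrable normal2 (\<lambda>z. fst z ^ m)"
    by (rule integrable_distr[OF _ f]) simp
  show "integrable normal2 (\<lambda>z. snd z ^ m)"
    using normal2.integrable_product_swap[OF 1] by (simp add: case_prod_beta')
qed

context gauss_process begin

text \<open>The coefficients are bounded only after multiplication by the standard deviations,
  because (A.2) bounds covariances relative to these. \<open>B\<close> stays explicit since it will
  depend on a Gaussian mixing variable, over which its eighth power is integrated.\<close>

lemma cos_average_eighth_moment:
  fixes C \<gamma> \<theta> B :: real
  assumes cb: "correlation_bound p C \<gamma> \<theta>"
    and n: "n > p"
    and a: "\<And>k. k \<in> {1..<n - p} \<Longrightarrow> \<bar>a k\<bar> * sd p n k \<le> B"
    and b: "\<And>k. k \<in> {1..<n - p} \<Longrightarrow> \<bar>b k\<bar> * sd p n (k + 1) \<le> B"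
    and B: "B \<ge> 0"
  defines "\<zeta> \<equiv> \<lambda>k \<omega>. a k * D p n k \<omega> + b k * D p n (k + 1) \<omega>"
  shows "expectation (\<lambda>\<omega>. (1 / real (n - p) * (\<Sum>k=1..<n - p. cos (\<zeta> k \<omega>) - expectation (\<lambda>\<omega>. cos (\<zeta> k \<omega>)))) ^ 8)
    \<le> 1330 * (16 * C * real (p + 1) / (1 - \<gamma>)) ^ 4 * (B\<^sup>2 * real n powr (\<theta> - \<gamma>)) ^ 4"
proof -
  have C: "C \<ge> 1" and g: "0 < \<gamma>" "\<gamma> < 1"
    and cor: "\<And>k j. 1 \<le> k \<Longrightarrow> 1 \<le> j \<Longrightarrow> k \<le> n - p \<Longrightarrow> j \<le> n - p \<Longrightarrow>
      \<bar>expectation (\<lambda>\<omega>. D p n k \<omega> * D p n j \<omega>)\<bar>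
       \<le> C * real n powr \<theta> * (\<bar>real k - real j\<bar> + 1) powr (- \<gamma>) * (sd p n k * sd p n j)"
    using cb n unfolding correlation_bound_def by simp_all
  have n0: "n > 0" using n by simp
  interpret G: gaussian_family M "{..n}" "\<lambda>k. X (real k / real n)" using n0 by (rule gaussian_family_grid)
  let ?K = "{1..<n - p}"
  let ?N = "real (n - p)"
  have N: "?N > 0" using n by simp
  define w where "w k l = a k * incr_coeff p k l + b k * incr_coeff p (k + 1) l" for k l
  have lfw: "G.lf (w k) = \<zeta> k" if "k \<in> ?K" for k
  proof
    fix \<omega>
    have "G.lf (w k) \<omega> = a k * G.lf (incr_coeff p k) \<omega> + b k * G.lf (incr_coeff p (k + 1)) \<omega>"
      unfolding G.lf_def w_def by (simp add: sum.distrib sum_distrib_left distrib_right mult.assoc)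
    also have "\<dots> = \<zeta> k \<omega>"
    proof -
      have "k + p \<le> n" "k + 1 + p \<le> n" using that by auto
      then show ?thesis using n0 by (simp only: lf_incr_coeff \<zeta>_def)
    qed
    finally show "G.lf (w k) \<omega> = \<zeta> k \<omega>" .
  qed
  let ?s = "sd p n"
  have s0: "?s k \<ge> 0" for k by (simp add: incr_sd_def)
  let ?e = "\<lambda>k l. expectation (\<lambda>\<omega>. D p n k \<omega> * D p n l \<omega>)"
  let ?P = "C * real n powr \<theta>"
  let ?d = "\<lambda>k l. (\<bar>real k - real l\<bar> + 1) powr (- \<gamma>)"
  have P0: "?P \<ge> 0" using C by simp
  \<comment> \<open>Passing from \<open>k\<close>, \<open>l\<close> to themselves or their
    successors changes the distance by at most 1, so distance plus 1 changes by a factor of at most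
    2, at the cost of \<open>2 powr \<gamma> \<le> 2\<close>.\<close>
  have part: "\<bar>x * y * ?e k' l'\<bar> \<le> B * B * (2 * ?P * ?d k l)"
    if "\<bar>x\<bar> * ?s k' \<le> B" "\<bar>y\<bar> * ?s l' \<le> B" "1 \<le> k'" "1 \<le> l'" "k' \<le> n - p" "l' \<le> n - p"
      "\<bar>real k - real l\<bar> \<le> \<bar>real k' - real l'\<bar> + 1" for x y k l k' l'
  proof -
    have "y powr (- \<gamma>) = 2 powr \<gamma> * (2 * y) powr (- \<gamma>)" if "y > 0" for y :: real
      using that by (simp add: powr_mult flip: powr_add)
    then have "?d k' l' = 2 powr \<gamma> * (2 * (\<bar>real k' - real l'\<bar> + 1)) powr (- \<gamma>)" by simp
    also have "\<bar>real k - real l\<bar> + 1 \<le> 2 * (\<bar>real k' - real l'\<bar> + 1)"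
      using that(7) abs_ge_zero[of "real k' - real l'"] by (smt (verit))
    then have "2 powr \<gamma> * (2 * (\<bar>real k' - real l'\<bar> + 1)) powr (- \<gamma>) \<le> 2 powr 1 * ?d k l"
      using g by (intro mult_mono powr_mono powr_mono2') auto
    finally have d2: "?d k' l' \<le> 2 * ?d k l" by simp
    have "\<bar>x * y * ?e k' l'\<bar> = \<bar>x\<bar> * \<bar>y\<bar> * \<bar>?e k' l'\<bar>" by (simp add: abs_mult)
    also have "\<dots> \<le> \<bar>x\<bar> * \<bar>y\<bar> * (?P * ?d k' l' * (?s k' * ?s l'))"
      using cor[OF that(3-6)] by (intro mult_left_mono) auto
    also have "\<dots> = (\<bar>x\<bar> * ?s k') * (\<bar>y\<bar> * ?s l') * (?P * ?d k' l')" by (simp add: mult_ac)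
    also have "\<dots> \<le> B * B * (?P * (2 * ?d k l))"
      using that(1,2) s0 B P0 C d2 by (intro mult_mono) auto
    finally show ?thesis by (simp add: mult_ac)
  qed
  have cvb: "\<bar>G.cv (w k) (w l)\<bar> \<le> 8 * B\<^sup>2 * ?P * ?d k l" if kl: "k \<in> ?K" "l \<in> ?K" for k l
  proof -
    have i: "integrable M (\<lambda>\<omega>. D p n k' \<omega> * D p n l' \<omega>)" if "k' \<in> {k, k + 1}" "l' \<in> {l, l + 1}" for k' l'
      using that kl n0 by (intro integrable_D_mult) auto
    have "G.cv (w k) (w l) = expectation (\<lambda>\<omega>. a k * a l * (D p n k \<omega> * D p n l \<omega>)
        + a k * b l * (D p n k \<omega> * D p n (l + 1) \<omega>) + b k * a l * (D p n (k + 1) \<omega> * D p n l \<omega>)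
        + b k * b l * (D p n (k + 1) \<omega> * D p n (l + 1) \<omega>))"
      unfolding G.cv_def lfw[OF kl(1)] lfw[OF kl(2)] \<zeta>_def
      by (rule Bochner_Integration.integral_cong[OF refl]) (simp add: algebra_simps)
    also have "\<dots> = a k * a l * ?e k l + a k * b l * ?e k (l + 1) + b k * a l * ?e (k + 1) l + b k * b l * ?e (k + 1) (l + 1)"
      using i by simp
    finally have "G.cv (w k) (w l) = \<dots>" .
    moreover have "\<bar>a k * a l * ?e k l\<bar> \<le> B * B * (2 * ?P * ?d k l)"
      using kl by (intro part a) auto
    moreover have "\<bar>a k * b l * ?e k (l + 1)\<bar> \<le> B * B * (2 * ?P * ?d k l)"
      using kl by (intro part a b) auto
    moreover have "\<bar>b k * a l * ?e (k + 1) l\<bar> \<le> B * B * (2 * ?P * ?d k l)"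
      using kl by (intro part a b) auto
    moreover have "\<bar>b k * b l * ?e (k + 1) (l + 1)\<bar> \<le> B * B * (2 * ?P * ?d k l)"
      using kl by (intro part b) auto
    moreover have "8 * B\<^sup>2 * ?P * ?d k l = 4 * (B * B * (2 * ?P * ?d k l))" by (simp add: power2_eq_square)
    ultimately show ?thesis by linarith
  qed
  let ?S = "16 * C * real (p + 1) / (1 - \<gamma>) * (B\<^sup>2 * real n powr (\<theta> - \<gamma>))"
  have Ssum: "(\<Sum>k\<in>?K. \<Sum>l\<in>?K. \<bar>1 / ?N * (1 / ?N) * G.cv (w k) (w l)\<bar>) \<le> ?S"
  proof -
    have "(\<Sum>k\<in>?K. \<Sum>l\<in>?K. \<bar>1 / ?N * (1 / ?N) * G.cv (w k) (w l)\<bar>)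
        \<le> (\<Sum>k\<in>?K. \<Sum>l\<in>?K. 1 / ?N * (1 / ?N) * (8 * B\<^sup>2 * ?P * ?d k l))"
    proof (intro sum_mono)
      fix k l assume "k \<in> ?K" "l \<in> ?K"
      then have "\<bar>G.cv (w k) (w l)\<bar> \<le> 8 * B\<^sup>2 * ?P * ?d k l" by (rule cvb)
      then show "\<bar>1 / ?N * (1 / ?N) * G.cv (w k) (w l)\<bar> \<le> 1 / ?N * (1 / ?N) * (8 * B\<^sup>2 * ?P * ?d k l)"
        unfolding abs_mult[of _ "G.cv (w k) (w l)"] by (intro mult_mono) auto
    qed
    also have "\<dots> = 1 / ?N * (1 / ?N) * (8 * B\<^sup>2 * ?P) * (\<Sum>k\<in>?K. \<Sum>l\<in>?K. ?d k l)"
      by (simp add: sum_distrib_left mult.assoc)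
    also have "\<dots> \<le> 1 / ?N * (1 / ?N) * (8 * B\<^sup>2 * ?P) * (\<Sum>k\<in>?K. 2 * real n powr (1 - \<gamma>) / (1 - \<gamma>))"
      using P0 by (intro mult_left_mono sum_mono sum_dist_powr_le g) auto
    also have "\<dots> \<le> 1 / ?N * (1 / ?N) * (8 * B\<^sup>2 * ?P) * (?N * (2 * real n powr (1 - \<gamma>) / (1 - \<gamma>)))"
    proof (intro mult_left_mono)
      have const: "(\<Sum>k\<in>?K. r) \<le> ?N * r" if "r \<ge> 0" for r :: real
        using that by (simp add: mult_right_mono)
      show "(\<Sum>k\<in>?K. 2 * real n powr (1 - \<gamma>) / (1 - \<gamma>)) \<le> ?N * (2 * real n powr (1 - \<gamma>) / (1 - \<gamma>))"
        by (rule const) (use g in simp)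
    qed (use P0 in auto)
    \<comment> \<open>The constant 16 is 4 covariances, times 2 for neighbouring indices, times 2
      for the two sides of \<open>k\<close>.\<close>
    also have "\<dots> = 16 * C / (1 - \<gamma>) * B\<^sup>2 * real n powr (\<theta> + (1 - \<gamma>)) * (1 / ?N)"
      using N by (simp add: powr_add mult_ac)
    also have "\<dots> \<le> 16 * C / (1 - \<gamma>) * B\<^sup>2 * real n powr (\<theta> + (1 - \<gamma>)) * (real (p + 1) / real n)"
    proof (intro mult_left_mono)
      \<comment> \<open>With \<open>n = p + r\<close> and \<open>r \<ge> 1\<close>, one has
        \<open>p + r \<le> (p + 1) r\<close>.\<close>
      have "n \<le> (p + 1) * (n - p)"
      proof -
        obtain m where m: "n = p + Suc m" using n by (metis less_imp_Suc_add add_Suc_right)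
        then show ?thesis by simp
      qed
      then have "real n \<le> real (p + 1) * ?N" by (metis of_nat_le_iff of_nat_mult)
      then show "1 / ?N \<le> real (p + 1) / real n" using N n0 by (simp add: field_simps)
    qed (use C g in auto)
    also have "real n powr (\<theta> + (1 - \<gamma>)) = real n powr (\<theta> - \<gamma>) * real n"
    proof -
      have "\<theta> + (1 - \<gamma>) = (\<theta> - \<gamma>) + 1" by simp
      then show ?thesis using n0 by (simp only: powr_add) simp
    qed
    also have "16 * C / (1 - \<gamma>) * B\<^sup>2 * (real n powr (\<theta> - \<gamma>) * real n) * (real (p + 1) / real n) = ?S"
      using n0 by simp
    finally show ?thesis .
  qed
  have "expectation (\<lambda>\<omega>. (\<Sum>k\<in>?K. 1 / ?N * (cos (G.lf (w k) \<omega>) - expectation (\<lambda>\<omega>. cos (G.lf (w k) \<omega>)))) ^ 8)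
    \<le> 1330 * ?S ^ 4"
    by (rule G.cos_sum_eighth_moment[OF _ Ssum]) simp
  also have "(\<lambda>\<omega>. (\<Sum>k\<in>?K. 1 / ?N * (cos (G.lf (w k) \<omega>) - expectation (\<lambda>\<omega>. cos (G.lf (w k) \<omega>)))) ^ 8)
    = (\<lambda>\<omega>. (1 / ?N * (\<Sum>k\<in>?K. cos (\<zeta> k \<omega>) - expectation (\<lambda>\<omega>. cos (\<zeta> k \<omega>)))) ^ 8)"
    unfolding sum_distrib_left by (intro ext arg_cong[where f="\<lambda>x. x ^ 8"] sum.cong refl) (simp add: lfw)
  finally show ?thesis by (simp only: power_mult_distrib mult.assoc)
qed

end

section \<open>Concentration of exponential monomials\<close>

lemma abs_exp_minus_diff_le:
  fixes x y :: real
  assumes "0 \<le> x" "0 \<le> y"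
  shows "\<bar>exp (- x) - exp (- y)\<bar> \<le> \<bar>x - y\<bar>"
proof -
  have *: "exp (- x) - exp (- y) \<le> y - x" if "0 \<le> x" "x \<le> y" for x y :: real
  proof -
    have "exp (- x) - exp (- y) = exp (- x) * (1 - exp (- (y - x)))"
      by (simp add: right_diff_distrib flip: exp_add)
    also have "\<dots> \<le> 1 * (1 - exp (- (y - x)))" using that by (intro mult_right_mono) auto
    also have "\<dots> \<le> y - x" using exp_ge_add_one_self[of "- (y - x)"] by (smt (verit))
    finally show ?thesis .
  qed
  show ?thesis
  proof (cases "x \<le> y")
    case True
    then have "exp (- y) \<le> exp (- x)" by simp
    then show ?thesis using *[OF assms(1) True] True by linarith
  next
    case False
    then have "exp (- x) \<le> exp (- y)" by simp
    then show ?thesis using *[OF assms(2)] False by force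
  qed
qed

lemma add_power8_le: "((x::real) + y) ^ 8 \<le> 128 * (x ^ 8 + y ^ 8)"
proof -
  have sq: "(a + b)\<^sup>2 \<le> 2 * (a\<^sup>2 + b\<^sup>2)" for a b :: real
    using sum_squares_bound[of a b] by (simp add: power2_sum)
  have "(x + y) ^ 8 = (((x + y)\<^sup>2)\<^sup>2)\<^sup>2" by simp
  also have "\<dots> \<le> ((2 * (x\<^sup>2 + y\<^sup>2))\<^sup>2)\<^sup>2" by (intro power_mono sq) auto
  also have "\<dots> = 16 * ((x\<^sup>2 + y\<^sup>2)\<^sup>2)\<^sup>2" by (simp only: power_mult_distrib) simp
  also have "\<dots> \<le> 16 * (2 * ((x\<^sup>2)\<^sup>2 + (y\<^sup>2)\<^sup>2))\<^sup>2" by (intro mult_left_mono power_mono sq) auto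
  also have "\<dots> = 64 * ((x\<^sup>2)\<^sup>2 + (y\<^sup>2)\<^sup>2)\<^sup>2" by (simp only: power_mult_distrib) simp
  also have "\<dots> \<le> 64 * (2 * (((x\<^sup>2)\<^sup>2)\<^sup>2 + ((y\<^sup>2)\<^sup>2)\<^sup>2))" by (intro mult_left_mono sq) auto
  also have "\<dots> = 128 * (x ^ 8 + y ^ 8)" by simp
  finally show ?thesis .
qed

text \<open>Jensen's inequality, as three applications of the nonnegativity of the variance.\<close>

lemma (in prob_space) expectation_power8_le:
  fixes f :: "'a \<Rightarrow> real"
  assumes [measurable]: "f \<in> borel_measurable M" and B: "\<And>x. \<bar>f x\<bar> \<le> B"
  shows "expectation f ^ 8 \<le> expectation (\<lambda>x. f x ^ 8)"
proof -
  have i: "integrable M (\<lambda>x. f x ^ m)" for m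
  proof (rule integrable_const_bound[where B="B ^ m"])
    show "AE x in M. norm (f x ^ m) \<le> B ^ m"
      using B by (intro AE_I2) (simp add: norm_power power_mono power_abs)
  qed measurable
  have sq: "(expectation (\<lambda>x. f x ^ m))\<^sup>2 \<le> expectation (\<lambda>x. f x ^ (2 * m))" for m
  proof -
    have "0 \<le> variance (\<lambda>x. f x ^ m)" by (rule variance_positive)
    also have "\<dots> = expectation (\<lambda>x. (f x ^ m)\<^sup>2) - (expectation (\<lambda>x. f x ^ m))\<^sup>2"
      using i[of m] i[of "2 * m"] by (intro variance_eq) (auto simp: power_mult[symmetric] mult.commute)
    finally show ?thesis by (simp add: power_mult[symmetric] mult.commute)
  qed
  have "expectation f ^ 8 = (((expectation f)\<^sup>2)\<^sup>2)\<^sup>2" by simp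
  also have "\<dots> \<le> ((expectation (\<lambda>x. f x ^ 2))\<^sup>2)\<^sup>2"
    using sq[of 1] by (intro power_mono) auto
  also have "\<dots> \<le> (expectation (\<lambda>x. f x ^ 4))\<^sup>2"
    using sq[of 2] by (intro power_mono) auto
  also have "\<dots> \<le> expectation (\<lambda>x. f x ^ 8)"
    using sq[of 4] by simp
  finally show ?thesis .
qed

definition gmono :: "nat \<Rightarrow> nat \<Rightarrow> real \<Rightarrow> real \<Rightarrow> real" where
  "gmono i j s d = exp (- (real i * s\<^sup>2 + real j * d\<^sup>2))"

lemma gmono_eq_cos_mixture:
  "gmono i j s d = (\<integral>z. cos (fst z * (sqrt (2 * real i) * s) + snd z * (sqrt (2 * real j) * d)) \<partial>normal2)"
  unfolding normal2_cos gmono_def by (simp add: power_mult_distrib)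

lemma gmono_bounds: "0 \<le> gmono i j s d" "gmono i j s d \<le> 1"
  by (simp_all add: gmono_def add_nonneg_nonneg del: minus_add_distrib)

context gauss_process begin

lemma measurable_nsum_ndiff [measurable]:
  assumes "k < n - p"
  shows "nsum p \<tau> n k \<in> borel_measurable M" "ndiff p \<tau> n k \<in> borel_measurable M"
proof -
  have [measurable]: "D p n k \<in> borel_measurable M" "D p n (k + 1) \<in> borel_measurable M"
    using assms by (auto intro!: measurable_D simp del: of_nat_Suc)
  show "nsum p \<tau> n k \<in> borel_measurable M" "ndiff p \<tau> n k \<in> borel_measurable M"
    unfolding nsum_def[abs_def] ndiff_def[abs_def] by measurable
qed

lemma expectation_gmono:
  assumes k: "k < n - p"
  shows "expectation (\<lambda>\<omega>. gmono i j (nsum p \<tau> n k \<omega>) (ndiff p \<tau> n k \<omega>))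
    = (\<integral>z. expectation (\<lambda>\<omega>. cos (fst z * (sqrt (2 * real i) * nsum p \<tau> n k \<omega>)
        + snd z * (sqrt (2 * real j) * ndiff p \<tau> n k \<omega>))) \<partial>normal2)"
proof -
  interpret Q: pair_prob_space normal2 M ..
  let ?c = "\<lambda>z \<omega>. cos (fst z * (sqrt (2 * real i) * nsum p \<tau> n k \<omega>) + snd z * (sqrt (2 * real j) * ndiff p \<tau> n k \<omega>))"
  have "integrable (normal2 \<Otimes>\<^sub>M M) (\<lambda>(z, \<omega>). ?c z \<omega>)"
  proof (rule Q.P.integrable_const_bound[where B=1])
    have [measurable]: "nsum p \<tau> n k \<in> borel_measurable M" "ndiff p \<tau> n k \<in> borel_measurable M"
      using k by (auto intro!: measurable_nsum_ndiff)
    show "(\<lambda>(z, \<omega>). ?c z \<omega>) \<in> borel_measurable (normal2 \<Otimes>\<^sub>M M)"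
      unfolding split_beta' by measurable
  qed (auto simp: split_beta')
  from Q.Fubini_integral[OF this] show ?thesis by (simp add: gmono_eq_cos_mixture)
qed

text \<open>The eighth moment is of order \<open>n\<^bsup>4 (\<theta> - \<gamma>)\<^esup>\<close>, which is summable because \<open>\<gamma> - \<theta> > \<gamma> / 2 > 1 / 4\<close>;
  the fourth moment would not suffice. The sums start at \<open>k = 1\<close> because (A.2) says nothing
  about the increment with index \<open>0\<close>.\<close>

lemma monomial_concentration:
  assumes cb: "correlation_bound p C \<gamma> \<theta>"
    and tpos: "\<And>n k. k < n \<Longrightarrow> \<tau> n k > 0"
    and sdt: "\<And>n k. n \<ge> N \<Longrightarrow> k < n - p \<Longrightarrow> sd p n k \<le> 5 * \<tau> n k \<and> sd p n (k + 1) \<le> 5 * \<tau> n k"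
  shows "AE \<omega> in M. (\<lambda>n. 1 / real (n - p) * (\<Sum>k=1..<n - p. gmono i j (nsum p \<tau> n k \<omega>) (ndiff p \<tau> n k \<omega>)
      - expectation (\<lambda>\<omega>. gmono i j (nsum p \<tau> n k \<omega>) (ndiff p \<tau> n k \<omega>)))) \<longlonglongrightarrow> 0"
proof -
  define u where "u = sqrt (2 * real i)"
  define v where "v = sqrt (2 * real j)"
  \<comment> \<open>The coefficient bound for the cosine with mixing variable \<open>z\<close>; the
    factor 5 is that of \<open>sdt\<close>.\<close>
  define B where "B z = 5 * (\<bar>fst z\<bar> * u + \<bar>snd z\<bar> * v)" for z :: "real \<times> real"
  have g: "\<gamma> < 1" "1/2 < \<gamma>" and th: "\<theta> < \<gamma> / 2" using cb by (simp_all add: correlation_bound_def)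
  have uv: "u \<ge> 0" "v \<ge> 0" by (simp_all add: u_def v_def)
  define K where "K = 1330 * (16 * C * real (p + 1) / (1 - \<gamma>)) ^ 4"
  \<comment> \<open>\<open>390625 = 5^8\<close>, and 128 is the constant of
    \<open>add_power8_le\<close>; the bound is a polynomial in \<open>z\<close>, hence
    integrable.\<close>
  let ?b = "\<lambda>z. 390625 * (128 * (u ^ 8 * fst z ^ 8 + v ^ 8 * snd z ^ 8))"
  have intB: "integrable normal2 (\<lambda>z. B z ^ 8)"
  proof (rule Bochner_Integration.integrable_bound)
    show "integrable normal2 (\<lambda>z. ?b z)"
      by (intro integrable_mult_right Bochner_Integration.integrable_add integrable_normal2_power)
    have "B z ^ 8 \<le> ?b z" for z
    proof -
      have "B z ^ 8 = 390625 * (\<bar>fst z\<bar> * u + \<bar>snd z\<bar> * v) ^ 8"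
        unfolding B_def by (simp only: power_mult_distrib) simp
      also have "\<dots> \<le> 390625 * (128 * ((\<bar>fst z\<bar> * u) ^ 8 + (\<bar>snd z\<bar> * v) ^ 8))"
        by (intro mult_left_mono add_power8_le) auto
      finally show ?thesis by (simp add: power_mult_distrib mult.commute)
    qed
    moreover have "0 \<le> B z ^ 8" for z by (rule zero_le_even_power) simp
    ultimately show "AE z in normal2. norm (B z ^ 8) \<le> norm (?b z)"
      by (intro AE_I2) (simp only: real_norm_def, smt (verit))
  qed (simp add: B_def)
  let ?m = "\<lambda>n k \<omega>. gmono i j (nsum p \<tau> n k \<omega>) (ndiff p \<tau> n k \<omega>)"
  let ?F = "\<lambda>n \<omega>. 1 / real (n - p) * (\<Sum>k=1..<n - p. ?m n k \<omega> - expectation (?m n k))"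
  show ?thesis
  proof (rule AE_tendsto_0_of_summable_eighth_moment[where N="max N (p + 1)"
      and a="\<lambda>n. K * (\<integral>z. B z ^ 8 \<partial>normal2) * real n powr (4 * (\<theta> - \<gamma>))"])
    have "4 * (\<theta> - \<gamma>) < -1" using g th by simp
    then have "summable (\<lambda>n. real n powr (4 * (\<theta> - \<gamma>)))" by (simp add: summable_real_powr_iff)
    then show "summable (\<lambda>n. K * (\<integral>z. B z ^ 8 \<partial>normal2) * real n powr (4 * (\<theta> - \<gamma>)))"
      by (rule summable_mult)
  next
    fix n assume "max N (p + 1) \<le> n"
    then have n: "n \<ge> N" "n > p" by auto
    have [measurable]: "nsum p \<tau> n k \<in> borel_measurable M" "ndiff p \<tau> n k \<in> borel_measurable M" if "k \<in> {1..<n - p}" for k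
      using that by (auto intro!: measurable_nsum_ndiff)
    have mm [measurable]: "?m n k \<in> borel_measurable M" if "k \<in> {1..<n - p}" for k
      using that unfolding gmono_def by measurable
    show Fm [measurable]: "?F n \<in> borel_measurable M" by measurable
    define \<zeta> where "\<zeta> k z \<omega> = fst z * (u * nsum p \<tau> n k \<omega>) + snd z * (v * ndiff p \<tau> n k \<omega>)" for k z \<omega>
    have \<zeta>m [measurable]: "(\<lambda>x. \<zeta> k (fst x) (snd x)) \<in> borel_measurable (normal2 \<Otimes>\<^sub>M M)" if "k \<in> {1..<n - p}" for k
      using that unfolding \<zeta>_def by measurable
    have \<zeta>m1 [measurable]: "\<zeta> k z \<in> borel_measurable M" if "k \<in> {1..<n - p}" for k z
      using that unfolding \<zeta>_def[abs_def] by measurable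
    have \<zeta>m2 [measurable]: "(\<lambda>z. \<zeta> k z \<omega>) \<in> borel_measurable normal2" for k \<omega>
      unfolding \<zeta>_def by measurable
    define c where "c k z = expectation (\<lambda>\<omega>. cos (\<zeta> k z \<omega>))" for k z
    interpret Q: pair_prob_space normal2 M ..
    have cm [measurable]: "c k \<in> borel_measurable normal2" if "k \<in> {1..<n - p}" for k
    proof -
      have "(\<lambda>x. cos (\<zeta> k (fst x) (snd x))) \<in> borel_measurable (normal2 \<Otimes>\<^sub>M M)" using that by measurable
      then have "(\<lambda>(z, \<omega>). cos (\<zeta> k z \<omega>)) \<in> borel_measurable (normal2 \<Otimes>\<^sub>M M)" by (simp add: split_beta')
      then show ?thesis unfolding c_def[abs_def] by (rule borel_measurable_lebesgue_integral)
    qed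
    \<comment> \<open>The bound is claimed for all \<open>k\<close>; where the cosine is not known
      to be measurable, the default value 0 of the expectation satisfies it.\<close>
    have c1: "\<bar>c k z\<bar> \<le> 1" for k z
    proof (cases "integrable M (\<lambda>\<omega>. cos (\<zeta> k z \<omega>))")
      case True
      have "\<bar>c k z\<bar> \<le> expectation (\<lambda>\<omega>. \<bar>cos (\<zeta> k z \<omega>)\<bar>)" unfolding c_def by (rule integral_abs_bound)
      also have "\<dots> \<le> expectation (\<lambda>\<omega>. 1)" using True by (intro integral_mono) auto
      finally show ?thesis by (simp add: prob_space)
    qed (simp add: c_def not_integrable_integral_eq)
    define G where "G z \<omega> = 1 / real (n - p) * (\<Sum>k=1..<n - p. cos (\<zeta> k z \<omega>) - c k z)" for z \<omega>
    have Gm [measurable]: "(\<lambda>x. G (fst x) (snd x)) \<in> borel_measurable (normal2 \<Otimes>\<^sub>M M)"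
      unfolding G_def by measurable
    have Gm1 [measurable]: "(\<lambda>z. G z \<omega>) \<in> borel_measurable normal2" for \<omega>
      unfolding G_def by measurable
    have Gm2 [measurable]: "G z \<in> borel_measurable M" for z
      unfolding G_def[abs_def] by measurable
    have Gb: "\<bar>G z \<omega>\<bar> \<le> 2" for z \<omega>
    proof -
      have "\<bar>\<Sum>k=1..<n - p. cos (\<zeta> k z \<omega>) - c k z\<bar> \<le> (\<Sum>k=1..<n - p. 2)"
      proof (rule order_trans[OF sum_abs], rule sum_mono)
        fix k
        have "\<bar>cos (\<zeta> k z \<omega>)\<bar> \<le> 1" by simp
        then show "\<bar>cos (\<zeta> k z \<omega>) - c k z\<bar> \<le> 2" using c1[of k z] by linarith
      qed
      also have "\<dots> \<le> 2 * real (n - p)" by simp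
      finally show ?thesis using n by (simp add: G_def abs_mult field_simps)
    qed
    have G8b: "\<bar>G z \<omega> ^ 8\<bar> \<le> 2 ^ 8" for z \<omega>
      using power_mono[OF Gb[of z \<omega>], of 8] by (simp add: power_abs)
    have intm: "expectation (?m n k) = (\<integral>z. c k z \<partial>normal2)" if k: "k \<in> {1..<n - p}" for k
      unfolding c_def \<zeta>_def u_def v_def by (rule expectation_gmono) (use k in simp)
    \<comment> \<open>Centring commutes with the mixture, so the centred average of monomials is the
      mean over \<open>z\<close> of centred averages of cosines.\<close>
    have F_eq: "?F n \<omega> = (\<integral>z. G z \<omega> \<partial>normal2)" for \<omega>
    proof -
      have i1: "integrable normal2 (\<lambda>z. cos (\<zeta> k z \<omega>))" for k
        by (rule normal2.P.integrable_const_bound[where B=1]) auto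
      have i2: "integrable normal2 (\<lambda>z. c k z)" if "k \<in> {1..<n - p}" for k
        using that by (intro normal2.P.integrable_const_bound[where B=1]) (auto simp: c1)
      have "(\<integral>z. G z \<omega> \<partial>normal2) = 1 / real (n - p) * (\<Sum>k=1..<n - p. (\<integral>z. cos (\<zeta> k z \<omega>) \<partial>normal2) - (\<integral>z. c k z \<partial>normal2))"
        unfolding G_def using i1 i2 by (simp add: Bochner_Integration.integral_sum)
      also have "\<dots> = ?F n \<omega>"
        by (intro arg_cong2[where f="(*)"] sum.cong refl, subst intm)
           (simp_all add: gmono_eq_cos_mixture \<zeta>_def u_def v_def)
      finally show ?thesis ..
    qed
    have Fb: "\<bar>?F n \<omega>\<bar> \<le> 2" for \<omega>
    proof -
      have "\<bar>\<integral>z. G z \<omega> \<partial>normal2\<bar> \<le> (\<integral>z. \<bar>G z \<omega>\<bar> \<partial>normal2)" by (rule integral_abs_bound)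
      also have "\<dots> \<le> (\<integral>z. 2 \<partial>normal2)"
        by (intro integral_mono normal2.P.integrable_const_bound[where B=2]) (auto simp: Gb)
      finally show ?thesis unfolding F_eq by (simp add: normal2.P.prob_space)
    qed
    show iF: "integrable M (\<lambda>\<omega>. ?F n \<omega> ^ 8)"
    proof (rule integrable_const_bound[where B="2 ^ 8"])
      show "AE \<omega> in M. norm (?F n \<omega> ^ 8) \<le> 2 ^ 8"
        using power_mono[OF Fb, where n=8] by (intro AE_I2) (simp add: power_abs norm_power)
    qed measurable
    have iG: "integrable (normal2 \<Otimes>\<^sub>M M) (\<lambda>(z, \<omega>). G z \<omega> ^ 8)"
    proof (rule Q.P.integrable_const_bound[where B="2 ^ 8"])
      have "(\<lambda>x. G (fst x) (snd x) ^ 8) \<in> borel_measurable (normal2 \<Otimes>\<^sub>M M)" by measurable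
      then show "(\<lambda>(z, \<omega>). G z \<omega> ^ 8) \<in> borel_measurable (normal2 \<Otimes>\<^sub>M M)" by (simp add: split_beta')
      show "AE x in normal2 \<Otimes>\<^sub>M M. norm (case x of (z, \<omega>) \<Rightarrow> G z \<omega> ^ 8) \<le> 2 ^ 8"
        using G8b by (intro AE_I2) (simp add: split_beta')
    qed
    \<comment> \<open>Jensen's inequality moves the eighth power inside the integral over
      \<open>z\<close>, and Fubini's theorem then reduces the estimate to a fixed
      \<open>z\<close>.\<close>
    have "expectation (\<lambda>\<omega>. ?F n \<omega> ^ 8) \<le> expectation (\<lambda>\<omega>. \<integral>z. G z \<omega> ^ 8 \<partial>normal2)"
    proof (rule integral_mono[OF iF])
      show "integrable M (\<lambda>\<omega>. \<integral>z. G z \<omega> ^ 8 \<partial>normal2)" by (rule Q.integrable_snd[OF iG])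
      show "?F n \<omega> ^ 8 \<le> (\<integral>z. G z \<omega> ^ 8 \<partial>normal2)" for \<omega>
        unfolding F_eq by (rule normal2.P.expectation_power8_le) (use Gb in auto)
    qed
    also have "\<dots> = (\<integral>z. expectation (\<lambda>\<omega>. G z \<omega> ^ 8) \<partial>normal2)"
      by (rule Q.Fubini_integral[OF iG])
    also have "\<dots> \<le> (\<integral>z. K * B z ^ 8 * real n powr (4 * (\<theta> - \<gamma>)) \<partial>normal2)"
    proof (rule integral_mono)
      show "integrable normal2 (\<lambda>z. expectation (\<lambda>\<omega>. G z \<omega> ^ 8))"
        by (rule Q.integrable_fst[OF iG])
      show "integrable normal2 (\<lambda>z. K * B z ^ 8 * real n powr (4 * (\<theta> - \<gamma>)))"
        using intB by simp
      fix z
      define a where "a k = (fst z * u + snd z * v) / \<tau> n k" for k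
      define b where "b k = (fst z * u - snd z * v) / \<tau> n k" for k
      have \<zeta>_eq: "\<zeta> k z \<omega> = a k * D p n k \<omega> + b k * D p n (k + 1) \<omega>" for k \<omega>
        by (simp add: \<zeta>_def a_def b_def nsum_def ndiff_def add_divide_distrib diff_divide_distrib algebra_simps)
      have ab: "\<bar>a k\<bar> * sd p n k \<le> B z" "\<bar>b k\<bar> * sd p n (k + 1) \<le> B z" if k: "k \<in> {1..<n - p}" for k
      proof -
        have t: "\<tau> n k > 0" using k by (intro tpos) auto
        have s: "sd p n k \<le> 5 * \<tau> n k" "sd p n (k + 1) \<le> 5 * \<tau> n k"
          using sdt[OF n(1)] k by auto
        have s0: "sd p n l \<ge> 0" for l by (simp add: incr_sd_def)
        have le: "\<bar>x\<bar> / \<tau> n k * y \<le> B z" if "\<bar>x\<bar> \<le> \<bar>fst z\<bar> * u + \<bar>snd z\<bar> * v" "0 \<le> y" "y \<le> 5 * \<tau> n k" for x y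
        proof -
          have "\<bar>x\<bar> / \<tau> n k * y \<le> (\<bar>fst z\<bar> * u + \<bar>snd z\<bar> * v) / \<tau> n k * (5 * \<tau> n k)"
            using that t uv by (intro mult_mono divide_right_mono) auto
          also have "\<dots> = B z" using t by (simp add: B_def)
          finally show ?thesis .
        qed
        have "\<bar>fst z * u + snd z * v\<bar> \<le> \<bar>fst z\<bar> * u + \<bar>snd z\<bar> * v"
          "\<bar>fst z * u - snd z * v\<bar> \<le> \<bar>fst z\<bar> * u + \<bar>snd z\<bar> * v"
          using uv abs_triangle_ineq[of "fst z * u" "snd z * v"] abs_triangle_ineq4[of "fst z * u" "snd z * v"]
          by (simp_all add: abs_mult)
        from le[OF this(1) s0 s(1)] le[OF this(2) s0 s(2)] t
        show "\<bar>a k\<bar> * sd p n k \<le> B z" "\<bar>b k\<bar> * sd p n (k + 1) \<le> B z"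
          by (simp_all add: a_def b_def)
      qed
      have "B z \<ge> 0" using uv by (simp add: B_def)
      from cos_average_eighth_moment[OF cb n(2) ab this]
      have "expectation (\<lambda>\<omega>. G z \<omega> ^ 8) \<le> K * ((B z)\<^sup>2 * real n powr (\<theta> - \<gamma>)) ^ 4"
        using g by (simp add: G_def \<zeta>_eq c_def K_def)
      also have "\<dots> = K * B z ^ 8 * real n powr (4 * (\<theta> - \<gamma>))"
      proof -
        have "(real n powr (\<theta> - \<gamma>)) ^ 4 = real n powr (4 * (\<theta> - \<gamma>))"
          using n by (simp add: powr_power mult.commute)
        then show ?thesis by (simp only: power_mult_distrib power_mult[symmetric]) simp
      qed
      finally show "expectation (\<lambda>\<omega>. G z \<omega> ^ 8) \<le> K * B z ^ 8 * real n powr (4 * (\<theta> - \<gamma>))" .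
    qed
    also have "\<dots> = K * (\<integral>z. B z ^ 8 \<partial>normal2) * real n powr (4 * (\<theta> - \<gamma>))" by simp
    finally show "expectation (\<lambda>\<omega>. ?F n \<omega> ^ 8) \<le> K * (\<integral>z. B z ^ 8 \<partial>normal2) * real n powr (4 * (\<theta> - \<gamma>))" .
  qed
qed

end

section \<open>The law of large numbers\<close>

definition gmono_mean :: "nat \<Rightarrow> nat \<Rightarrow> nat \<Rightarrow> real \<Rightarrow> real" where
  "gmono_mean i j p h = (\<integral>z. gmono i j (sqrt (sum_var p h) * fst z) (sqrt (diff_var p h) * snd z) \<partial>normal2)"

lemma gmono_sqrt:
  "0 \<le> a \<Longrightarrow> 0 \<le> b \<Longrightarrow> gmono i j (sqrt a * x) (sqrt b * y) = exp (- (real i * a * x\<^sup>2 + real j * b * y\<^sup>2))"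
  by (simp add: gmono_def power_mult_distrib mult.assoc)

lemma measurable_gmono [measurable (raw)]:
  assumes [measurable]: "f \<in> borel_measurable M" "g \<in> borel_measurable M"
  shows "(\<lambda>x. gmono i j (f x) (g x)) \<in> borel_measurable M"
  unfolding gmono_def by measurable

lemma abs_gmono_le: "\<bar>gmono i j s d\<bar> \<le> 1"
  using gmono_bounds[of i j s d] by simp

lemma sum_var_le: "h \<le> 1 \<Longrightarrow> sum_var p h \<le> 9"
proof -
  assume h: "h \<le> 1"
  have "(2::real) powr (2 * h) \<le> 2 powr 2" using h by (intro powr_mono) auto
  then have "(2::real) powr (2 * h) \<le> 4" by simp
  moreover have "(3::real) powr (2 * h) > 0" by simp
  ultimately show ?thesis unfolding sum_var_def by (smt (verit))
qed

lemma diff_var_le: "h \<le> 1 \<Longrightarrow> diff_var p h \<le> 24"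
proof -
  assume h: "h \<le> 1"
  have "(3::real) powr (2 * h) \<le> 3 powr 2" using h by (intro powr_mono) auto
  then have "(3::real) powr (2 * h) \<le> 9" by simp
  moreover have "(2::real) powr (2 * h) > 0" by simp
  ultimately show ?thesis unfolding diff_var_def by (smt (verit))
qed

text \<open>The value is \<open>i + j\<close>. It is a Lipschitz constant for the mean of a monomial
  as a function of the two variances, because
  \<open>\<bar>e^(-x) - e^(-y)\<bar> \<le> \<bar>x - y\<bar>\<close> for nonnegative
  arguments.\<close>

definition second_moments :: "nat \<Rightarrow> nat \<Rightarrow> real" where
  "second_moments i j = (\<integral>z. real i * (fst z)\<^sup>2 + real j * (snd z)\<^sup>2 \<partial>normal2)"

lemma integrable_second_moments:
  "integrable normal2 (\<lambda>z. real i * (fst z)\<^sup>2 + real j * (snd z)\<^sup>2)"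
  by (intro Bochner_Integration.integrable_add integrable_mult_right integrable_normal2_power)

lemma continuous_on_gmono_mean:
  fixes H :: "real \<Rightarrow> real"
  assumes H: "continuous_on {0..1} H" "\<And>t. t \<in> {0..1} \<Longrightarrow> 0 < H t \<and> H t < 1" and p: "p \<in> {1, 2}"
  shows "continuous_on {0..1} (\<lambda>t. gmono_mean i j p (H t))"
proof -
  let ?K = "second_moments i j"
  let ?a = "\<lambda>t. sum_var p (H t)" and ?b = "\<lambda>t. diff_var p (H t)"
  let ?g = "\<lambda>t z. gmono i j (sqrt (?a t) * fst z) (sqrt (?b t) * snd z)"
  let ?d = "\<lambda>s t. \<bar>?a t - ?a s\<bar> + \<bar>?b t - ?b s\<bar>"
  have pos: "?a t > 0" "?b t > 0" if "t \<in> {0..1}" for t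
    using H(2)[OF that] p by (auto intro: sum_var_pos diff_var_pos)
  have bd: "\<bar>gmono_mean i j p (H t) - gmono_mean i j p (H s)\<bar> \<le> ?d s t * ?K"
    if t: "t \<in> {0..1}" and s: "s \<in> {0..1}" for s t
  proof -
    have int: "integrable normal2 (\<lambda>z. gmono i j (x * fst z) (y * snd z))" for x y
      by (rule normal2.P.integrable_const_bound[where B=1]) (auto simp: abs_gmono_le)
    have "\<bar>gmono_mean i j p (H t) - gmono_mean i j p (H s)\<bar>
      = \<bar>\<integral>z. ?g t z - ?g s z \<partial>normal2\<bar>"
      unfolding gmono_mean_def by (simp add: int)
    also have "\<dots> \<le> (\<integral>z. \<bar>?g t z - ?g s z\<bar> \<partial>normal2)"
      by (rule integral_abs_bound)
    also have "\<dots> \<le> (\<integral>z. ?d s t * (real i * (fst z)\<^sup>2 + real j * (snd z)\<^sup>2) \<partial>normal2)"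
    proof (rule integral_mono)
      fix z :: "real \<times> real"
      let ?x = "real i * (fst z)\<^sup>2" and ?y = "real j * (snd z)\<^sup>2"
      have "\<bar>?g t z - ?g s z\<bar>
        \<le> \<bar>(real i * ?a t * (fst z)\<^sup>2 + real j * ?b t * (snd z)\<^sup>2) - (real i * ?a s * (fst z)\<^sup>2 + real j * ?b s * (snd z)\<^sup>2)\<bar>"
        using pos[OF t] pos[OF s] by (simp only: gmono_sqrt less_imp_le) (rule abs_exp_minus_diff_le, auto intro!: add_nonneg_nonneg)
      also have "\<dots> = \<bar>(?a t - ?a s) * ?x + (?b t - ?b s) * ?y\<bar>" by (simp add: algebra_simps)
      also have "\<dots> \<le> \<bar>?a t - ?a s\<bar> * ?x + \<bar>?b t - ?b s\<bar> * ?y"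
        by (rule order_trans[OF abs_triangle_ineq]) (simp add: abs_mult)
      also have "\<dots> \<le> ?d s t * (?x + ?y)"
        by (simp add: distrib_left distrib_right)
      finally show "\<bar>?g t z - ?g s z\<bar>
        \<le> ?d s t * (?x + ?y)" .
    qed (use integrable_second_moments int in auto)
    also have "\<dots> = ?d s t * ?K" by (simp add: second_moments_def)
    finally show ?thesis .
  qed
  show ?thesis
    unfolding continuous_on_def
  proof
    fix s :: real assume s: "s \<in> {0..1}"
    have "(?a \<longlongrightarrow> ?a s) (at s within {0..1})" "(?b \<longlongrightarrow> ?b s) (at s within {0..1})"
      using continuous_on_sum_var[OF H(1), of p] continuous_on_diff_var[OF H(1), of p] s by (auto simp: continuous_on_def)
    then have "((\<lambda>t. ?d s t * ?K) \<longlongrightarrow> (\<bar>?a s - ?a s\<bar> + \<bar>?b s - ?b s\<bar>) * ?K) (at s within {0..1})"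
      by (intro tendsto_intros)
    then have "((\<lambda>t. ?d s t * ?K) \<longlongrightarrow> 0) (at s within {0..1})" by simp
    then have "((\<lambda>t. gmono_mean i j p (H t) - gmono_mean i j p (H s)) \<longlongrightarrow> 0) (at s within {0..1})"
      by (rule Lim_null_comparison[rotated]) (use bd s in \<open>auto simp: eventually_at_filter\<close>)
    then show "((\<lambda>t. gmono_mean i j p (H t)) \<longlongrightarrow> gmono_mean i j p (H s)) (at s within {0..1})"
      by (simp add: LIM_zero_iff)
  qed
qed

context gauss_process begin

lemma gaussian_nsum_ndiff:
  assumes k: "k < n - p"
  shows "centered_gaussian_rv M (\<lambda>\<omega>. x * nsum p \<tau> n k \<omega> + y * ndiff p \<tau> n k \<omega>)"
proof -
  have n0: "n > 0" and kk: "k + p \<le> n" "k + 1 + p \<le> n" using k by auto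
  interpret G: gaussian_family M "{..n}" "\<lambda>k. X (real k / real n)" using n0 by (rule gaussian_family_grid)
  define a where "a = (x + y) / \<tau> n k"
  define b where "b = (x - y) / \<tau> n k"
  have "G.lf (\<lambda>l. a * incr_coeff p k l + b * incr_coeff p (k + 1) l) \<omega>
     = x * nsum p \<tau> n k \<omega> + y * ndiff p \<tau> n k \<omega>" for \<omega>
  proof -
    have "G.lf (\<lambda>l. a * incr_coeff p k l + b * incr_coeff p (k + 1) l) \<omega>
      = a * G.lf (incr_coeff p k) \<omega> + b * G.lf (incr_coeff p (k + 1)) \<omega>"
      unfolding G.lf_def by (simp add: sum.distrib sum_distrib_left distrib_right mult.assoc)
    also have "\<dots> = a * D p n k \<omega> + b * D p n (k + 1) \<omega>"
      using n0 kk by (simp only: lf_incr_coeff)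
    also have "\<dots> = x * nsum p \<tau> n k \<omega> + y * ndiff p \<tau> n k \<omega>"
      by (simp add: a_def b_def nsum_def ndiff_def add_divide_distrib diff_divide_distrib algebra_simps)
    finally show ?thesis .
  qed
  then have "G.lf (\<lambda>l. a * incr_coeff p k l + b * incr_coeff p (k + 1) l)
     = (\<lambda>\<omega>. x * nsum p \<tau> n k \<omega> + y * ndiff p \<tau> n k \<omega>)" by (rule ext)
  then show ?thesis
    using G.gauss_lf[of "\<lambda>l. a * incr_coeff p k l + b * incr_coeff p (k + 1) l"] by (simp only:)
qed

lemma integrable_nsum_ndiff:
  assumes k: "k < n - p"
  shows "integrable M (\<lambda>\<omega>. (nsum p \<tau> n k \<omega>)\<^sup>2)" "integrable M (\<lambda>\<omega>. (ndiff p \<tau> n k \<omega>)\<^sup>2)"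
    "integrable M (\<lambda>\<omega>. nsum p \<tau> n k \<omega> * ndiff p \<tau> n k \<omega>)"
proof -
  let ?e = "D p n (k + 1)"
  let ?d = "D p n k"
  have n0: "n > 0" and kk: "k + p \<le> n" "k + 1 + p \<le> n" using k by auto
  note i = integrable_D_mult[OF n0 kk(1) kk(1)] integrable_D_mult[OF n0 kk(1) kk(2)] integrable_D_mult[OF n0 kk(2) kk(2)]
  have "integrable M (\<lambda>\<omega>. (?d \<omega> * ?d \<omega> + 2 * (?d \<omega> * ?e \<omega>) + ?e \<omega> * ?e \<omega>) / (\<tau> n k)\<^sup>2)"
    using i by simp
  then show "integrable M (\<lambda>\<omega>. (nsum p \<tau> n k \<omega>)\<^sup>2)"
    by (simp add: nsum_def power_divide power2_eq_square algebra_simps)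
  have "integrable M (\<lambda>\<omega>. (?d \<omega> * ?d \<omega> - 2 * (?d \<omega> * ?e \<omega>) + ?e \<omega> * ?e \<omega>) / (\<tau> n k)\<^sup>2)"
    using i by simp
  then show "integrable M (\<lambda>\<omega>. (ndiff p \<tau> n k \<omega>)\<^sup>2)"
    by (simp add: ndiff_def power_divide power2_eq_square algebra_simps)
  have "integrable M (\<lambda>\<omega>. (?d \<omega> * ?d \<omega> - ?e \<omega> * ?e \<omega>) / (\<tau> n k)\<^sup>2)"
    using i by simp
  then show "integrable M (\<lambda>\<omega>. nsum p \<tau> n k \<omega> * ndiff p \<tau> n k \<omega>)"
    by (simp add: nsum_def ndiff_def power2_eq_square algebra_simps)
qed

text \<open>The increments are \<open>\<tau>\<close> times half the sum or half the difference of
  \<open>nsum\<close> and \<open>ndiff\<close>, so their variances are at most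
  \<open>50 / 2 = 5^2\<close> in units of \<open>\<tau>^2\<close>.\<close>

lemma incr_sd_le:
  assumes k: "k < n - p" and t: "\<tau> n k > 0"
    and b: "expectation (\<lambda>\<omega>. (nsum p \<tau> n k \<omega>)\<^sup>2) + expectation (\<lambda>\<omega>. (ndiff p \<tau> n k \<omega>)\<^sup>2) \<le> 50"
  shows "sd p n k \<le> 5 * \<tau> n k" "sd p n (k + 1) \<le> 5 * \<tau> n k"
proof -
  let ?S = "nsum p \<tau> n k"
  let ?T = "ndiff p \<tau> n k"
  let ?r = "\<lambda>\<omega>. (\<tau> n k)\<^sup>2 * (((?S \<omega>)\<^sup>2 + (?T \<omega>)\<^sup>2) / 2)"
  note i = integrable_nsum_ndiff[OF k, of \<tau>]
  have n0: "n > 0" and kk: "k + p \<le> n" "k + 1 + p \<le> n" using k by auto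
  have main: "sqrt (expectation (\<lambda>\<omega>. (f \<omega>)\<^sup>2)) \<le> 5 * \<tau> n k"
    if f: "integrable M (\<lambda>\<omega>. (f \<omega>)\<^sup>2)" and fe: "\<And>\<omega>. (f \<omega>)\<^sup>2 \<le> ?r \<omega>" for f
  proof -
    have "expectation (\<lambda>\<omega>. (f \<omega>)\<^sup>2) \<le> expectation (\<lambda>\<omega>. ?r \<omega>)"
      by (intro integral_mono f fe) (use i in auto)
    also have "\<dots> = (\<tau> n k)\<^sup>2 * ((expectation (\<lambda>\<omega>. (?S \<omega>)\<^sup>2) + expectation (\<lambda>\<omega>. (?T \<omega>)\<^sup>2)) / 2)"
      using i by simp
    also have "\<dots> \<le> (\<tau> n k)\<^sup>2 * 25" using b by (intro mult_left_mono) auto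
    also have "\<dots> = (5 * \<tau> n k)\<^sup>2" by (simp add: power_mult_distrib)
    finally show ?thesis using t by (simp add: real_le_lsqrt)
  qed
  have e: "D p n k \<omega> = \<tau> n k * ((?S \<omega> + ?T \<omega>) / 2)"
     "D p n (k + 1) \<omega> = \<tau> n k * ((?S \<omega> - ?T \<omega>) / 2)" for \<omega>
    using t by (simp_all add: nsum_def ndiff_def divide_simps)
  have sq: "((x + y) / 2)\<^sup>2 \<le> (x\<^sup>2 + y\<^sup>2) / 2" "((x - y) / 2)\<^sup>2 \<le> (x\<^sup>2 + y\<^sup>2) / 2" for x y :: real
    using sum_squares_bound[of x y] sum_squares_bound[of x "- y"]
    by (simp_all add: power_divide power2_sum power2_diff)
  show "sd p n k \<le> 5 * \<tau> n k"
    unfolding incr_sd_def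
  proof (rule main)
    show "integrable M (\<lambda>\<omega>. (D p n k \<omega>)\<^sup>2)" using integrable_D_mult[OF n0 kk(1) kk(1)] by (simp add: power2_eq_square)
    show "(D p n k \<omega>)\<^sup>2 \<le> ?r \<omega>" for \<omega>
      unfolding e(1) power_mult_distrib by (intro mult_left_mono sq) auto
  qed
  show "sd p n (k + 1) \<le> 5 * \<tau> n k"
    unfolding incr_sd_def
  proof (rule main)
    show "integrable M (\<lambda>\<omega>. (D p n (k + 1) \<omega>)\<^sup>2)" using integrable_D_mult[OF n0 kk(2) kk(2)] by (simp add: power2_eq_square)
    show "(D p n (k + 1) \<omega>)\<^sup>2 \<le> ?r \<omega>" for \<omega>
      unfolding e(2) power_mult_distrib by (intro mult_left_mono sq) auto
  qed
qed

text \<open>Both means are integrals over the mixing variable of exponentials of quadratic forms: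
  half the variance of a linear form on one side, a form without mixed term on the other. Comparing
  exponents, half of the error bound comes from the two variances and half from the mixed
  moment.\<close>

lemma expectation_gmono_near:
  fixes H :: "real \<Rightarrow> real"
  assumes k: "k < n - p" and e: "e \<ge> 0" and pos: "sum_var p ((H (midpt n k))) \<ge> 0" "diff_var p ((H (midpt n k))) \<ge> 0"
    and close: "close_variances p \<tau> H e n k"
  shows "\<bar>expectation (\<lambda>\<omega>. gmono i j (nsum p \<tau> n k \<omega>) (ndiff p \<tau> n k \<omega>)) - gmono_mean i j p ((H (midpt n k)))\<bar>
    \<le> 2 * e * second_moments i j"
proof -
  let ?h = "H (midpt n k)"
  note A = close[unfolded close_variances_def]
  let ?S = "nsum p \<tau> n k" and ?T = "ndiff p \<tau> n k"
  define u where "u = sqrt (2 * real i)"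
  define v where "v = sqrt (2 * real j)"
  have uv: "u\<^sup>2 = 2 * real i" "v\<^sup>2 = 2 * real j" "u \<ge> 0" "v \<ge> 0" by (simp_all add: u_def v_def)
  note int = integrable_nsum_ndiff[OF k, of \<tau>]
  let ?a = "expectation (\<lambda>\<omega>. (?S \<omega>)\<^sup>2)" and ?b = "expectation (\<lambda>\<omega>. (?T \<omega>)\<^sup>2)" and ?c = "expectation (\<lambda>\<omega>. ?S \<omega> * ?T \<omega>)"
  define q where "q z = (fst z * u)\<^sup>2 * ?a + 2 * (fst z * u) * (snd z * v) * ?c + (snd z * v)\<^sup>2 * ?b" for z :: "real \<times> real"
  have q: "expectation (\<lambda>\<omega>. (fst z * (u * ?S \<omega>) + snd z * (v * ?T \<omega>))\<^sup>2) = q z" for z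
  proof -
    have "expectation (\<lambda>\<omega>. (fst z * (u * ?S \<omega>) + snd z * (v * ?T \<omega>))\<^sup>2)
      = expectation (\<lambda>\<omega>. (fst z * u)\<^sup>2 * (?S \<omega>)\<^sup>2 + 2 * (fst z * u) * (snd z * v) * (?S \<omega> * ?T \<omega>) + (snd z * v)\<^sup>2 * (?T \<omega>)\<^sup>2)"
      by (simp add: power2_eq_square algebra_simps)
    also have "\<dots> = q z" unfolding q_def using int by simp
    finally show ?thesis .
  qed
  have q0: "q z \<ge> 0" for z unfolding q[symmetric] by (rule Bochner_Integration.integral_nonneg) simp
  have c: "expectation (\<lambda>\<omega>. cos (fst z * (u * ?S \<omega>) + snd z * (v * ?T \<omega>))) = exp (- (q z / 2))" for z
  proof -
    have "centered_gaussian_rv M (\<lambda>\<omega>. fst z * (u * ?S \<omega>) + snd z * (v * ?T \<omega>))"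
      using gaussian_nsum_ndiff[OF k, of "fst z * u" \<tau> "snd z * v"] by (simp add: mult.assoc)
    from centered_gaussian_rv_expectation_cos[OF this] show ?thesis by (simp add: q)
  qed
  define r where "r z = real i * sum_var p ?h * (fst z)\<^sup>2 + real j * diff_var p ?h * (snd z)\<^sup>2" for z :: "real \<times> real"
  have r0: "r z \<ge> 0" for z using pos by (auto simp: r_def)
  have qm [measurable]: "q \<in> borel_measurable normal2" "r \<in> borel_measurable normal2"
    unfolding q_def[abs_def] r_def[abs_def] by measurable
  have ie: "integrable normal2 (\<lambda>z. exp (- (q z / 2)))" "integrable normal2 (\<lambda>z. exp (- r z))"
    by (rule normal2.P.integrable_const_bound[where B=1]; simp add: q0 r0)+
  have "expectation (\<lambda>\<omega>. gmono i j (?S \<omega>) (?T \<omega>)) = (\<integral>z. exp (- (q z / 2)) \<partial>normal2)"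
    unfolding expectation_gmono[OF k] u_def[symmetric] v_def[symmetric] c ..
  moreover have "gmono_mean i j p ?h = (\<integral>z. exp (- r z) \<partial>normal2)"
    unfolding gmono_mean_def r_def using pos by (simp only: gmono_sqrt)
  ultimately have "\<bar>expectation (\<lambda>\<omega>. gmono i j (?S \<omega>) (?T \<omega>)) - gmono_mean i j p ?h\<bar>
     = \<bar>\<integral>z. exp (- (q z / 2)) - exp (- r z) \<partial>normal2\<bar>" by (simp only: Bochner_Integration.integral_diff[OF ie])
  also have "\<dots> \<le> (\<integral>z. \<bar>exp (- (q z / 2)) - exp (- r z)\<bar> \<partial>normal2)" by (rule integral_abs_bound)
  also have "\<dots> \<le> (\<integral>z. 2 * e * (real i * (fst z)\<^sup>2 + real j * (snd z)\<^sup>2) \<partial>normal2)"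
  proof (rule integral_mono)
    fix z :: "real \<times> real"
    let ?x = "real i * (fst z)\<^sup>2" and ?y = "real j * (snd z)\<^sup>2"
    have "\<bar>exp (- (q z / 2)) - exp (- r z)\<bar> \<le> \<bar>q z / 2 - r z\<bar>"
      using q0 r0 by (intro abs_exp_minus_diff_le) auto
    also have "q z / 2 - r z = (?a - sum_var p ?h) * ?x + (?b - diff_var p ?h) * ?y + ((fst z * u) * (snd z * v)) * ?c"
      unfolding q_def r_def power_mult_distrib uv by (simp add: algebra_simps)
    also have "\<bar>\<dots>\<bar> \<le> e * ?x + e * ?y + (?x + ?y) * e"
    proof -
      have 1: "\<bar>(?a - sum_var p ?h) * ?x\<bar> \<le> e * ?x" using A by (simp add: abs_mult mult_right_mono)
      have 2: "\<bar>(?b - diff_var p ?h) * ?y\<bar> \<le> e * ?y" using A by (simp add: abs_mult mult_right_mono)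
      have "2 * \<bar>(fst z * u) * (snd z * v)\<bar> \<le> (fst z * u)\<^sup>2 + (snd z * v)\<^sup>2"
        using sum_squares_bound[of "\<bar>fst z * u\<bar>" "\<bar>snd z * v\<bar>"] by (simp add: abs_mult power_mult_distrib mult_ac)
      moreover have "(fst z * u)\<^sup>2 = 2 * ?x" "(snd z * v)\<^sup>2 = 2 * ?y" by (simp_all add: power_mult_distrib uv)
      ultimately have "\<bar>(fst z * u) * (snd z * v)\<bar> \<le> ?x + ?y" by linarith
      then have 3: "\<bar>((fst z * u) * (snd z * v)) * ?c\<bar> \<le> (?x + ?y) * e"
        unfolding abs_mult[of _ ?c] using A by (intro mult_mono) auto
      show ?thesis using 1 2 3 by linarith
    qed
    also have "\<dots> = 2 * e * (?x + ?y)" by (simp add: algebra_simps)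
    finally show "\<bar>exp (- (q z / 2)) - exp (- r z)\<bar> \<le> 2 * e * (?x + ?y)" .
  qed (use integrable_second_moments ie in auto)
  also have "\<dots> = 2 * e * second_moments i j" by (simp add: second_moments_def)
  finally show ?thesis .
qed

text \<open>The average is split into a centred average, the bias of the local means, and a Riemann
  sum of their limits; the first two tend to 0.\<close>

lemma monomial_lln:
  fixes H :: "real \<Rightarrow> real"
  assumes A2: "assumption_A2 p M X" and p: "p \<in> {1, 2}"
    and H: "continuous_on {0..1} H" "\<And>t. t \<in> {0..1} \<Longrightarrow> 0 < H t \<and> H t < 1"
    and tpos: "\<And>n k. k < n \<Longrightarrow> \<tau> n k > 0"
    and var: "\<And>e. e > 0 \<Longrightarrow> \<forall>\<^sub>F n in sequentially. \<forall>k<n - p. close_variances p \<tau> H e n k"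
  shows "AE \<omega> in M. (\<lambda>n. 1 / real (n - p) * (\<Sum>k=1..<n - p. gmono i j (nsum p \<tau> n k \<omega>) (ndiff p \<tau> n k \<omega>)))
     \<longlonglongrightarrow> integral {0..1} (\<lambda>t. gmono_mean i j p (H t))"
proof -
  from assumption_A2_correlation[OF A2] obtain C \<gamma> \<theta> where cb: "correlation_bound p C \<gamma> \<theta>" .
  have Hm: "0 < H (midpt n k) \<and> H (midpt n k) < 1" if "k < n - p" for n k
    using that by (intro H(2) midpt_in') auto
  obtain N where N: "\<And>n k. n \<ge> N \<Longrightarrow> k < n - p \<Longrightarrow> sd p n k \<le> 5 * \<tau> n k \<and> sd p n (k + 1) \<le> 5 * \<tau> n k"
  proof -
    obtain N where N: "\<And>n k. n \<ge> N \<Longrightarrow> k < n - p \<Longrightarrow> close_variances p \<tau> H 1 n k"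
      using var[of 1] unfolding eventually_sequentially by auto
    show ?thesis
    proof (rule that)
      fix n k assume nk: "n \<ge> N" "k < n - p"
      have "\<tau> n k > 0" using nk by (intro tpos) auto
      \<comment> \<open>The bounds 9 and 24 on the limiting variances, each with an error of 1, stay
        below 50.\<close>
      moreover have "expectation (\<lambda>\<omega>. (nsum p \<tau> n k \<omega>)\<^sup>2) + expectation (\<lambda>\<omega>. (ndiff p \<tau> n k \<omega>)\<^sup>2) \<le> 50"
        using N[OF nk, unfolded close_variances_def] sum_var_le[of "H (midpt n k)" p] diff_var_le[of "H (midpt n k)" p] Hm[OF nk(2)] by (smt (verit))
      ultimately show "sd p n k \<le> 5 * \<tau> n k \<and> sd p n (k + 1) \<le> 5 * \<tau> n k"
        using incr_sd_le[OF nk(2)] by blast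
    qed
  qed
  let ?K = "second_moments i j"
  let ?m = "\<lambda>n k \<omega>. gmono i j (nsum p \<tau> n k \<omega>) (ndiff p \<tau> n k \<omega>)"
  let ?L = "\<lambda>n k. gmono_mean i j p (H (midpt n k))"
  have K0: "?K \<ge> 0" unfolding second_moments_def by (rule Bochner_Integration.integral_nonneg) auto
  have ex: "(\<lambda>n. 1 / real (n - p) * (\<Sum>k=1..<n - p. expectation (?m n k) - ?L n k)) \<longlonglongrightarrow> 0"
  proof (rule LIMSEQ_I)
    fix r :: real assume r: "r > 0"
    \<comment> \<open>Dividing by \<open>2 * ?K + 1\<close> rather than by \<open>?K\<close> covers
      \<open>?K = 0\<close>, which occurs for \<open>i = j = 0\<close>.\<close>
    define e where "e = r / (2 * ?K + 1) / 2"
    have e: "e > 0" unfolding e_def using r K0 by (intro divide_pos_pos add_nonneg_pos mult_nonneg_nonneg) auto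
    have eK: "2 * e * ?K < r"
    proof -
      have "2 * (r / w / 2) * x = r * (x / w)" for w x by simp
      then have "2 * e * ?K = r * (?K / (2 * ?K + 1))" unfolding e_def .
      also have "x / (2 * x + 1) < 1" if "x \<ge> 0" for x :: real using that by (simp add: divide_simps)
      then have "r * (?K / (2 * ?K + 1)) < r * 1" using r K0 by (intro mult_strict_left_mono)
      finally show ?thesis by simp
    qed
    obtain N1 where N1: "\<And>n k. n \<ge> N1 \<Longrightarrow> k < n - p \<Longrightarrow> close_variances p \<tau> H e n k"
      using var[OF e] unfolding eventually_sequentially by auto
    show "\<exists>no. \<forall>n\<ge>no. norm (1 / real (n - p) * (\<Sum>k=1..<n - p. expectation (?m n k) - ?L n k) - 0) < r"
    proof (intro exI allI impI)
      fix n assume n: "n \<ge> max N1 (p + 1)"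
      have b: "\<bar>expectation (?m n k) - ?L n k\<bar> \<le> 2 * e * ?K" if "k \<in> {1..<n - p}" for k
      proof -
        have k: "k < n - p" using that by simp
        show ?thesis
          using N1[of n k] n k e sum_var_pos[OF p, of "H (midpt n k)"] diff_var_pos[OF p, of "H (midpt n k)"] Hm[OF k]
          by (intro expectation_gmono_near) auto
      qed
      have "\<bar>\<Sum>k=1..<n - p. expectation (?m n k) - ?L n k\<bar> \<le> (\<Sum>k=1..<n - p. 2 * e * ?K)"
        by (rule order_trans[OF sum_abs], rule sum_mono, rule b)
      also have "\<dots> = real (n - p - 1) * (2 * e * ?K)" by simp
      also have "\<dots> \<le> real (n - p) * (2 * e * ?K)" using e K0 by (intro mult_right_mono) auto
      finally have "\<bar>1 / real (n - p) * (\<Sum>k=1..<n - p. expectation (?m n k) - ?L n k)\<bar> \<le> 2 * e * ?K"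
        using n by (simp add: abs_mult field_simps)
      then show "norm (1 / real (n - p) * (\<Sum>k=1..<n - p. expectation (?m n k) - ?L n k) - 0) < r"
        using eK by simp
    qed
  qed
  have rs: "(\<lambda>n. 1 / real (n - p) * (\<Sum>k=1..<n - p. ?L n k)) \<longlonglongrightarrow> integral {0..1} (\<lambda>t. gmono_mean i j p (H t))"
    unfolding midpt_def by (rule midpoint_sum_tendsto) (rule continuous_on_gmono_mean[OF H p])
  have "AE \<omega> in M. (\<lambda>n. 1 / real (n - p) * (\<Sum>k=1..<n - p. ?m n k \<omega> - expectation (?m n k))) \<longlonglongrightarrow> 0"
    by (rule monomial_concentration[OF cb, where N=N]) (rule tpos N; assumption)+
  then show ?thesis
  proof eventually_elim
    case (elim \<omega>)
    from tendsto_add[OF tendsto_add[OF elim ex] rs]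
    show ?case by (simp add: sum_subtractf right_diff_distrib)
  qed
qed

end

section \<open>Approximation of the ratio by polynomials\<close>

inductive_set monomial_span :: "(real \<times> real \<Rightarrow> real) set" where
  monomial: "(\<lambda>z. fst z ^ i * snd z ^ j) \<in> monomial_span"
| add: "f \<in> monomial_span \<Longrightarrow> g \<in> monomial_span \<Longrightarrow> (\<lambda>z. f z + g z) \<in> monomial_span"
| scale: "f \<in> monomial_span \<Longrightarrow> (\<lambda>z. c * f z) \<in> monomial_span"

lemma monomial_span_mult_fst: "f \<in> monomial_span \<Longrightarrow> (\<lambda>z. fst z * f z) \<in> monomial_span"
proof (induction rule: monomial_span.induct)
  case (monomial i j)
  show ?case using monomial_span.monomial[of "Suc i" j] by (simp add: mult_ac)
next
  case (add f g)
  then show ?case using monomial_span.add[OF add.IH] by (simp add: distrib_left)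
next
  case (scale f c)
  then show ?case using monomial_span.scale[OF scale.IH, of c] by (simp add: mult.left_commute)
qed

lemma monomial_span_mult_snd: "f \<in> monomial_span \<Longrightarrow> (\<lambda>z. snd z * f z) \<in> monomial_span"
proof (induction rule: monomial_span.induct)
  case (monomial i j)
  show ?case using monomial_span.monomial[of i "Suc j"] by (simp add: mult_ac)
next
  case (add f g)
  then show ?case using monomial_span.add[OF add.IH] by (simp add: distrib_left)
next
  case (scale f c)
  then show ?case using monomial_span.scale[OF scale.IH, of c] by (simp add: mult.left_commute)
qed

text \<open>Multiplying an arbitrary member of the span lets the induction pass through products;
  the constant monomial 1 as \<open>f\<close> then gives membership itself.\<close>

lemma real_polynomial_function_mult_span:
  assumes "real_polynomial_function q"
  shows "f \<in> monomial_span \<Longrightarrow> (\<lambda>z. q z * f z) \<in> monomial_span"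
  using assms
proof (induction arbitrary: f rule: real_polynomial_function.induct)
  case (linear h)
  note f = linear.prems
  interpret bounded_linear h by (rule linear.hyps)
  define a b where "a = h (1, 0)" and "b = h (0, 1)"
  have "h z = fst z * a + snd z * b" for z
  proof -
    have "h z = h (fst z *\<^sub>R (1, 0) + snd z *\<^sub>R (0, 1))" by (simp add: scaleR_prod_def)
    also have "\<dots> = fst z * a + snd z * b" by (simp only: add scale real_scaleR_def a_def b_def)
    finally show ?thesis .
  qed
  then have "(\<lambda>z. h z * f z) = (\<lambda>z. a * (fst z * f z) + b * (snd z * f z))"
    by (simp add: fun_eq_iff algebra_simps)
  also have "\<dots> \<in> monomial_span"
    by (rule monomial_span.add[OF monomial_span.scale[OF monomial_span_mult_fst[OF f]]
        monomial_span.scale[OF monomial_span_mult_snd[OF f]]])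
  finally show ?case .
next
  case (const c)
  then show ?case by (rule monomial_span.scale)
next
  case (add f' g')
  then show ?case using monomial_span.add[OF add.IH(1)[OF add.prems] add.IH(2)[OF add.prems]] by (simp add: distrib_right)
next
  case (mult f' g')
  then show ?case using mult.IH(1)[OF mult.IH(2)[OF mult.prems]] by (simp add: mult.assoc)
qed

lemma real_polynomial_function_in_span:
  assumes "real_polynomial_function q"
  shows "q \<in> monomial_span"
  using real_polynomial_function_mult_span[OF assms monomial_span.monomial[of 0 0]] by simp

text \<open>Cut-offs in \<open>w = e\<^bsup>-(s\<^sup>2 + d\<^sup>2)\<^esup>\<close> away from the two points \<open>w = 0\<close>, \<open>w = 1\<close> where the ratio,
  as a function of \<open>(e\<^bsup>-s\<^sup>2\<^esup>, e\<^bsup>-d\<^sup>2\<^esup>)\<close>, is discontinuous.\<close>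

definition cutoff :: "nat \<Rightarrow> real \<Rightarrow> real" where
  "cutoff m w = max 0 (min 1 (real m * w - 1)) * max 0 (min 1 (real m * (1 - w) - 1))"

text \<open>\<open>sqrt (- ln x)\<close> recovers \<open>\<bar>s\<bar>\<close> from
  \<open>x = e^(-s^2)\<close>. The truncations make the formula continuous on the whole plane and
  change nothing at points \<open>(e^(-s^2), e^(-d^2))\<close> where the cut-off does not
  vanish.\<close>

definition cut_ratio :: "nat \<Rightarrow> real \<times> real \<Rightarrow> real" where
  "cut_ratio m z = cutoff m (fst z * snd z) *
     (sqrt (- ln (max (1 / real m) (min 1 (fst z)))) /
      sqrt (max (1 / (2 * real m)) (max (- ln (max (1 / real m) (min 1 (fst z)))) (- ln (max (1 / real m) (min 1 (snd z)))))))"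

lemma cutoff_bounds: "0 \<le> cutoff m w" "cutoff m w \<le> 1"
  by (auto simp: cutoff_def intro!: mult_le_one)

lemma continuous_on_cutoff: "continuous_on S (\<lambda>z. cutoff m (fst z * snd z))"
  unfolding cutoff_def by (intro continuous_intros)

lemma continuous_on_cut_ratio:
  assumes m: "m > 0"
  shows "continuous_on S (cut_ratio m)"
proof -
  have pos: "max (1 / real m) x > 0" "max (1 / (2 * real m)) x > 0" for x
    using m by (simp_all add: less_max_iff_disj)
  have "sqrt (max (1 / (2 * real m)) x) \<noteq> 0" for x using pos(2)[of x] by simp
  moreover have "max (1 / real m) x \<noteq> 0" for x using pos(1)[of x] by simp
  ultimately show ?thesis
    unfolding cut_ratio_def[abs_def]
    by (intro continuous_intros continuous_on_cutoff ballI)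
qed

text \<open>Where the cut-off is nonzero, \<open>1/m < w < 1 - 1/m\<close> for the product
  \<open>w\<close> of the two coordinates. The lower bound passes to both coordinates, which are at
  least \<open>w\<close>, and the upper one to \<open>s^2 + d^2 \<ge> 1 - w\<close>; so no
  truncation is active.\<close>

lemma cut_ratio_eq:
  assumes m: "m > 0"
  shows "cut_ratio m (exp (- s\<^sup>2), exp (- d\<^sup>2)) = cutoff m (exp (- s\<^sup>2) * exp (- d\<^sup>2)) * sd_ratio s d"
proof (cases "cutoff m (exp (- s\<^sup>2) * exp (- d\<^sup>2)) = 0")
  case False
  let ?x = "exp (- s\<^sup>2)" and ?y = "exp (- d\<^sup>2)"
  let ?w = "?x * ?y"
  have "real m * ?w - 1 > 0" "real m * (1 - ?w) - 1 > 0" 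
  proof -
    have "a > 0" if "max 0 (min 1 a) \<noteq> 0" for a :: real using that by (auto simp: max_def split: if_splits)
    then show "real m * ?w - 1 > 0" "real m * (1 - ?w) - 1 > 0" using False by (auto simp: cutoff_def)
  qed
  then have w: "1 / real m < ?w" "1 / real m < 1 - ?w" using m by (simp_all add: field_simps)
  have xy: "?x \<le> 1" "?y \<le> 1" by simp_all
  have "?w \<le> ?x" "?w \<le> ?y" by (simp_all add: mult_left_le mult_left_le_one_le)
  then have "1 / real m \<le> ?x" "1 / real m \<le> ?y" using w(1) by linarith+
  then have 1: "max (1 / real m) (min 1 ?x) = ?x" "max (1 / real m) (min 1 ?y) = ?y"
    using xy by (simp_all add: min_absorb2 max_absorb2)
  have "?w = exp (- s\<^sup>2 - d\<^sup>2)" by (simp add: exp_diff exp_minus divide_inverse)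
  then have "1 - ?w \<le> s\<^sup>2 + d\<^sup>2" using exp_ge_add_one_self[of "- s\<^sup>2 - d\<^sup>2"] by linarith
  then have "1 / real m < s\<^sup>2 + d\<^sup>2" using w(2) by linarith
  moreover have "s\<^sup>2 + d\<^sup>2 \<le> 2 * max (s\<^sup>2) (d\<^sup>2)" by linarith
  moreover have "1 / (2 * real m) = (1 / real m) / 2" by simp
  ultimately have "1 / (2 * real m) \<le> max (s\<^sup>2) (d\<^sup>2)" by linarith
  then have 2: "max (1 / (2 * real m)) (max (s\<^sup>2) (d\<^sup>2)) = max (s\<^sup>2) (d\<^sup>2)" by (rule max_absorb2)
  have 3: "sqrt (max (s\<^sup>2) (d\<^sup>2)) = max \<bar>s\<bar> \<bar>d\<bar>"
  proof (cases "\<bar>s\<bar> \<le> \<bar>d\<bar>")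
    case True
    then have "s\<^sup>2 \<le> d\<^sup>2" by (simp add: abs_le_square_iff)
    then show ?thesis using True by (simp add: max_absorb2)
  next
    case False
    then have "\<bar>d\<bar> \<le> \<bar>s\<bar>" by simp
    then have "d\<^sup>2 \<le> s\<^sup>2" by (simp add: abs_le_square_iff)
    then show ?thesis using \<open>\<bar>d\<bar> \<le> \<bar>s\<bar>\<close> by (simp add: max_absorb1)
  qed
  have "s \<noteq> 0 \<or> d \<noteq> 0" using w(2) by auto
  then have "sd_ratio s d = \<bar>s\<bar> / max \<bar>s\<bar> \<bar>d\<bar>" by (auto simp: sd_ratio_def)
  then show ?thesis unfolding cut_ratio_def fst_conv snd_conv 1 ln_exp minus_minus 2 3 by simp
qed (simp add: cut_ratio_def)

lemma cutoff_tendsto_1: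
  assumes "0 < w" "w < 1"
  shows "(\<lambda>m. cutoff m w) \<longlonglongrightarrow> 1"
proof (rule tendsto_eventually)
  obtain N where N: "real N > max (2 / w) (2 / (1 - w))" using reals_Archimedean2 by blast
  show "\<forall>\<^sub>F m in sequentially. cutoff m w = 1"
    using eventually_ge_at_top[of N]
  proof eventually_elim
    case (elim m)
    then have "real m > 2 / w" "real m > 2 / (1 - w)" using N by auto
    then have "real m * w > 2" "real m * (1 - w) > 2" using assms by (simp_all add: field_simps)
    then show ?case by (simp add: cutoff_def)
  qed
qed

text \<open>A deterministic statement about empirical averages, to be applied for each
  \<open>\<omega>\<close> outside a null set. The discontinuities are harmless because the limit law
  gives no mass to \<open>U = V = 0\<close>, while \<open>w = 0\<close> is not attained by finite
  \<open>U\<close> and \<open>V\<close>.\<close>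

lemma (in prob_space) sd_ratio_average_tendsto:
  fixes s d :: "nat \<Rightarrow> nat \<Rightarrow> real" and U V :: "'a \<Rightarrow> real"
  assumes UV [measurable]: "U \<in> borel_measurable M" "V \<in> borel_measurable M"
    and conv: "\<And>i j. (\<lambda>n. 1 / real (n - p) * (\<Sum>k=1..<n - p. gmono i j (s n k) (d n k)))
      \<longlonglongrightarrow> expectation (\<lambda>q. gmono i j (U q) (V q))"
    and nz: "AE q in M. U q \<noteq> 0 \<or> V q \<noteq> 0"
  shows "(\<lambda>n. 1 / real (n - p) * (\<Sum>k=1..<n - p. sd_ratio (s n k) (d n k)))
      \<longlonglongrightarrow> expectation (\<lambda>q. sd_ratio (U q) (V q))"
proof -
  define P where "P x y = (exp (- x\<^sup>2), exp (- y\<^sup>2))" for x y :: real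
  define sq where "sq = {0..1::real} \<times> {0..1::real}"
  have Psq: "P x y \<in> sq" for x y by (simp add: P_def sq_def)
  define A where "A n f = 1 / real (n - p) * (\<Sum>k=1..<n - p. f (s n k) (d n k))" for n and f :: "real \<Rightarrow> real \<Rightarrow> real"
  define L where "L f = expectation (\<lambda>q. f (U q) (V q))" for f :: "real \<Rightarrow> real \<Rightarrow> real"
  let ?A = "\<lambda>n f. A n (\<lambda>x y. f (P x y))" and ?L = "\<lambda>f. L (\<lambda>x y. f (P x y))"
  have A_add: "A n (\<lambda>x y. f x y + g x y) = A n f + A n g" for n f g
    by (simp add: A_def sum.distrib distrib_left)
  have A_scale: "A n (\<lambda>x y. c * f x y) = c * A n f" for n c f
    by (simp add: A_def sum_distrib_left mult_ac)
  have A_diff: "\<bar>A n f - A n g\<bar> \<le> A n e" if "\<And>x y. \<bar>f x y - g x y\<bar> \<le> e x y" for n f g e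
  proof -
    have "\<bar>(\<Sum>k=1..<n - p. f (s n k) (d n k)) - (\<Sum>k=1..<n - p. g (s n k) (d n k))\<bar> \<le> (\<Sum>k=1..<n - p. e (s n k) (d n k))"
      unfolding sum_subtractf[symmetric] by (rule order_trans[OF sum_abs], rule sum_mono, rule that)
    then have "1 / real (n - p) * \<bar>(\<Sum>k=1..<n - p. f (s n k) (d n k)) - (\<Sum>k=1..<n - p. g (s n k) (d n k))\<bar> \<le> A n e"
      unfolding A_def by (rule mult_left_mono) simp
    then show ?thesis unfolding A_def right_diff_distrib[symmetric] abs_mult by simp
  qed
  \<comment> \<open>Only an inequality: \<open>n - p - 1\<close> terms are divided by
    \<open>n - p\<close>.\<close>
  have A_const: "A n (\<lambda>x y. c) \<le> c" if "c \<ge> 0" for n c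
  proof (cases "n - p = 0")
    case False
    have "(\<Sum>k=1..<n - p. c) \<le> real (n - p) * c" using that by (simp add: mult_right_mono)
    then show ?thesis using False by (simp add: A_def field_simps)
  qed (use that in \<open>simp add: A_def\<close>)
  have meas: "(\<lambda>q. f (P (U q) (V q))) \<in> borel_measurable M" if "continuous_on UNIV f" for f :: "real \<times> real \<Rightarrow> real"
  proof -
    have [measurable]: "f \<in> borel_measurable borel" using that by (rule borel_measurable_continuous_onI)
    have "(\<lambda>q. P (U q) (V q)) \<in> borel_measurable M" unfolding P_def by measurable
    then show ?thesis by measurable
  qed
  have int: "integrable M (\<lambda>q. f (P (U q) (V q)))" if f: "continuous_on UNIV f" for f :: "real \<times> real \<Rightarrow> real"
  proof -
    have "compact sq" unfolding sq_def by (intro compact_Times compact_Icc)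
    then have "bounded (f ` sq)" by (intro compact_imp_bounded compact_continuous_image continuous_on_subset[OF f]) auto
    then obtain B where B: "\<And>z. z \<in> sq \<Longrightarrow> \<bar>f z\<bar> \<le> B" unfolding bounded_iff by auto
    show ?thesis by (rule integrable_const_bound[where B=B]) (auto intro!: B Psq meas f)
  qed
  have span: "continuous_on UNIV f \<and> (\<lambda>n. ?A n f) \<longlonglongrightarrow> ?L f" if "f \<in> monomial_span" for f
    using that
  proof (induction rule: monomial_span.induct)
    case (monomial i j)
    have "fst (P x y) ^ i * snd (P x y) ^ j = gmono i j x y" for x y
      by (simp only: P_def gmono_def fst_conv snd_conv exp_of_nat_mult[symmetric] exp_add[symmetric]) simp
    then show ?case using conv[of i j] by (simp add: A_def L_def continuous_intros)
  next
    case (add f g)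
    then have "(\<lambda>n. ?A n f + ?A n g) \<longlonglongrightarrow> ?L f + ?L g"
      by (intro tendsto_add) auto
    moreover have "L (\<lambda>x y. f (P x y) + g (P x y)) = ?L f + ?L g"
      unfolding L_def using add int by (intro Bochner_Integration.integral_add) auto
    ultimately show ?case using add by (simp add: A_add continuous_on_add)
  next
    case (scale f c)
    then have "(\<lambda>n. c * ?A n f) \<longlonglongrightarrow> c * ?L f"
      by (intro tendsto_mult_left) auto
    then show ?case using scale by (simp add: A_scale L_def continuous_on_mult_left)
  qed
  have cont: "(\<lambda>n. ?A n f) \<longlonglongrightarrow> ?L f" if f: "continuous_on UNIV f" for f
  proof (rule LIMSEQ_I)
    fix r :: real assume r: "r > 0"
    have "compact sq" unfolding sq_def by (intro compact_Times compact_Icc)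
    moreover have "continuous_on sq f" by (rule continuous_on_subset[OF f]) simp
    ultimately obtain g where g: "real_polynomial_function g" "\<And>z. z \<in> sq \<Longrightarrow> \<bar>f z - g z\<bar> < r / 4"
      using Stone_Weierstrass_real_polynomial_function[of sq f "r / 4"] r by auto
    note gs = span[OF real_polynomial_function_in_span[OF g(1)]]
    from gs have "(\<lambda>n. ?A n g) \<longlonglongrightarrow> ?L g" by blast
    from LIMSEQ_D[OF this, of "r / 4"] r obtain N
      where N: "\<And>n. n \<ge> N \<Longrightarrow> \<bar>?A n g - ?L g\<bar> < r / 4" by auto
    have le: "\<bar>f (P x y) - g (P x y)\<bar> \<le> r / 4" for x y using g(2)[OF Psq[of x y]] by simp
    have "\<bar>?L f - ?L g\<bar> \<le> r / 4"
    proof -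
      have "\<bar>?L f - ?L g\<bar> = \<bar>expectation (\<lambda>q. f (P (U q) (V q)) - g (P (U q) (V q)))\<bar>"
        unfolding L_def using int[OF f] int gs by simp
      also have "\<dots> \<le> expectation (\<lambda>q. \<bar>f (P (U q) (V q)) - g (P (U q) (V q))\<bar>)" by (rule integral_abs_bound)
      also have "\<dots> \<le> expectation (\<lambda>q. r / 4)" using int[OF f] int gs le by (intro integral_mono) auto
      finally show ?thesis by (simp add: prob_space)
    qed
    moreover have "\<bar>?A n f - ?A n g\<bar> \<le> r / 4" for n
      by (rule order_trans[OF A_diff[OF le] A_const]) (use r in simp)
    note AL = calculation this
    have "\<bar>?A n f - ?L f\<bar> < r" if "n \<ge> N" for n
      using N[OF that] AL(1) AL(2)[of n] r by linarith
    then show "\<exists>N. \<forall>n\<ge>N. norm (?A n f - ?L f) < r" by auto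
  qed
  define \<kappa> where "\<kappa> m z = 1 - cutoff m (fst z * snd z)" for m and z :: "real \<times> real"
  have c\<kappa>: "continuous_on UNIV (\<kappa> m)" for m
    unfolding \<kappa>_def by (intro continuous_intros continuous_on_cutoff)
  \<comment> \<open>The error of the cut ratio is bounded by a continuous function, to which the
    convergence just proved applies as well: small mean under the limit law implies eventually small
    averages.\<close>
  have near: "\<bar>sd_ratio x y - cut_ratio m (P x y)\<bar> \<le> \<kappa> m (P x y)" if "m > 0" for m x y
  proof -
    have "sd_ratio x y - cut_ratio m (P x y) = \<kappa> m (P x y) * sd_ratio x y"
      using cut_ratio_eq[OF that, of x y] by (simp add: P_def \<kappa>_def algebra_simps)
    moreover have "0 \<le> \<kappa> m (P x y)" using cutoff_bounds by (simp add: \<kappa>_def)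
    ultimately show ?thesis
      using sd_ratio_nonneg[of x y] sd_ratio_le_1[of x y] by (simp add: abs_mult mult_left_le)
  qed
  have L\<kappa>: "(\<lambda>m. ?L (\<kappa> m)) \<longlonglongrightarrow> 0"
  proof -
    have "(\<lambda>m. expectation (\<lambda>q. \<kappa> m (P (U q) (V q)))) \<longlonglongrightarrow> expectation (\<lambda>q. 0)"
    proof (rule integral_dominated_convergence[where w="\<lambda>q. 1"])
      show "AE q in M. (\<lambda>m. \<kappa> m (P (U q) (V q))) \<longlonglongrightarrow> 0"
        using nz
      proof eventually_elim
        case (elim q)
        let ?w = "exp (- (U q)\<^sup>2) * exp (- (V q)\<^sup>2)"
        have "?w = exp (- ((U q)\<^sup>2 + (V q)\<^sup>2))" by (simp flip: exp_add)
        moreover have "(U q)\<^sup>2 + (V q)\<^sup>2 > 0" using elim by (simp add: sum_power2_gt_zero_iff)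
        ultimately have "?w < 1" by simp
        then have "(\<lambda>m. 1 - cutoff m ?w) \<longlonglongrightarrow> 1 - 1"
          by (intro tendsto_diff tendsto_const cutoff_tendsto_1) auto
        then show ?case by (simp add: \<kappa>_def P_def)
      qed
      show "AE q in M. norm (\<kappa> m (P (U q) (V q))) \<le> 1" for m
        using cutoff_bounds by (intro AE_I2) (auto simp: \<kappa>_def)
    qed (auto intro: meas c\<kappa>)
    then show ?thesis by (simp add: L_def)
  qed
  have "(\<lambda>n. A n sd_ratio) \<longlonglongrightarrow> L sd_ratio"
  proof (rule LIMSEQ_I)
    fix r :: real assume r: "r > 0"
    have "\<forall>\<^sub>F m in sequentially. ?L (\<kappa> m) < r / 4 \<and> m > 0"
      by (intro eventually_conj order_tendstoD(2)[OF L\<kappa>] eventually_gt_at_top) (use r in simp)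
    then obtain m where m: "?L (\<kappa> m) < r / 4" "m > 0"
      using eventually_happens trivial_limit_sequentially by blast
    note ch = continuous_on_cut_ratio[OF m(2), of UNIV]
    have "(\<lambda>n. ?A n (cut_ratio m)) \<longlonglongrightarrow> ?L (cut_ratio m)" by (rule cont[OF ch])
    from LIMSEQ_D[OF this, of "r / 4"] r obtain N1
      where N1: "\<And>n. n \<ge> N1 \<Longrightarrow> \<bar>?A n (cut_ratio m) - ?L (cut_ratio m)\<bar> < r / 4" by auto
    have "(\<lambda>n. ?A n (\<kappa> m)) \<longlonglongrightarrow> ?L (\<kappa> m)" by (rule cont[OF c\<kappa>])
    from order_tendstoD(2)[OF this m(1)] obtain N2 where N2: "\<And>n. n \<ge> N2 \<Longrightarrow> ?A n (\<kappa> m) < r / 4"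
      unfolding eventually_sequentially by auto
    have "\<bar>L sd_ratio - ?L (cut_ratio m)\<bar> \<le> ?L (\<kappa> m)"
    proof -
      have i: "integrable M (\<lambda>q. sd_ratio (U q) (V q))"
        by (rule integrable_const_bound[where B=1]) (auto simp: sd_ratio_nonneg sd_ratio_le_1)
      have "\<bar>L sd_ratio - ?L (cut_ratio m)\<bar> = \<bar>expectation (\<lambda>q. sd_ratio (U q) (V q) - cut_ratio m (P (U q) (V q)))\<bar>"
        unfolding L_def using i int[OF ch] by simp
      also have "\<dots> \<le> expectation (\<lambda>q. \<bar>sd_ratio (U q) (V q) - cut_ratio m (P (U q) (V q))\<bar>)" by (rule integral_abs_bound)
      also have "\<dots> \<le> expectation (\<lambda>q. \<kappa> m (P (U q) (V q)))"
        using i int[OF ch] int[OF c\<kappa>] near[OF m(2)] by (intro integral_mono) auto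
      finally show ?thesis by (simp add: L_def)
    qed
    moreover have "\<bar>A n sd_ratio - ?A n (cut_ratio m)\<bar> \<le> ?A n (\<kappa> m)" for n
      by (rule A_diff) (rule near[OF m(2)])
    note AL = calculation this
    have "\<bar>A n sd_ratio - L sd_ratio\<bar> < r" if "n \<ge> max N1 N2" for n
      using N1[of n] N2[of n] AL(1) AL(2)[of n] that m(1) r by linarith
    then show "\<exists>N. \<forall>n\<ge>N. norm (A n sd_ratio - L sd_ratio) < r" unfolding real_norm_def by blast
  qed
  then show ?thesis by (simp add: A_def L_def)
qed

section \<open>The limit as an expectation at a uniform random time\<close>

abbreviation unit_interval :: "real measure" where
  "unit_interval \<equiv> restrict_space lborel {0..1}"

lemma measurable_unit_interval:
  fixes f :: "real \<Rightarrow> real"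
  assumes "continuous_on {0..1} f"
  shows "f \<in> borel_measurable unit_interval"
  using borel_measurable_continuous_on_restrict[OF assms]
  by (simp add: measurable_def space_restrict_space sets_restrict_space)

interpretation unit_interval: prob_space unit_interval
  by (rule prob_space_restrict_space) auto

interpretation unit_normal: pair_prob_space unit_interval normal2 ..

lemma expectation_sd_ratio_normal:
  assumes p: "p \<in> {1, 2}" and h: "0 < h" "h < 1"
  shows "(\<integral>z. sd_ratio (sqrt (sum_var p h) * fst z) (sqrt (diff_var p h) * snd z) \<partial>normal2) = Lambda_fun p h"
proof -
  let ?a = "sum_var p h" and ?b = "diff_var p h"
  let ?c = "sqrt ?a / sqrt ?b"
  have pos: "?a > 0" "?b > 0" using sum_var_pos[OF p h] diff_var_pos[OF p h] by auto
  have "(\<integral>\<^sup>+z. ennreal (sd_ratio (sqrt ?a * fst z) (sqrt ?b * snd z)) \<partial>normal2)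
    = (\<integral>\<^sup>+y. \<integral>\<^sup>+x. ennreal (sd_ratio (sqrt ?a * x) (sqrt ?b * y)) \<partial>std_normal \<partial>std_normal)"
    by (subst normal2.nn_integral_snd[symmetric]) (auto simp: split_beta')
  also have "\<dots> = ennreal (Lambda_fun p h)"
    using nn_integral_sd_ratio_normal[of "sqrt ?a" "sqrt ?b"] pos
    by (simp add: Lambda_fun_eq[OF p h] lambda_fun_eq_arctan)
  finally have nn: "(\<integral>\<^sup>+z. ennreal (sd_ratio (sqrt ?a * fst z) (sqrt ?b * snd z)) \<partial>normal2) = ennreal (Lambda_fun p h)" .
  \<comment> \<open>\<open>ennreal\<close> sends negative numbers to 0, so the sign is needed to
    read off the real value.\<close>
  have "0 \<le> Lambda_fun p h"
  proof -
    have c: "?c > 0" using pos by simp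
    then have "0 \<le> ln (1 + 1 / ?c\<^sup>2)" by (intro ln_ge_zero) simp
    then have "0 \<le> ?c * ln (1 + 1 / ?c\<^sup>2)" using c by (intro mult_nonneg_nonneg) auto
    moreover have "0 \<le> 2 * arctan ?c" using c by (simp add: zero_le_arctan_iff less_imp_le del: real_sqrt_divide)
    ultimately show ?thesis unfolding Lambda_fun_eq[OF p h] lambda_fun_eq_arctan[OF pos] by (intro mult_nonneg_nonneg add_nonneg_nonneg) auto
  qed
  then show ?thesis
    using nn by (subst integral_eq_nn_integral) (auto simp: sd_ratio_nonneg)
qed

theorem theorem4p1:
  fixes M :: "'a measure"
    and X :: "real \<Rightarrow> 'a \<Rightarrow> real"
    and H :: "real \<Rightarrow> real"
    and p :: nat
  assumes "prob_space M"
    and "p \<in> {1, 2}"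
    and "centered_gaussian_process M {0..1} X"
    and "AE \<omega> in M. X 0 \<omega> = 0"
    and "assumption_A1 M X H"
    and "assumption_A2 p M X"
  shows "AE \<omega> in M.
           (\<lambda>n. incr_ratio_stat p n (\<lambda>t. X t \<omega>))
             \<longlonglongrightarrow> (LBINT t:{0..1}. Lambda_fun p (H t))"
proof -
  interpret gauss_process M X
    using assms(1,3) by (simp add: gauss_process_def gauss_process_axioms_def)
  note p = assms(2)
  have cH: "continuous_on {0..1} H" and H: "\<And>t. t \<in> {0..1} \<Longrightarrow> 0 < H t \<and> H t < 1"
    using assms(5) by (auto simp: assumption_A1_def)
  have pos: "sum_var p (H t) > 0" "diff_var p (H t) > 0" if "t \<in> {0..1}" for t
    using H[OF that] p by (auto intro: sum_var_pos diff_var_pos)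
  from assumption_A1_variances[OF assms(5) p] obtain \<tau> where tpos: "\<And>n k. k < n \<Longrightarrow> \<tau> n k > 0"
    and var: "\<And>e. e > 0 \<Longrightarrow> \<forall>\<^sub>F n in sequentially. \<forall>k<n - p. close_variances p \<tau> H e n k"
    by blast
  have lln: "AE \<omega> in M. (\<lambda>n. 1 / real (n - p) * (\<Sum>k=1..<n - p. gmono i j (nsum p \<tau> n k \<omega>) (ndiff p \<tau> n k \<omega>)))
     \<longlonglongrightarrow> integral {0..1} (\<lambda>t. gmono_mean i j p (H t))" for i j
    by (rule monomial_lln[OF assms(6) p cH H tpos var])
  \<comment> \<open>A uniform time independent of the Gaussian pair turns integrals over
    \<open>t\<close> of local means into one expectation, the form required by
    \<open>sd_ratio_average_tendsto\<close>.\<close>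
  let ?Q = "unit_interval \<Otimes>\<^sub>M normal2"
  define U where "U q = sqrt (sum_var p (H (fst q))) * fst (snd q)" for q :: "real \<times> real \<times> real"
  define V where "V q = sqrt (diff_var p (H (fst q))) * snd (snd q)" for q :: "real \<times> real \<times> real"
  have [measurable]: "(\<lambda>t. sum_var p (H t)) \<in> borel_measurable unit_interval"
    "(\<lambda>t. diff_var p (H t)) \<in> borel_measurable unit_interval"
    by (intro measurable_unit_interval continuous_intros cH)+
  have UV [measurable]: "U \<in> borel_measurable ?Q" "V \<in> borel_measurable ?Q"
    unfolding U_def[abs_def] V_def[abs_def] by measurable
  have sp: "t \<in> {0..1}" if "t \<in> space unit_interval" for t
    using that by (simp add: space_restrict_space)
  have mean: "integral {0..1} (\<lambda>t. gmono_mean i j p (H t)) = unit_normal.P.expectation (\<lambda>q. gmono i j (U q) (V q))" for i j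
  proof -
    have i: "integrable ?Q (\<lambda>q. gmono i j (U q) (V q))"
      by (rule unit_normal.P.integrable_const_bound[where B=1]) (auto simp: abs_gmono_le)
    have "unit_normal.P.expectation (\<lambda>q. gmono i j (U q) (V q)) = (\<integral>t. gmono_mean i j p (H t) \<partial>unit_interval)"
      unfolding unit_normal.integral_fst'[OF i, symmetric] by (simp add: U_def V_def gmono_mean_def)
    also have "\<dots> = (LBINT t:{0..1}. gmono_mean i j p (H t))"
      by (simp add: integral_restrict_space set_lebesgue_integral_def)
    also have "\<dots> = integral {0..1} (\<lambda>t. gmono_mean i j p (H t))"
      by (intro set_borel_integral_eq_integral borel_integrable_atLeastAtMost' continuous_on_gmono_mean cH H p)
    finally show ?thesis by simp
  qed
  have nz: "AE q in ?Q. U q \<noteq> 0 \<or> V q \<noteq> 0"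
  proof (rule unit_normal.AE_pair_measure)
    show "{q \<in> space ?Q. U q \<noteq> 0 \<or> V q \<noteq> 0} \<in> sets ?Q" by measurable
    have "AE x in std_normal. x \<noteq> 0"
      using AE_lborel_singleton[of "0::real"] by (subst AE_density) (auto elim: eventually_mono)
    then have ae: "AE x in std_normal. AE y in std_normal. fst (x, y) \<noteq> 0" by simp
    have z: "AE z in normal2. fst z \<noteq> 0"
      by (rule normal2.AE_pair_measure[OF _ ae]) measurable
    show "AE t in unit_interval. AE z in normal2. U (t, z) \<noteq> 0 \<or> V (t, z) \<noteq> 0"
    proof (rule AE_I2)
      fix t assume "t \<in> space unit_interval"
      then have "sum_var p (H t) > 0" by (intro pos(1) sp)
      then have "sqrt (sum_var p (H t)) \<noteq> 0" by simp
      then show "AE z in normal2. U (t, z) \<noteq> 0 \<or> V (t, z) \<noteq> 0"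
        using z by (auto simp: U_def)
    qed
  qed
  have limit: "unit_normal.P.expectation (\<lambda>q. sd_ratio (U q) (V q)) = (LBINT t:{0..1}. Lambda_fun p (H t))"
  proof -
    have i: "integrable ?Q (\<lambda>q. sd_ratio (U q) (V q))"
      by (rule unit_normal.P.integrable_const_bound[where B=1]) (auto simp: sd_ratio_nonneg sd_ratio_le_1)
    have "unit_normal.P.expectation (\<lambda>q. sd_ratio (U q) (V q)) = (\<integral>t. Lambda_fun p (H t) \<partial>unit_interval)"
      unfolding unit_normal.integral_fst'[OF i, symmetric]
    proof (rule Bochner_Integration.integral_cong[OF refl])
      fix t assume "t \<in> space unit_interval"
      then have "0 < H t" "H t < 1" using H sp by auto
      from expectation_sd_ratio_normal[OF p this]
      show "(\<integral>z. sd_ratio (U (t, z)) (V (t, z)) \<partial>normal2) = Lambda_fun p (H t)"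
        by (simp add: U_def V_def)
    qed
    also have "\<dots> = (LBINT t:{0..1}. Lambda_fun p (H t))"
      by (simp add: integral_restrict_space set_lebesgue_integral_def)
    finally show ?thesis .
  qed
  \<comment> \<open>There are countably many monomials, so one null set serves for all of
    them.\<close>
  have "AE \<omega> in M. \<forall>i j. (\<lambda>n. 1 / real (n - p) * (\<Sum>k=1..<n - p. gmono i j (nsum p \<tau> n k \<omega>) (ndiff p \<tau> n k \<omega>)))
     \<longlonglongrightarrow> integral {0..1} (\<lambda>t. gmono_mean i j p (H t))"
    using lln by (simp add: AE_all_countable)
  then show ?thesis
  proof eventually_elim
    case (elim \<omega>)
    let ?A = "\<lambda>n. 1 / real (n - p) * (\<Sum>k=1..<n - p. sd_ratio (nsum p \<tau> n k \<omega>) (ndiff p \<tau> n k \<omega>))"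
    have main: "(\<lambda>n. ?A n)
      \<longlonglongrightarrow> (LBINT t:{0..1}. Lambda_fun p (H t))"
      unfolding limit[symmetric]
      by (rule unit_normal.P.sd_ratio_average_tendsto[OF UV _ nz]) (use elim in \<open>simp add: mean\<close>)
    let ?f = "\<lambda>n k. incr_ratio (D p n k \<omega>) (D p n (k + 1) \<omega>)"
    have f: "?f n k = sd_ratio (nsum p \<tau> n k \<omega>) (ndiff p \<tau> n k \<omega>)" if "k < n - p" for n k
    proof -
      have "\<tau> n k > 0" using that by (intro tpos) auto
      then show ?thesis by (simp add: nsum_def ndiff_def sd_ratio_scale incr_ratio_eq_sd_ratio)
    qed
    \<comment> \<open>The ratio with index 0 lies between 0 and 1, so it contributes at most
      \<open>1/(n - p)\<close>.\<close>
    have "(\<lambda>n. 1 / real (n - p) * ?f n 0) \<longlonglongrightarrow> 0"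
    proof (rule Lim_null_comparison)
      have "0 \<le> ?f n 0" "?f n 0 \<le> 1" for n
        by (simp_all add: incr_ratio_eq_sd_ratio sd_ratio_nonneg sd_ratio_le_1)
      then show "\<forall>\<^sub>F n in sequentially. norm (1 / real (n - p) * ?f n 0) \<le> 1 / real (n - p)"
        by (intro always_eventually allI) (simp add: divide_right_mono)
      have "(\<lambda>n. 1 / real (n + p - p)) \<longlonglongrightarrow> 0" using lim_1_over_n by simp
      then show "(\<lambda>n. 1 / real (n - p)) \<longlonglongrightarrow> 0" by (rule LIMSEQ_offset[where k=p])
    qed
    from tendsto_add[OF this main]
    have "(\<lambda>n. 1 / real (n - p) * ?f n 0 + ?A n)
      \<longlonglongrightarrow> (LBINT t:{0..1}. Lambda_fun p (H t))" by simp
    moreover have "\<forall>\<^sub>F n in sequentially. 1 / real (n - p) * ?f n 0 + ?A n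
       = incr_ratio_stat p n (\<lambda>t. X t \<omega>)"
      using eventually_gt_at_top[of p]
    proof eventually_elim
      case (elim n)
      have "{..<n - p} = insert 0 {1..<n - p}" using elim by auto
      then have "(\<Sum>k<n - p. ?f n k) = ?f n 0 + (\<Sum>k=1..<n - p. ?f n k)" by simp
      also have "(\<Sum>k=1..<n - p. ?f n k) = (\<Sum>k=1..<n - p. sd_ratio (nsum p \<tau> n k \<omega>) (ndiff p \<tau> n k \<omega>))"
        by (rule sum.cong[OF refl], rule f) auto
      finally show ?case by (simp add: incr_ratio_stat_def distrib_left)
    qed
    ultimately show ?case by (rule Lim_transform_eventually)
  qed
qed

end
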